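(* A countable group $G$ has Property $P(3)$ if and only if the centre of $G$ does not contain any subgroup isomorphic to $C_2 \times C_2$.
   Context: Countable means finite or countably infinite. $C_2$ is the cyclic group of order $2$. A subset $F$ of a group $G$ is irreducibly faithful if there exists an irreducible unitary representation $\pi$ of $G$ (in a Hilbert space) such that $\pi(x) \ne \mathrm{id}$ for all $x \in F$ with $x \ne e$. For $n \ge 1$, $G$ has Property $P(n)$ if every subset of $G$ of size at most $n$ is irreducibly faithful. *)

theory Defs
  imports
    "HOL-Analysis.Abstract_Metric_Spaces"
    "HOL-Algebra.Module"
    "HOL-Algebra.Bij"
    "HOL-Algebra.Elementary_Groups"
    "HOL-Algebra.Algebraic_Closure_Type"
    "HOL-Library.Countable_Set"
begin

section \<open>Complex Hilbert spaces with explicit carriers\<close>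

text \<open>
  Irreducible faithfulness quantifies existentially over Hilbert spaces, so these are records rather
  than types. The ring fields \<open>mult\<close> and \<open>one\<close> inherited from \<open>module\<close> are
  unconstrained.
\<close>

abbreviation complex_field :: "complex ring" where
  "complex_field \<equiv> ring_of_type_algebra"

lemma complex_field_simps [simp]:
  "carrier complex_field = UNIV" "monoid.mult complex_field = (*)" "one complex_field = 1"
  "zero complex_field = 0" "add complex_field = (+)"
  by (auto simp: ring_of_type_algebra_def)

record 'h hilbert = "(complex, 'h) module" +
  hinner :: "'h \<Rightarrow> 'h \<Rightarrow> complex"

text \<open>
  The value outside the carrier makes \<open>hdist\<close> satisfy the locale \<open>Metric_space\<close>, which requires
  nonnegativity and symmetry on the whole type.
\<close>

definition hdist :: "('h, 'z) hilbert_scheme \<Rightarrow> 'h \<Rightarrow> 'h \<Rightarrow> real" where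
  "hdist V x y = (if x \<in> carrier V \<and> y \<in> carrier V
     then sqrt (Re (hinner V (x \<ominus>\<^bsub>V\<^esub> y) (x \<ominus>\<^bsub>V\<^esub> y))) else 0)"

locale complex_inner_space = module complex_field V for V :: "('h, 'z) hilbert_scheme" (structure) +
  assumes hinner_add_left:
      "\<lbrakk>x \<in> carrier V; y \<in> carrier V; z \<in> carrier V\<rbrakk> \<Longrightarrow>
        hinner V (x \<oplus> y) z = hinner V x z + hinner V y z"
    and hinner_smult_left:
      "\<lbrakk>x \<in> carrier V; y \<in> carrier V\<rbrakk> \<Longrightarrow> hinner V (c \<odot> x) y = c * hinner V x y"
    and hinner_commute:
      "\<lbrakk>x \<in> carrier V; y \<in> carrier V\<rbrakk> \<Longrightarrow> hinner V y x = cnj (hinner V x y)"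
    and hinner_pos:
      "\<lbrakk>x \<in> carrier V; x \<noteq> \<zero>\<rbrakk> \<Longrightarrow> 0 < Re (hinner V x x)"

locale complex_hilbert_space = complex_inner_space +
  assumes complete: "Metric_space.mcomplete (carrier V) (hdist V)"

definition closed_subspace :: "'h set \<Rightarrow> ('h, 'z) hilbert_scheme \<Rightarrow> bool" where
  "closed_subspace W V \<longleftrightarrow> submodule W complex_field V \<and>
     closedin (Metric_space.mtopology (carrier V) (hdist V)) W"

definition unitary_operators :: "('h, 'z) hilbert_scheme \<Rightarrow> ('h \<Rightarrow> 'h) set" where
  "unitary_operators V = {u \<in> Bij (carrier V).
     (\<forall>x\<in>carrier V. \<forall>y\<in>carrier V. u (x \<oplus>\<^bsub>V\<^esub> y) = u x \<oplus>\<^bsub>V\<^esub> u y) \<and>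
     (\<forall>c. \<forall>x\<in>carrier V. u (c \<odot>\<^bsub>V\<^esub> x) = c \<odot>\<^bsub>V\<^esub> u x) \<and>
     (\<forall>x\<in>carrier V. \<forall>y\<in>carrier V. hinner V (u x) (u y) = hinner V x y)}"

definition unitary_group :: "('h, 'z) hilbert_scheme \<Rightarrow> ('h \<Rightarrow> 'h) monoid" where
  "unitary_group V = (BijGroup (carrier V))\<lparr>carrier := unitary_operators V\<rparr>"


section \<open>Irreducible unitary representations\<close>

locale unitary_representation = G: group G + V: complex_hilbert_space V
  for G :: "('a, 'b) monoid_scheme" and V :: "('h, 'z) hilbert_scheme"
    and \<pi> :: "'a \<Rightarrow> 'h \<Rightarrow> 'h" +
  assumes hom: "\<pi> \<in> hom G (unitary_group V)"

locale irreducible_unitary_representation = unitary_representation G V \<pi>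
  for G :: "('a, 'b) monoid_scheme" and V :: "('h, 'z) hilbert_scheme" and \<pi> +
  assumes nonzero: "carrier V \<noteq> {\<zero>\<^bsub>V\<^esub>}"
    and irreducible:
      "\<lbrakk>closed_subspace W V; \<And>g. g \<in> carrier G \<Longrightarrow> \<pi> g ` W \<subseteq> W\<rbrakk> \<Longrightarrow> W = {\<zero>\<^bsub>V\<^esub>} \<or> W = carrier V"

text \<open>
  HOL cannot quantify over the type of the vectors inside a definition, so the Hilbert space has its
  carrier in the fixed type \<open>'a \<Rightarrow> complex\<close>; its operations and inner product are arbitrary. This
  loses no generality for any group on \<open>'a\<close>: see \<open>irreducibly_faithful_any_type\<close> below.
\<close>

definition irreducibly_faithful :: "('a, 'b) monoid_scheme \<Rightarrow> 'a set \<Rightarrow> bool" where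
  "irreducibly_faithful G F \<longleftrightarrow>
     (\<exists>(V :: ('a \<Rightarrow> complex) hilbert) \<pi>. irreducible_unitary_representation G V \<pi> \<and>
       (\<forall>x\<in>F. x \<noteq> \<one>\<^bsub>G\<^esub> \<longrightarrow> \<pi> x \<noteq> \<one>\<^bsub>unitary_group V\<^esub>))"

definition property_P :: "('a, 'b) monoid_scheme \<Rightarrow> nat \<Rightarrow> bool" where
  "property_P G n \<longleftrightarrow>
     (\<forall>F. F \<subseteq> carrier G \<and> finite F \<and> card F \<le> n \<longrightarrow> irreducibly_faithful G F)"

definition group_centre :: "('a, 'b) monoid_scheme \<Rightarrow> 'a set" where
  "group_centre G = {z \<in> carrier G. \<forall>g\<in>carrier G. z \<otimes>\<^bsub>G\<^esub> g = g \<otimes>\<^bsub>G\<^esub> z}"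


section \<open>Independence of the type of vectors\<close>

context complex_inner_space
begin

lemma hinner_add_right:
  "\<lbrakk>x \<in> carrier V; y \<in> carrier V; z \<in> carrier V\<rbrakk> \<Longrightarrow>
    hinner V z (x \<oplus> y) = hinner V z x + hinner V z y"
  by (metis M.add.m_closed complex_cnj_add hinner_add_left hinner_commute)

lemma hinner_smult_right:
  "\<lbrakk>x \<in> carrier V; y \<in> carrier V\<rbrakk> \<Longrightarrow> hinner V y (c \<odot> x) = cnj c * hinner V y x"
  using hinner_commute[of "c \<odot> x" y] hinner_commute[of x y] hinner_smult_left[of x y c]
  by (simp add: smult_closed)

lemma hinner_zero_left [simp]: "y \<in> carrier V \<Longrightarrow> hinner V \<zero> y = 0"
  using hinner_add_left[of \<zero> \<zero> y] by simp

lemma hinner_zero_right [simp]: "y \<in> carrier V \<Longrightarrow> hinner V y \<zero> = 0"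
  using hinner_add_right[of \<zero> \<zero> y] by simp

lemma hinner_uminus_left: "\<lbrakk>x \<in> carrier V; y \<in> carrier V\<rbrakk> \<Longrightarrow> hinner V (\<ominus> x) y = - hinner V x y"
  using hinner_add_left[of x "\<ominus> x" y] by (simp add: r_neg eq_neg_iff_add_eq_0 add.commute)

lemma hinner_uminus_right: "\<lbrakk>x \<in> carrier V; y \<in> carrier V\<rbrakk> \<Longrightarrow> hinner V y (\<ominus> x) = - hinner V y x"
  using hinner_add_right[of x "\<ominus> x" y] by (simp add: r_neg eq_neg_iff_add_eq_0 add.commute)

lemma hinner_minus_left:
  "\<lbrakk>x \<in> carrier V; y \<in> carrier V; z \<in> carrier V\<rbrakk> \<Longrightarrow>
    hinner V (x \<ominus> y) z = hinner V x z - hinner V y z"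
  by (simp add: a_minus_def hinner_add_left hinner_uminus_left)

lemma hinner_minus_right:
  "\<lbrakk>x \<in> carrier V; y \<in> carrier V; z \<in> carrier V\<rbrakk> \<Longrightarrow>
    hinner V z (x \<ominus> y) = hinner V z x - hinner V z y"
  by (simp add: a_minus_def hinner_add_right hinner_uminus_right)

lemma minus_zero_imp_eq:
  assumes "x \<ominus> y = \<zero>" "x \<in> carrier V" "y \<in> carrier V"
  shows "x = y"
proof -
  have "x = (x \<ominus> y) \<oplus> y" using assms(2,3) by (simp add: a_minus_def a_assoc l_neg)
  then show ?thesis using assms by simp
qed

lemma hinner_self_Im: "x \<in> carrier V \<Longrightarrow> Im (hinner V x x) = 0"
  using hinner_commute[of x x] by (simp add: complex_eq_iff)

lemma hinner_self_ge0: "x \<in> carrier V \<Longrightarrow> 0 \<le> Re (hinner V x x)"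
  by (metis hinner_pos hinner_zero_left less_eq_real_def zero_complex.simps(1) zero_closed)

lemma hinner_self_eq_0: "x \<in> carrier V \<Longrightarrow> Re (hinner V x x) = 0 \<longleftrightarrow> x = \<zero>"
  by (metis hinner_pos hinner_zero_left less_irrefl zero_complex.simps(1) zero_closed)

lemma Cauchy_Schwarz:
  assumes x: "x \<in> carrier V" and y: "y \<in> carrier V"
  shows "(cmod (hinner V x y))\<^sup>2 \<le> Re (hinner V x x) * Re (hinner V y y)"
proof (cases "y = \<zero>")
  case True
  then show ?thesis using x by simp
next
  case False
  define a where "a = Re (hinner V y y)"
  define b where "b = hinner V x y"
  define c where "c = b / of_real a"
  have a: "a > 0" using False y hinner_pos by (simp add: a_def)
  have yy: "hinner V y y = of_real a"
    using hinner_self_Im[OF y] by (simp add: a_def complex_eq_iff)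
  have yx: "hinner V y x = cnj b" using hinner_commute[OF x y] by (simp add: b_def)
  have cy: "c \<odot> y \<in> carrier V" using y by (simp add: smult_closed)
  have "hinner V (x \<ominus> c \<odot> y) (x \<ominus> c \<odot> y) =
      hinner V x x - cnj c * b - c * cnj b + c * cnj c * of_real a"
    using x y cy
    by (simp add: hinner_minus_left hinner_minus_right hinner_smult_left hinner_smult_right
        yy yx b_def[symmetric] algebra_simps)
  also have "\<dots> = hinner V x x - (b * cnj b) / of_real a"
    using a by (simp add: c_def field_simps)
  also have "b * cnj b = of_real ((cmod b)\<^sup>2)"
    by (rule complex_norm_square[symmetric])
  finally have "Re (hinner V (x \<ominus> c \<odot> y) (x \<ominus> c \<odot> y)) = Re (hinner V x x) - (cmod b)\<^sup>2 / a"
    by (simp add: Re_divide_of_real)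
  moreover have "0 \<le> Re (hinner V (x \<ominus> c \<odot> y) (x \<ominus> c \<odot> y))"
    using x cy by (intro hinner_self_ge0) simp
  ultimately have "(cmod b)\<^sup>2 / a \<le> Re (hinner V x x)" by simp
  then show ?thesis using a by (simp add: a_def b_def field_simps)
qed

lemma hdist_Cauchy_Schwarz:
  assumes "x \<in> carrier V" "y \<in> carrier V" "z \<in> carrier V"
  shows "cmod (hinner V (x \<ominus> y) z) \<le> hdist V x y * sqrt (Re (hinner V z z))"
proof -
  have "sqrt ((cmod (hinner V (x \<ominus> y) z))\<^sup>2)
      \<le> sqrt (Re (hinner V (x \<ominus> y) (x \<ominus> y)) * Re (hinner V z z))"
    using assms by (intro real_sqrt_le_mono Cauchy_Schwarz) auto
  then show ?thesis using assms by (simp add: hdist_def real_sqrt_mult)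
qed

lemma norm_triangle:
  assumes u: "u \<in> carrier V" and w: "w \<in> carrier V"
  shows "sqrt (Re (hinner V (u \<oplus> w) (u \<oplus> w)))
    \<le> sqrt (Re (hinner V u u)) + sqrt (Re (hinner V w w))"
proof -
  let ?a = "Re (hinner V u u)" and ?b = "Re (hinner V w w)"
  have ge: "?a \<ge> 0" "?b \<ge> 0" using u w hinner_self_ge0 by auto
  have "Re (hinner V u w) \<le> sqrt ((cmod (hinner V u w))\<^sup>2)" by (simp add: complex_Re_le_cmod)
  also have "\<dots> \<le> sqrt (?a * ?b)" by (intro real_sqrt_le_mono Cauchy_Schwarz u w)
  finally have *: "Re (hinner V u w) \<le> sqrt ?a * sqrt ?b" by (simp add: real_sqrt_mult)
  have "Re (hinner V (u \<oplus> w) (u \<oplus> w)) = ?a + ?b + 2 * Re (hinner V u w)"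
    using u w hinner_commute[of u w] by (simp add: hinner_add_left hinner_add_right)
  also have "\<dots> \<le> (sqrt ?a + sqrt ?b)\<^sup>2"
    using * ge by (simp add: power2_sum)
  finally show ?thesis
    using ge by (simp add: real_le_lsqrt)
qed

sublocale metric: Metric_space "carrier V" "hdist V"
proof
  fix x y z
  show "0 \<le> hdist V x y" by (simp add: hdist_def hinner_self_ge0)
  show "hdist V x y = hdist V y x"
    by (simp add: hdist_def hinner_minus_left hinner_minus_right)
  show "hdist V x y = 0 \<longleftrightarrow> x = y" if "x \<in> carrier V" "y \<in> carrier V"
    using that by (auto simp: hdist_def hinner_self_eq_0 a_minus_def r_neg dest: minus_zero_imp_eq[unfolded a_minus_def])
  show "hdist V x z \<le> hdist V x y + hdist V y z"
    if c: "x \<in> carrier V" "y \<in> carrier V" "z \<in> carrier V"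
  proof -
    have "x \<ominus> z = (x \<ominus> y) \<oplus> (y \<ominus> z)"
      using c by (simp add: a_minus_def a_assoc r_neg1 r_neg2)
    then show ?thesis using c norm_triangle[of "x \<ominus> y" "y \<ominus> z"] by (simp add: hdist_def)
  qed
qed

end

lemma unitary_group_simps [simp]:
  "carrier (unitary_group V) = unitary_operators V"
  "\<one>\<^bsub>unitary_group V\<^esub> = (\<lambda>x\<in>carrier V. x)"
  by (simp_all add: unitary_group_def BijGroup_def)

lemma unitary_group_mult:
  "\<lbrakk>u \<in> unitary_operators V; w \<in> unitary_operators V\<rbrakk> \<Longrightarrow>
    u \<otimes>\<^bsub>unitary_group V\<^esub> w = compose (carrier V) u w"
  by (simp add: unitary_group_def BijGroup_def unitary_operators_def)

lemma unitary_operators_closed: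
  "\<lbrakk>u \<in> unitary_operators V; x \<in> carrier V\<rbrakk> \<Longrightarrow> u x \<in> carrier V"
  by (auto simp: unitary_operators_def dest: Bij_imp_funcset)

definition matrix_coefficients ::
  "('a, 'b) monoid_scheme \<Rightarrow> ('h, 'z) hilbert_scheme \<Rightarrow> ('a \<Rightarrow> 'h \<Rightarrow> 'h) \<Rightarrow> 'h \<Rightarrow> 'h \<Rightarrow> 'a \<Rightarrow> complex" where
  "matrix_coefficients G V \<pi> v x = (\<lambda>g. if g \<in> carrier G then hinner V x (\<pi> g v) else 0)"

context unitary_representation
begin

lemma rep_unitary: "g \<in> carrier G \<Longrightarrow> \<pi> g \<in> unitary_operators V"
  using hom by (auto simp: hom_def)

lemma rep_closed [simp]: "\<lbrakk>g \<in> carrier G; x \<in> carrier V\<rbrakk> \<Longrightarrow> \<pi> g x \<in> carrier V"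
  by (rule unitary_operators_closed[OF rep_unitary])

lemma rep_mult:
  "\<lbrakk>g \<in> carrier G; h \<in> carrier G; x \<in> carrier V\<rbrakk> \<Longrightarrow> \<pi> (g \<otimes>\<^bsub>G\<^esub> h) x = \<pi> g (\<pi> h x)"
  using hom rep_unitary by (simp add: hom_def unitary_group_mult compose_def)

lemma rep_add:
  "\<lbrakk>g \<in> carrier G; x \<in> carrier V; y \<in> carrier V\<rbrakk> \<Longrightarrow> \<pi> g (x \<oplus>\<^bsub>V\<^esub> y) = \<pi> g x \<oplus>\<^bsub>V\<^esub> \<pi> g y"
  using rep_unitary by (auto simp: unitary_operators_def)

lemma rep_smult:
  "\<lbrakk>g \<in> carrier G; x \<in> carrier V\<rbrakk> \<Longrightarrow> \<pi> g (c \<odot>\<^bsub>V\<^esub> x) = c \<odot>\<^bsub>V\<^esub> \<pi> g x"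
  using rep_unitary by (auto simp: unitary_operators_def)

lemma rep_hinner:
  "\<lbrakk>g \<in> carrier G; x \<in> carrier V; y \<in> carrier V\<rbrakk> \<Longrightarrow> hinner V (\<pi> g x) (\<pi> g y) = hinner V x y"
  using rep_unitary by (auto simp: unitary_operators_def)

lemma rep_bij: "g \<in> carrier G \<Longrightarrow> bij_betw (\<pi> g) (carrier V) (carrier V)"
  using rep_unitary by (auto simp: unitary_operators_def Bij_def)

lemma rep_extensional: "g \<in> carrier G \<Longrightarrow> \<pi> g \<in> extensional (carrier V)"
  using rep_unitary by (auto simp: unitary_operators_def Bij_def)

end

lemma (in irreducible_unitary_representation) inj_on_matrix_coefficients:
  assumes v: "v \<in> carrier V" "v \<noteq> \<zero>\<^bsub>V\<^esub>"
  shows "inj_on (matrix_coefficients G V \<pi> v) (carrier V)"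
proof -
  define W where "W = {x \<in> carrier V. \<forall>g\<in>carrier G. hinner V x (\<pi> g v) = 0}"
  have "submodule W complex_field V"
    by (rule V.submoduleI)
      (auto simp: W_def v V.hinner_add_left V.hinner_uminus_left V.hinner_smult_left
        intro: V.smult_closed)
  moreover have "closedin V.metric.mtopology W"
    unfolding V.metric.closedin_metric
  proof (intro conjI allI impI)
    show "W \<subseteq> carrier V" by (auto simp: W_def)
    fix x assume x: "x \<in> carrier V - W"
    then obtain g where g: "g \<in> carrier G" "hinner V x (\<pi> g v) \<noteq> 0"
      by (auto simp: W_def)
    define n where "n = sqrt (Re (hinner V (\<pi> g v) (\<pi> g v)))"
    define r where "r = cmod (hinner V x (\<pi> g v)) / (n + 1)"
    have n: "n \<ge> 0" using g v V.hinner_self_ge0 by (simp add: n_def)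
    have r: "r > 0" using g n by (simp add: r_def)
    have "y \<notin> W" if y: "y \<in> carrier V" "hdist V x y < r" for y
    proof
      assume "y \<in> W"
      then have "hinner V (x \<ominus>\<^bsub>V\<^esub> y) (\<pi> g v) = hinner V x (\<pi> g v)"
        using x y g v by (simp add: W_def V.hinner_minus_left)
      then have "cmod (hinner V x (\<pi> g v)) \<le> hdist V x y * n"
        using V.hdist_Cauchy_Schwarz[of x y "\<pi> g v"] x y g v by (simp add: n_def)
      also have "\<dots> \<le> r * n"
        using y n by (intro mult_right_mono) auto
      also have "\<dots> < r * (n + 1)" using r by simp
      also have "\<dots> = cmod (hinner V x (\<pi> g v))" using n by (simp add: r_def)
      finally show False by simp
    qed
    then show "\<exists>r>0. disjnt W (V.metric.mball x r)"
      using r by (intro exI[of _ r]) (auto simp: disjnt_iff V.metric.in_mball)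
  qed
  ultimately have closed: "closed_subspace W V" by (simp add: closed_subspace_def)
  have invariant: "\<pi> h ` W \<subseteq> W" if h: "h \<in> carrier G" for h
  proof
    fix y assume "y \<in> \<pi> h ` W"
    then obtain x where x: "x \<in> W" and y: "y = \<pi> h x" by blast
    have "hinner V (\<pi> h x) (\<pi> g v) = 0" if g: "g \<in> carrier G" for g
    proof -
      have k: "inv\<^bsub>G\<^esub> h \<otimes>\<^bsub>G\<^esub> g \<in> carrier G" using g h by simp
      have "\<pi> g v = \<pi> (h \<otimes>\<^bsub>G\<^esub> (inv\<^bsub>G\<^esub> h \<otimes>\<^bsub>G\<^esub> g)) v"
        using g h by (simp add: G.m_assoc[symmetric])
      also have "\<dots> = \<pi> h (\<pi> (inv\<^bsub>G\<^esub> h \<otimes>\<^bsub>G\<^esub> g) v)" using h k v(1) by (rule rep_mult)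
      finally show ?thesis using x h k v by (simp add: rep_hinner W_def)
    qed
    then show "y \<in> W" using x y h by (simp add: W_def)
  qed
  have "W \<noteq> carrier V"
  proof
    assume "W = carrier V"
    then have "\<pi> \<one>\<^bsub>G\<^esub> v \<in> W" using v by simp
    then have "hinner V (\<pi> \<one>\<^bsub>G\<^esub> v) (\<pi> \<one>\<^bsub>G\<^esub> v) = 0" by (simp add: W_def)
    then have "hinner V v v = 0" using v by (simp add: rep_hinner)
    then show False using V.hinner_pos[of v] v by simp
  qed
  then have W: "W = {\<zero>\<^bsub>V\<^esub>}" using irreducible[OF closed invariant] by blast
  show ?thesis
  proof (rule inj_onI)
    fix x y assume c: "x \<in> carrier V" "y \<in> carrier V"
      and eq: "matrix_coefficients G V \<pi> v x = matrix_coefficients G V \<pi> v y"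
    have "hinner V x (\<pi> g v) = hinner V y (\<pi> g v)" if "g \<in> carrier G" for g
      using fun_cong[OF eq, of g] that by (simp add: matrix_coefficients_def)
    then have "x \<ominus>\<^bsub>V\<^esub> y \<in> W" using c v by (simp add: W_def V.hinner_minus_left)
    then show "x = y" using W c V.minus_zero_imp_eq by auto
  qed
qed

definition transport_hilbert ::
  "('h \<Rightarrow> 'k) \<Rightarrow> ('k \<Rightarrow> 'h) \<Rightarrow> ('h, 'z) hilbert_scheme \<Rightarrow> 'k hilbert" where
  "transport_hilbert f f' V =
     \<lparr>carrier = f ` carrier V, monoid.mult = (\<lambda>x y. f (f' x \<otimes>\<^bsub>V\<^esub> f' y)), monoid.one = f \<one>\<^bsub>V\<^esub>,
      ring.zero = f \<zero>\<^bsub>V\<^esub>, add = (\<lambda>x y. f (f' x \<oplus>\<^bsub>V\<^esub> f' y)),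
      module.smult = (\<lambda>c x. f (c \<odot>\<^bsub>V\<^esub> f' x)), hinner = (\<lambda>x y. hinner V (f' x) (f' y))\<rparr>"

context irreducible_unitary_representation
begin

lemma transport_representation:
  fixes f :: "'h \<Rightarrow> 'k"
  assumes inj: "inj_on f (carrier V)"
  obtains V' :: "'k hilbert" and \<pi>' where "irreducible_unitary_representation G V' \<pi>'"
    and "\<And>g. g \<in> carrier G \<Longrightarrow> \<pi>' g = \<one>\<^bsub>unitary_group V'\<^esub> \<longleftrightarrow> \<pi> g = \<one>\<^bsub>unitary_group V\<^esub>"
proof -
  define f' where "f' = inv_into (carrier V) f"
  define V' where "V' = transport_hilbert f f' V"
  define \<pi>' where "\<pi>' = (\<lambda>g. \<lambda>x\<in>f ` carrier V. f (\<pi> g (f' x)))"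
  note [simp] = transport_hilbert_def
  have f'f [simp]: "f' (f x) = x" if "x \<in> carrier V" for x
    using that inj by (simp add: f'_def)
  have V': "carrier V' = f ` carrier V" "zero V' = f \<zero>\<^bsub>V\<^esub>"
    "\<And>x y. add V' x y = f (f' x \<oplus>\<^bsub>V\<^esub> f' y)" "\<And>c x. module.smult V' c x = f (c \<odot>\<^bsub>V\<^esub> f' x)"
    "\<And>x y. hinner V' x y = hinner V (f' x) (f' y)"
    by (simp_all add: V'_def)
  have smc [simp]: "c \<odot>\<^bsub>V\<^esub> x \<in> carrier V" if "x \<in> carrier V" for c x
    using that V.smult_closed by simp
  have "abelian_group V'"
  proof (rule abelian_groupI)
    fix x assume "x \<in> carrier V'"
    then obtain u where u: "u \<in> carrier V" "x = f u" by (auto simp: V')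
    then show "\<exists>y\<in>carrier V'. y \<oplus>\<^bsub>V'\<^esub> x = \<zero>\<^bsub>V'\<^esub>"
      by (intro bexI[of _ "f (\<ominus>\<^bsub>V\<^esub> u)"]) (auto simp: V' V.l_neg)
  qed (auto simp: V' V.a_assoc intro!: arg_cong[of _ _ f] V.a_comm)
  moreover have "cring complex_field" by (rule V.R.is_cring)
  ultimately have module: "module complex_field V'"
    using V.smult_l_distr V.smult_r_distr V.smult_assoc1 V.smult_one
    by (intro moduleI) (auto simp: V')
  then interpret M': module complex_field V' .
  have f_eq: "f x = f y \<longleftrightarrow> x = y" if "x \<in> carrier V" "y \<in> carrier V" for x y
    using that inj by (auto dest: inj_onD)
  interpret V': complex_inner_space V'
    by unfold_locales
      (auto simp: V' f_eq V.hinner_add_left V.hinner_smult_left intro: V.hinner_commute V.hinner_pos)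
  have uminus: "\<ominus>\<^bsub>V'\<^esub> (f x) = f (\<ominus>\<^bsub>V\<^esub> x)" if "x \<in> carrier V" for x
    by (rule M'.minus_equality) (use that in \<open>auto simp: V' V.l_neg\<close>)
  have hdist: "hdist V' (f x) (f y) = hdist V x y" if "x \<in> carrier V" "y \<in> carrier V" for x y
    using that by (simp add: hdist_def a_minus_def uminus) (simp add: V')
  have range: "(\<forall>x\<in>carrier V'. P x) \<longleftrightarrow> (\<forall>x\<in>carrier V. P (f x))" for P
    by (auto simp: V')
  have complete': "V'.metric.mcomplete"
    unfolding V'.metric.mcomplete_def
  proof (intro allI impI)
    fix \<sigma> assume \<sigma>: "V'.metric.MCauchy \<sigma>"
    define \<tau> where "\<tau> = f' \<circ> \<sigma>"
    have \<tau>: "\<tau> n \<in> carrier V" "\<sigma> n = f (\<tau> n)" for n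
    proof -
      have "\<sigma> n \<in> carrier V'" using \<sigma> by (auto simp: V'.metric.MCauchy_def)
      then have "\<sigma> n \<in> f ` carrier V" by (simp add: V')
      then show "\<tau> n \<in> carrier V" "\<sigma> n = f (\<tau> n)" by (auto simp: \<tau>_def)
    qed
    have "V.metric.MCauchy \<tau>"
      using \<sigma> \<tau>
      unfolding V.metric.MCauchy_def V'.metric.MCauchy_def by (auto simp: hdist)
    then obtain l where "limitin V.metric.mtopology \<tau> l sequentially"
      using V.complete by (auto simp: V.metric.mcomplete_def)
    then have "limitin V'.metric.mtopology \<sigma> (f l) sequentially"
      unfolding V.metric.limit_metric_sequentially V'.metric.limit_metric_sequentially
      using \<tau> by (simp add: V' hdist)
    then show "\<exists>l. limitin V'.metric.mtopology \<sigma> l sequentially" by blast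
  qed
  have Bij: "\<pi>' g \<in> Bij (carrier V')" if g: "g \<in> carrier G" for g
  proof -
    have "bij_betw (f \<circ> (\<pi> g \<circ> f')) (f ` carrier V) (f ` carrier V)"
      using inj rep_bij[OF g]
      by (intro bij_betw_trans[of _ _ "carrier V"])
        (auto simp: f'_def intro: bij_betw_inv_into inj_on_imp_bij_betw)
    then have "bij_betw (\<pi>' g) (carrier V') (carrier V')"
      by (subst bij_betw_cong[where g = "f \<circ> (\<pi> g \<circ> f')"]) (auto simp: \<pi>'_def V')
    then show ?thesis by (simp add: Bij_def \<pi>'_def V')
  qed
  have \<pi>'f: "\<pi>' g (f x) = f (\<pi> g x)" if "x \<in> carrier V" for g x
    using that by (simp add: \<pi>'_def)
  have unitary: "\<pi>' g \<in> unitary_operators V'" if g: "g \<in> carrier G" for g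
    using Bij[OF g] g
    by (auto simp: unitary_operators_def range \<pi>'f) (simp_all add: V' \<pi>'f rep_add rep_smult rep_hinner)
  have hom': "\<pi>' \<in> hom G (unitary_group V')"
    using unitary
    by (auto simp: hom_def unitary_group_mult compose_def \<pi>'_def V' rep_mult f_eq fun_eq_iff)
  interpret R': unitary_representation G V' \<pi>'
    by unfold_locales (use complete' hom' in auto)
  have "irreducible_unitary_representation G V' \<pi>'"
  proof unfold_locales
    show "carrier V' \<noteq> {\<zero>\<^bsub>V'\<^esub>}"
    proof
      assume "carrier V' = {\<zero>\<^bsub>V'\<^esub>}"
      then have "f x = f \<zero>\<^bsub>V\<^esub>" if "x \<in> carrier V" for x using that by (auto simp: V')
      then have "x = \<zero>\<^bsub>V\<^esub>" if "x \<in> carrier V" for x using that f_eq by blast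
      then show False using nonzero by auto
    qed
  next
    fix W' assume W': "closed_subspace W' V'" and inv: "\<And>g. g \<in> carrier G \<Longrightarrow> \<pi>' g ` W' \<subseteq> W'"
    define W where "W = {x \<in> carrier V. f x \<in> W'}"
    have sub': "submodule W' complex_field V'" and cl': "closedin V'.metric.mtopology W'"
      using W' by (auto simp: closed_subspace_def)
    note E = M'.submoduleE[OF sub']
    have W'_eq: "W' = f ` W" using E(1) by (auto simp: W_def V')
    have "submodule W complex_field V"
    proof (rule V.submoduleI)
      show "\<zero>\<^bsub>V\<^esub> \<in> W" 
        using subgroup.one_closed[OF submodule.axioms(1)[OF sub']] by (auto simp: W_def V')
      show "\<ominus>\<^bsub>V\<^esub> x \<in> W" if "x \<in> W" for x using E(3)[of "f x"] that by (auto simp: W_def uminus)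
      show "x \<oplus>\<^bsub>V\<^esub> y \<in> W" if "x \<in> W" "y \<in> W" for x y
        using E(5)[of "f x" "f y"] that by (auto simp: W_def V')
      show "c \<odot>\<^bsub>V\<^esub> x \<in> W" if "x \<in> W" for c x
        using E(4)[of c "f x"] that by (auto simp: W_def V')
    qed (auto simp: W_def)
    moreover have "closedin V.metric.mtopology W"
      unfolding V.metric.closedin_metric
    proof (intro conjI allI impI)
      show "W \<subseteq> carrier V" by (auto simp: W_def)
      fix x assume x: "x \<in> carrier V - W"
      then have "f x \<in> carrier V' - W'" by (auto simp: W_def V')
      then obtain r where r: "r > 0" "disjnt W' (V'.metric.mball (f x) r)"
        using cl' by (auto simp: V'.metric.closedin_metric)
      have "disjnt W (V.metric.mball x r)"
        unfolding disjnt_iff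
      proof (intro allI notI)
        fix y assume y: "y \<in> W \<and> y \<in> V.metric.mball x r"
        then have "f y \<in> W' \<and> f y \<in> V'.metric.mball (f x) r"
          by (auto simp: W_def hdist) (auto simp: V')
        then show False using r by (auto simp: disjnt_iff)
      qed
      then show "\<exists>r>0. disjnt W (V.metric.mball x r)" using r by blast
    qed
    ultimately have "closed_subspace W V" by (simp add: closed_subspace_def)
    moreover have "\<pi> g ` W \<subseteq> W" if g: "g \<in> carrier G" for g
    proof
      fix y assume "y \<in> \<pi> g ` W"
      then obtain x where x: "x \<in> W" "y = \<pi> g x" by blast
      then have "\<pi>' g (f x) \<in> W'" using inv[OF g] by (auto simp: W_def)
      then show "y \<in> W" using x g by (auto simp: W_def \<pi>'f)
    qed
    ultimately have "W = {\<zero>\<^bsub>V\<^esub>} \<or> W = carrier V" by (rule irreducible)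
    then show "W' = {\<zero>\<^bsub>V'\<^esub>} \<or> W' = carrier V'" by (auto simp: W'_eq V')
  qed
  moreover have "\<pi>' g = \<one>\<^bsub>unitary_group V'\<^esub> \<longleftrightarrow> \<pi> g = \<one>\<^bsub>unitary_group V\<^esub>" if g: "g \<in> carrier G" for g
  proof -
    have "\<pi>' g = \<one>\<^bsub>unitary_group V'\<^esub> \<longleftrightarrow> (\<forall>x\<in>carrier V'. \<pi>' g x = x)"
      using R'.rep_extensional[OF g] by (auto simp: fun_eq_iff extensional_def)
    also have "\<dots> \<longleftrightarrow> (\<forall>x\<in>carrier V. \<pi> g x = x)"
      using g by (simp add: range \<pi>'f f_eq)
    also have "\<dots> \<longleftrightarrow> \<pi> g = \<one>\<^bsub>unitary_group V\<^esub>"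
      using rep_extensional[OF g] by (auto simp: fun_eq_iff extensional_def)
    finally show ?thesis .
  qed
  ultimately show thesis by (rule that)
qed

theorem irreducibly_faithful_any_type:
  assumes "F \<subseteq> carrier G"
    and "\<And>x. \<lbrakk>x \<in> F; x \<noteq> \<one>\<^bsub>G\<^esub>\<rbrakk> \<Longrightarrow> \<pi> x \<noteq> \<one>\<^bsub>unitary_group V\<^esub>"
  shows "irreducibly_faithful G F"
proof -
  obtain v where "v \<in> carrier V" "v \<noteq> \<zero>\<^bsub>V\<^esub>" using nonzero by auto
  from transport_representation[OF inj_on_matrix_coefficients[OF this]]
  obtain V' :: "('a \<Rightarrow> complex) hilbert" and \<pi>'
    where "irreducible_unitary_representation G V' \<pi>'"
      and "\<And>g. g \<in> carrier G \<Longrightarrow> \<pi>' g = \<one>\<^bsub>unitary_group V'\<^esub> \<longleftrightarrow> \<pi> g = \<one>\<^bsub>unitary_group V\<^esub>"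
    by blast
  then show ?thesis using assms unfolding irreducibly_faithful_def by blast
qed

end

end

theory Submission
  imports Defs "HOL-Analysis.Function_Topology" "HOL-Analysis.Uniform_Limit"
begin

text \<open>
  A central involution acts in an irreducible representation by a sign, and three signs with product
  \<open>1\<close> are not all \<open>-1\<close>; so the involutions of a central Klein four-group are not irreducibly
  faithful.

  Conversely, let \<open>\<theta>\<close> be a unitary character of a subgroup \<open>H\<close>. The normalised positive-definite
  functions on \<open>G\<close> that extend \<open>\<theta>\<close> form a nonempty closed face of a compact convex set, so one of them
  is extreme, and its GNS representation is irreducible and nontrivial on every \<open>h\<close> with
  \<open>\<theta> h \<noteq> 1\<close>. Hence \<open>{a, b, c}\<close> is irreducibly faithful as soon as the normal closures \<open>A\<close>, \<open>B\<close>,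
  \<open>C\<close> contain commuting elements \<open>x\<close>, \<open>y\<close>, \<open>z\<close> of an abelian subgroup with a character nontrivial
  at all three. If two of the normal closures meet, two elements suffice, and such a character exists.
  Otherwise \<open>A\<close>, \<open>B\<close>, \<open>C\<close> commute pairwise, and a character can only be missing if
  \<open>x\<^sup>2 = y\<^sup>2 = xyz = 1\<close>. If this holds for all nontrivial \<open>x\<close>, \<open>y\<close>, \<open>z\<close>, then \<open>A\<close> and \<open>B\<close> have
  order \<open>2\<close>, so they are central and generate a Klein four-group.
\<close>

section \<open>Completion of a semi-inner product space\<close>

text \<open>A character of \<open>H\<close> constrains a representation only on \<open>H\<close>,
  while the given elements may lie anywhere in the group. The bridge is that the kernel of a
  representation is normal: if it contains \<open>a\<close>, it contains the whole normal closure of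
  \<open>a\<close>, so one element of that closure at which \<open>\<theta>\<close> differs from 1
  is enough. What remains is a question about abelian groups. If every character takes the value 1
  at \<open>x\<close>, \<open>y\<close> or \<open>z\<close>, the character group is the union of
  three annihilators, each a proper subgroup; a group covered by three proper subgroups has them all
  of index 2. This is where the involutions and the Klein four-group come from.

  Countability serves only to find extreme points: a strictly convex continuous function, summed
  over an enumeration of the group, attains its maximum over a closed face at an extreme point. The
  same device yields the characters of abelian groups, because extreme states of an abelian group
  are multiplicative.\<close>

lemma ex_pos_mult_less:
  fixes C r :: real
  assumes "r > 0" "C \<ge> 0"
  shows "\<exists>e>0. C * e < r"
proof -
  have "C * r < (C + 1) * r" using assms(1) by simp
  then have "C * (r / (C + 1)) < r" using assms(2) by (simp add: divide_less_eq mult.commute)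
  moreover have "r / (C + 1) > 0" using assms by simp
  ultimately show ?thesis by blast
qed

text \<open>No vector space is assumed: in the GNS construction the vectors are formal combinations
  given as lists, and \<open>ad\<close> is concatenation, which is neither commutative nor
  invertible. Linearity is visible only through the form, and \<open>ad u (sc (-1) v)\<close> stands
  for a difference.\<close>

locale semi_inner_space =
  fixes s :: "'v \<Rightarrow> 'v \<Rightarrow> complex"
    and ad :: "'v \<Rightarrow> 'v \<Rightarrow> 'v"
    and sc :: "complex \<Rightarrow> 'v \<Rightarrow> 'v"
  assumes s_ad_left: "s (ad u v) w = s u w + s v w"
    and s_sc_left: "s (sc c u) w = c * s u w"
    and s_commute: "s v u = cnj (s u v)"
    and s_self_ge0: "0 \<le> Re (s u u)"
begin

lemma s_ad_right: "s w (ad u v) = s w u + s w v"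
  using s_commute[of w "ad u v"] s_commute[of w u] s_commute[of w v] by (simp add: s_ad_left)

lemma s_sc_right: "s w (sc c u) = cnj c * s w u"
  using s_commute[of w "sc c u"] s_commute[of w u] by (simp add: s_sc_left)

definition seminorm :: "'v \<Rightarrow> real" where
  "seminorm u = sqrt (Re (s u u))"

lemma seminorm_ge0 [simp]: "0 \<le> seminorm u"
  by (simp add: seminorm_def s_self_ge0)

lemma s_self: "s u u = complex_of_real ((seminorm u)\<^sup>2)"
  using s_commute[of u u] by (simp add: seminorm_def s_self_ge0 complex_eq_iff)

text \<open>Nonnegativity of the form at \<open>u - t b v\<close>, where \<open>b = s u v\<close>,
  is a quadratic inequality in the real number \<open>t\<close>. The vector \<open>v\<close> may be
  null without being zero, so choosing the best \<open>t\<close> leaves a degenerate case.\<close>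

lemma semi_Cauchy_Schwarz: "cmod (s u v) \<le> seminorm u * seminorm v"
proof -
  define b where "b = s u v"
  have *: "0 \<le> (seminorm u)\<^sup>2 - 2 * t * (cmod b)\<^sup>2 + t\<^sup>2 * (cmod b)\<^sup>2 * (seminorm v)\<^sup>2" for t :: real
  proof -
    define c where "c = - (of_real t * b)"
    have bc: "b * cnj b = of_real ((cmod b)\<^sup>2)" by (rule complex_norm_square[symmetric])
    have "s (ad u (sc c v)) (ad u (sc c v)) =
        s u u + cnj c * b + c * cnj b + c * cnj c * s v v"
      using s_commute[of v u]
      by (simp add: s_ad_left s_ad_right s_sc_left s_sc_right b_def algebra_simps)
    also have "\<dots> = s u u - 2 * of_real t * (b * cnj b) + (of_real t)\<^sup>2 * (b * cnj b) * s v v"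
      by (simp add: c_def algebra_simps power2_eq_square)
    finally show ?thesis
      using s_self_ge0[of "ad u (sc c v)"] unfolding bc s_self by (simp flip: of_real_power of_real_mult)
  qed
  have "(cmod b)\<^sup>2 \<le> (seminorm u * seminorm v)\<^sup>2"
  proof (cases "seminorm v = 0")
    case True
    have "(cmod b)\<^sup>2 = 0"
    proof (rule ccontr)
      assume "(cmod b)\<^sup>2 \<noteq> 0"
      \<comment> \<open>With \<open>v\<close> null the inequality is affine in \<open>t\<close>, and
        this \<open>t\<close> makes its left side negative.\<close>
      then have "(seminorm u)\<^sup>2 - 2 * ((seminorm u)\<^sup>2 + 1) \<ge> 0"
        using *[of "((seminorm u)\<^sup>2 + 1) / (cmod b)\<^sup>2"] True by simp
      moreover have "q - 2 * (q + 1) < 0" if "q \<ge> 0" for q :: real using that by simp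
      ultimately show False by (meson linorder_not_less zero_le_power2)
    qed
    then show ?thesis by simp
  next
    case False
    then have v: "(seminorm v)\<^sup>2 > 0" by simp
    have "0 \<le> (seminorm u)\<^sup>2 - (cmod b)\<^sup>2 / (seminorm v)\<^sup>2"
      using *[of "1 / (seminorm v)\<^sup>2"] False by (simp add: power2_eq_square)
    then show ?thesis
      using v by (simp add: divide_le_eq power_mult_distrib)
  qed
  then show ?thesis unfolding b_def by (rule power2_le_imp_le) simp
qed

text \<open>The functionals \<open>s u\<close> are conjugate-linear in their argument, and
  \<open>f\<close> is a limit of such functionals in the dual seminorm. Closing the set of all
  \<open>s u\<close> in this sense both identifies vectors that differ by a null vector and
  completes the space, without quotients or classes of Cauchy sequences.\<close>

definition converges_to :: "(nat \<Rightarrow> 'v) \<Rightarrow> ('v \<Rightarrow> complex) \<Rightarrow> bool" where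
  "converges_to u f \<longleftrightarrow>
     (\<forall>\<epsilon>>0. \<forall>\<^sub>F n in sequentially. \<forall>w. cmod (f w - s (u n) w) \<le> \<epsilon> * seminorm w)"

definition completion :: "('v \<Rightarrow> complex) set" where
  "completion = {f. \<exists>u. converges_to u f}"

lemma completionI_approx:
  assumes "\<And>\<epsilon>. \<epsilon> > 0 \<Longrightarrow> \<exists>u. \<forall>w. cmod (f w - s u w) \<le> \<epsilon> * seminorm w"
  shows "f \<in> completion"
proof -
  have "\<exists>u. \<forall>w. cmod (f w - s u w) \<le> inverse (real (Suc n)) * seminorm w" for n
    by (rule assms) simp
  then obtain u where u: "\<And>n w. cmod (f w - s (u n) w) \<le> inverse (real (Suc n)) * seminorm w"
    by metis
  have "converges_to u f"
    unfolding converges_to_def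
  proof (intro allI impI)
    fix \<epsilon> :: real assume "\<epsilon> > 0"
    then have "\<forall>\<^sub>F n in sequentially. inverse (real (Suc n)) < \<epsilon>"
      by (rule order_tendstoD(2)[OF LIMSEQ_inverse_real_of_nat])
    then show "\<forall>\<^sub>F n in sequentially. \<forall>w. cmod (f w - s (u n) w) \<le> \<epsilon> * seminorm w"
      by eventually_elim (meson less_eq_real_def mult_right_mono order_trans seminorm_ge0 u)
  qed
  then show ?thesis by (auto simp: completion_def)
qed

lemma converges_toD:
  assumes "converges_to u f"
  shows "(\<lambda>n. s (u n) w) \<longlonglongrightarrow> f w"
proof (rule LIMSEQ_I)
  fix r :: real assume r: "r > 0"
  obtain e where e: "e > 0" "e * seminorm w < r"
    using ex_pos_mult_less[OF r seminorm_ge0[of w]] by (auto simp: mult.commute)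
  have "\<forall>\<^sub>F n in sequentially. \<forall>w. cmod (f w - s (u n) w) \<le> e * seminorm w"
    using assms e by (simp add: converges_to_def)
  then show "\<exists>no. \<forall>n\<ge>no. cmod (s (u n) w - f w) < r"
    using e unfolding eventually_sequentially by (metis norm_minus_commute order_le_less_trans)
qed

lemma completion_ad: "f \<in> completion \<Longrightarrow> f (ad v w) = f v + f w"
  unfolding completion_def
proof clarify
  fix u assume u: "converges_to u f"
  have "(\<lambda>n. s (u n) (ad v w)) \<longlonglongrightarrow> f v + f w"
    unfolding s_ad_right by (intro tendsto_add converges_toD u)
  then show "f (ad v w) = f v + f w" using converges_toD[OF u] LIMSEQ_unique by blast
qed

lemma completion_sc: "f \<in> completion \<Longrightarrow> f (sc c w) = cnj c * f w"
  unfolding completion_def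
proof clarify
  fix u assume u: "converges_to u f"
  have "(\<lambda>n. s (u n) (sc c w)) \<longlonglongrightarrow> cnj c * f w"
    unfolding s_sc_right by (intro tendsto_mult_left converges_toD u)
  then show "f (sc c w) = cnj c * f w" using converges_toD[OF u] LIMSEQ_unique by blast
qed

text \<open>The bound on \<open>seminorm (u n)\<close> comes from testing the approximation at
  \<open>w = u n\<close> itself: the square of the seminorm is at most a constant times the
  seminorm.\<close>

lemma converges_to_bounded:
  assumes "converges_to u f"
  obtains C where "C \<ge> 0" "\<And>w. cmod (f w) \<le> C * seminorm w"
    "\<forall>\<^sub>F n in sequentially. seminorm (u n) \<le> C"
proof -
  have ev: "\<forall>\<^sub>F n in sequentially. \<forall>w. cmod (f w - s (u n) w) \<le> 1 * seminorm w"
    using assms unfolding converges_to_def by (meson zero_less_one)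
  then obtain m where m: "\<And>w. cmod (f w - s (u m) w) \<le> seminorm w"
    unfolding eventually_sequentially by auto
  define C where "C = seminorm (u m) + 1"
  have bd: "cmod (f w) \<le> C * seminorm w" for w
  proof -
    have "cmod (f w) \<le> cmod (f w - s (u m) w) + cmod (s (u m) w)"
      by (metis diff_add_cancel norm_triangle_ineq)
    also have "\<dots> \<le> C * seminorm w"
      using m[of w] semi_Cauchy_Schwarz[of "u m" w] by (simp add: C_def algebra_simps)
    finally show ?thesis .
  qed
  have "\<forall>\<^sub>F n in sequentially. seminorm (u n) \<le> C + 1"
    using ev
  proof eventually_elim
    case (elim n)
    let ?x = "u n"
    have "cmod (s ?x ?x) \<le> cmod (f ?x) + cmod (f ?x - s ?x ?x)"
      by (metis norm_minus_commute norm_triangle_sub)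
    also have "\<dots> \<le> (C + 1) * seminorm ?x"
      using elim[rule_format, of ?x] bd[of ?x] by (simp add: algebra_simps)
    finally have "seminorm ?x * seminorm ?x \<le> (C + 1) * seminorm ?x"
      by (simp add: s_self norm_power power2_eq_square norm_mult)
    moreover have "C \<ge> 0" by (simp add: C_def)
    ultimately show "seminorm ?x \<le> C + 1"
      by (cases "seminorm ?x = 0") (use seminorm_ge0[of ?x] in auto)
  qed
  moreover have "C + 1 \<ge> 0" by (simp add: C_def)
  moreover have "cmod (f w) \<le> (C + 1) * seminorm w" for w
    using bd[of w] seminorm_ge0[of w] unfolding distrib_right mult_1 by linarith
  ultimately show thesis by (rule that[rotated 2])
qed

text \<open>Both estimates are tested at the difference itself, where the two functionals differ by
  its squared seminorm.\<close>

lemma seminorm_diff_le: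
  assumes "\<And>w. cmod (f w - s u w) \<le> \<delta> * seminorm w" "\<And>w. cmod (f w - s v w) \<le> \<epsilon> * seminorm w"
    and "\<delta> \<ge> 0" "\<epsilon> \<ge> 0"
  shows "seminorm (ad u (sc (-1) v)) \<le> \<delta> + \<epsilon>"
proof -
  let ?d = "ad u (sc (-1) v)"
  have "cmod (s ?d ?d) = cmod ((f ?d - s v ?d) - (f ?d - s u ?d))"
    by (simp add: s_ad_left s_sc_left)
  also have "\<dots> \<le> \<epsilon> * seminorm ?d + \<delta> * seminorm ?d"
    using assms norm_triangle_ineq4 by (meson add_mono order_trans)
  finally have "seminorm ?d * seminorm ?d \<le> (\<delta> + \<epsilon>) * seminorm ?d"
    by (simp add: s_self norm_power power2_eq_square norm_mult algebra_simps)
  then show ?thesis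
    using assms(3,4) by (cases "seminorm ?d = 0") (use seminorm_ge0[of ?d] in auto)
qed

text \<open>The filter and the two index maps are free so that one statement serves twice: with the
  product filter and the projections it is the Cauchy property, with identities it is independence
  of the approximating sequence.\<close>

lemma completion_apply_diff_tendsto_0:
  assumes f: "f \<in> completion" and v: "converges_to v g" and v': "converges_to v' g"
    and "filterlim p sequentially F" "filterlim q sequentially F"
  shows "((\<lambda>x. f (v (p x)) - f (v' (q x))) \<longlongrightarrow> 0) F"
proof -
  obtain C where C: "C \<ge> 0" "\<And>w. cmod (f w) \<le> C * seminorm w"
    using f converges_to_bounded unfolding completion_def by blast
  have diff: "f a - f b = f (ad a (sc (-1) b))" for a b
    by (simp add: completion_ad[OF f] completion_sc[OF f])
  show ?thesis
  proof (rule tendstoI)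
    fix r :: real assume r: "r > 0"
    obtain e where e: "e > 0" "C * (e + e) < r"
      using ex_pos_mult_less[of "r / 2" C] r C by (auto simp: distrib_left)
    have "\<forall>\<^sub>F n in sequentially. \<forall>w. cmod (g w - s (v n) w) \<le> e * seminorm w"
      using v e by (simp add: converges_to_def)
    then have 1: "\<forall>\<^sub>F x in F. \<forall>w. cmod (g w - s (v (p x)) w) \<le> e * seminorm w"
      using assms(4) by (rule eventually_compose_filterlim)
    have "\<forall>\<^sub>F n in sequentially. \<forall>w. cmod (g w - s (v' n) w) \<le> e * seminorm w"
      using v' e by (simp add: converges_to_def)
    then have 2: "\<forall>\<^sub>F x in F. \<forall>w. cmod (g w - s (v' (q x)) w) \<le> e * seminorm w"
      using assms(5) by (rule eventually_compose_filterlim)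
    show "\<forall>\<^sub>F x in F. dist (f (v (p x)) - f (v' (q x))) 0 < r"
      using 1 2
    proof eventually_elim
      case (elim x)
      have "cmod (f (v (p x)) - f (v' (q x))) \<le> C * seminorm (ad (v (p x)) (sc (-1) (v' (q x))))"
        unfolding diff by (rule C)
      also have "\<dots> \<le> C * (e + e)"
        by (rule mult_left_mono[OF seminorm_diff_le[of g]]) (use elim e C in auto)
      also have "\<dots> < r" by (rule e)
      finally show ?case by simp
    qed
  qed
qed

text \<open>Extends the rule that \<open>f\<close> paired with \<open>s v\<close> gives
  \<open>f v\<close>, by continuity in the second argument. By \<open>cinner_limit\<close> the
  choice of the sequence does not matter.\<close>

definition cinner :: "('v \<Rightarrow> complex) \<Rightarrow> ('v \<Rightarrow> complex) \<Rightarrow> complex" where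
  "cinner f g = lim (\<lambda>n. f ((SOME v. converges_to v g) n))"

lemma cinner_limit:
  assumes f: "f \<in> completion" and v: "converges_to v g"
  shows "(\<lambda>n. f (v n)) \<longlonglongrightarrow> cinner f g"
proof -
  define v' where "v' = (SOME v. converges_to v g)"
  have v': "converges_to v' g" unfolding v'_def by (rule someI[of "\<lambda>v. converges_to v g", OF v])
  have "convergent (\<lambda>n. f (v' n))"
  proof (rule Cauchy_convergent, rule CauchyI)
    fix e :: real assume e: "e > 0"
    have "((\<lambda>x. f (v' (fst x)) - f (v' (snd x))) \<longlongrightarrow> 0) (sequentially \<times>\<^sub>F sequentially)"
      by (rule completion_apply_diff_tendsto_0[OF f v' v']) (auto intro: filterlim_fst filterlim_snd)
    then have "\<forall>\<^sub>F x in sequentially \<times>\<^sub>F sequentially. dist (f (v' (fst x)) - f (v' (snd x))) 0 < e"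
      using e by (rule tendstoD)
    then show "\<exists>M. \<forall>m\<ge>M. \<forall>n\<ge>M. cmod (f (v' m) - f (v' n)) < e"
      unfolding eventually_prod_sequentially by auto
  qed
  then have "(\<lambda>n. f (v' n)) \<longlonglongrightarrow> cinner f g"
    unfolding cinner_def v'_def by (rule convergent_LIMSEQ_iff[THEN iffD1])
  moreover have "(\<lambda>n. f (v n) - f (v' n)) \<longlonglongrightarrow> 0"
    by (rule completion_apply_diff_tendsto_0[OF f v v' filterlim_ident filterlim_ident])
  ultimately have "(\<lambda>n. f (v' n) + (f (v n) - f (v' n))) \<longlonglongrightarrow> cinner f g + 0"
    by (rule tendsto_add)
  then show ?thesis by simp
qed

text \<open>Replacing \<open>f\<close> by its approximants costs at most
  \<open>e * seminorm (v n)\<close>, and these seminorms are eventually bounded. The limit treats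
  both arguments alike, which is what symmetry and positivity of \<open>cinner\<close> rest
  on.\<close>

lemma cinner_limit2:
  assumes u: "converges_to u f" and v: "converges_to v g"
  shows "(\<lambda>n. s (u n) (v n)) \<longlonglongrightarrow> cinner f g"
proof -
  have f: "f \<in> completion" using u by (auto simp: completion_def)
  obtain C where C: "C \<ge> 0" "\<forall>\<^sub>F n in sequentially. seminorm (v n) \<le> C"
    using converges_to_bounded[OF v] by metis
  have "(\<lambda>n. f (v n) - s (u n) (v n)) \<longlonglongrightarrow> 0"
  proof (rule tendstoI)
    fix r :: real assume r: "r > 0"
    obtain e where e: "e > 0" "e * C < r"
      using ex_pos_mult_less[OF r C(1)] by (auto simp: mult.commute)
    have "\<forall>\<^sub>F n in sequentially. \<forall>w. cmod (f w - s (u n) w) \<le> e * seminorm w"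
      using u e by (simp add: converges_to_def)
    then show "\<forall>\<^sub>F n in sequentially. dist (f (v n) - s (u n) (v n)) 0 < r"
      using C(2)
    proof eventually_elim
      case (elim n)
      have "cmod (f (v n) - s (u n) (v n)) \<le> e * seminorm (v n)" using elim by blast
      also have "\<dots> \<le> e * C" using elim e by simp
      finally show ?case using e by simp
    qed
  qed
  from tendsto_diff[OF cinner_limit[OF f v] this] show ?thesis by simp
qed

lemma completion_ex: "f \<in> completion \<Longrightarrow> \<exists>u. converges_to u f"
  by (simp add: completion_def)

lemma completion_add:
  assumes "f \<in> completion" "g \<in> completion"
  shows "(\<lambda>w. f w + g w) \<in> completion"
proof (rule completionI_approx)
  fix \<epsilon> :: real assume "\<epsilon> > 0"
  then have e: "\<epsilon> / 2 > 0" by simp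
  obtain u v where "converges_to u f" "converges_to v g" using assms completion_ex by blast
  with e have "\<forall>\<^sub>F n in sequentially. \<forall>w. cmod (f w - s (u n) w) \<le> \<epsilon> / 2 * seminorm w"
    "\<forall>\<^sub>F n in sequentially. \<forall>w. cmod (g w - s (v n) w) \<le> \<epsilon> / 2 * seminorm w"
    unfolding converges_to_def by blast+
  then have "\<forall>\<^sub>F n in sequentially. \<forall>w. cmod (f w + g w - s (ad (u n) (v n)) w) \<le> \<epsilon> * seminorm w"
  proof eventually_elim
    case (elim n)
    show ?case
    proof
      fix w
      have "cmod (f w + g w - s (ad (u n) (v n)) w) = cmod ((f w - s (u n) w) + (g w - s (v n) w))"
        by (simp add: s_ad_left algebra_simps)
      also have "\<dots> \<le> \<epsilon> / 2 * seminorm w + \<epsilon> / 2 * seminorm w"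
        using elim by (intro order_trans[OF norm_triangle_ineq] add_mono) auto
      finally show "cmod (f w + g w - s (ad (u n) (v n)) w) \<le> \<epsilon> * seminorm w" by simp
    qed
  qed
  then show "\<exists>u. \<forall>w. cmod (f w + g w - s u w) \<le> \<epsilon> * seminorm w"
    unfolding eventually_sequentially by blast
qed

lemma completion_smult:
  assumes "f \<in> completion"
  shows "(\<lambda>w. c * f w) \<in> completion"
proof (rule completionI_approx)
  fix \<epsilon> :: real assume \<epsilon>: "\<epsilon> > 0"
  obtain e where e: "e > 0" "cmod c * e \<le> \<epsilon>"
    using ex_pos_mult_less[OF \<epsilon> norm_ge_zero[of c]] by (auto intro: less_imp_le)
  obtain u where "converges_to u f" using assms completion_ex by blast
  with e have "\<forall>\<^sub>F n in sequentially. \<forall>w. cmod (f w - s (u n) w) \<le> e * seminorm w"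
    unfolding converges_to_def by blast
  then obtain x where x: "\<And>w. cmod (f w - s x w) \<le> e * seminorm w"
    unfolding eventually_sequentially by blast
  have "cmod (c * f w - s (sc c x) w) \<le> \<epsilon> * seminorm w" for w
  proof -
    have "cmod (c * f w - s (sc c x) w) = cmod c * cmod (f w - s x w)"
      by (simp add: s_sc_left flip: right_diff_distrib norm_mult)
    also have "\<dots> \<le> cmod c * (e * seminorm w)" by (intro mult_left_mono x) simp
    also have "\<dots> \<le> \<epsilon> * seminorm w" using e mult_right_mono[OF e(2) seminorm_ge0[of w]] by (simp add: mult.assoc)
    finally show ?thesis .
  qed
  then show "\<exists>u. \<forall>w. cmod (c * f w - s u w) \<le> \<epsilon> * seminorm w" by blast
qed

lemma converges_to_const: "converges_to (\<lambda>_. u) (s u)"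
  by (simp add: converges_to_def)

lemma s_in_completion [simp]: "s u \<in> completion"
  using converges_to_const by (auto simp: completion_def)

lemma cinner_s_right: "f \<in> completion \<Longrightarrow> cinner f (s u) = f u"
  using cinner_limit[OF _ converges_to_const] by (metis LIMSEQ_const_iff)

lemma zero_in_completion: "(\<lambda>_. 0) \<in> completion"
  using completion_smult[of "s undefined" 0] by simp

lemma cinner_add_left:
  assumes "f \<in> completion" "g \<in> completion" "h \<in> completion"
  shows "cinner (\<lambda>w. f w + g w) h = cinner f h + cinner g h"
proof -
  obtain v where v: "converges_to v h" using assms completion_ex by blast
  have "(\<lambda>n. f (v n) + g (v n)) \<longlonglongrightarrow> cinner f h + cinner g h"
    using assms v by (intro tendsto_add cinner_limit)
  then show ?thesis
    using cinner_limit[OF completion_add[OF assms(1,2)] v] LIMSEQ_unique by blast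
qed

lemma cinner_smult_left:
  assumes "f \<in> completion" "h \<in> completion"
  shows "cinner (\<lambda>w. c * f w) h = c * cinner f h"
proof -
  obtain v where v: "converges_to v h" using assms completion_ex by blast
  have "(\<lambda>n. c * f (v n)) \<longlonglongrightarrow> c * cinner f h"
    using assms v by (intro tendsto_mult_left cinner_limit)
  then show ?thesis
    using cinner_limit[OF completion_smult[OF assms(1)] v] LIMSEQ_unique by blast
qed

lemma cinner_commute:
  assumes "f \<in> completion" "g \<in> completion"
  shows "cinner g f = cnj (cinner f g)"
proof -
  obtain u v where uv: "converges_to u f" "converges_to v g" using assms completion_ex by blast
  have "(\<lambda>n. cnj (s (u n) (v n))) \<longlonglongrightarrow> cnj (cinner f g)"
    by (intro tendsto_cnj cinner_limit2 uv)
  then show ?thesis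
    using cinner_limit2[OF uv(2,1)] LIMSEQ_unique unfolding s_commute[of "v _" "u _"] by blast
qed

lemma seminorm_tendsto:
  assumes "converges_to u f"
  shows "(\<lambda>n. seminorm (u n)) \<longlonglongrightarrow> sqrt (Re (cinner f f))"
  unfolding seminorm_def by (intro tendsto_real_sqrt tendsto_Re cinner_limit2 assms)

lemma cinner_self_ge0:
  assumes "f \<in> completion"
  shows "0 \<le> Re (cinner f f)"
proof -
  obtain u where u: "converges_to u f" using assms completion_ex by blast
  have "(\<lambda>n. Re (s (u n) (u n))) \<longlonglongrightarrow> Re (cinner f f)"
    by (intro tendsto_Re cinner_limit2 u)
  then show ?thesis by (rule LIMSEQ_le_const) (simp add: s_self_ge0)
qed

lemma completion_apply_le:
  assumes "f \<in> completion"
  shows "cmod (f w) \<le> sqrt (Re (cinner f f)) * seminorm w"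
proof -
  obtain u where u: "converges_to u f" using assms completion_ex by blast
  have "(\<lambda>n. cmod (s (u n) w)) \<longlonglongrightarrow> cmod (f w)"
    by (intro tendsto_norm converges_toD u)
  moreover have "(\<lambda>n. seminorm (u n) * seminorm w) \<longlonglongrightarrow> sqrt (Re (cinner f f)) * seminorm w"
    by (intro tendsto_mult_right seminorm_tendsto u)
  ultimately show ?thesis by (rule LIMSEQ_le) (simp add: semi_Cauchy_Schwarz)
qed

text \<open>Together with \<open>completion_apply_le\<close> this identifies the Hilbert norm with
  the dual norm, the least such \<open>C\<close>. Along an approximating sequence
  \<open>f (u n)\<close> tends to the squared norm and \<open>seminorm (u n)\<close> to the norm, so
  one factor cancels.\<close>

lemma completion_norm_le:
  assumes f: "f \<in> completion" and C: "\<And>w. cmod (f w) \<le> C * seminorm w" "C \<ge> 0"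
  shows "sqrt (Re (cinner f f)) \<le> C"
proof -
  define r where "r = sqrt (Re (cinner f f))"
  have r: "r \<ge> 0" "r * r = Re (cinner f f)"
    using cinner_self_ge0[OF f] by (simp_all add: r_def)
  obtain u where u: "converges_to u f" using f completion_ex by blast
  have "(\<lambda>n. Re (f (u n))) \<longlonglongrightarrow> r * r"
    unfolding r by (intro tendsto_Re cinner_limit f u)
  moreover have "(\<lambda>n. C * seminorm (u n)) \<longlonglongrightarrow> C * r"
    unfolding r_def by (intro tendsto_mult_left seminorm_tendsto u)
  ultimately have "r * r \<le> C * r"
    by (rule LIMSEQ_le) (meson C(1) complex_Re_le_cmod order_trans)
  then show ?thesis unfolding r_def[symmetric] using r(1) C(2) by (cases "r = 0") auto
qed

lemma cinner_pos:
  assumes "f \<in> completion" "f \<noteq> (\<lambda>_. 0)"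
  shows "0 < Re (cinner f f)"
proof (rule ccontr)
  assume "\<not> 0 < Re (cinner f f)"
  then have "Re (cinner f f) = 0" using cinner_self_ge0[OF assms(1)] by simp
  then have "f w = 0" for w using completion_apply_le[OF assms(1), of w] by simp
  then show False using assms(2) by auto
qed

section \<open>The completion as a Hilbert space\<close>

definition hilbert_completion :: "('v \<Rightarrow> complex) hilbert" where
  "hilbert_completion =
     \<lparr>carrier = completion, monoid.mult = (\<lambda>f g. f), monoid.one = (\<lambda>_. 0),
      ring.zero = (\<lambda>_. 0), add = (\<lambda>f g w. f w + g w),
      module.smult = (\<lambda>c f w. c * f w), hinner = cinner\<rparr>"

lemma hilbert_completion_simps [simp]:
  "carrier hilbert_completion = completion"
  "zero hilbert_completion = (\<lambda>_. 0)"
  "add hilbert_completion = (\<lambda>f g w. f w + g w)"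
  "module.smult hilbert_completion = (\<lambda>c f w. c * f w)"
  "hinner hilbert_completion = cinner"
  by (simp_all add: hilbert_completion_def)

lemma complex_inner_space_completion: "complex_inner_space hilbert_completion"
proof -
  have "abelian_group hilbert_completion"
  proof (rule abelian_groupI)
    fix f assume "f \<in> carrier hilbert_completion"
    then show "\<exists>g\<in>carrier hilbert_completion. g \<oplus>\<^bsub>hilbert_completion\<^esub> f = \<zero>\<^bsub>hilbert_completion\<^esub>"
      using completion_smult[of f "-1"] by (intro bexI[of _ "\<lambda>w. - f w"]) auto
  qed (auto simp: completion_add zero_in_completion algebra_simps)
  then have "module complex_field hilbert_completion"
    by (intro moduleI cring_from_type_algebra)
      (auto simp: completion_smult algebra_simps)
  then show ?thesis
    by (intro complex_inner_space.intro complex_inner_space_axioms.intro)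
      (auto simp: cinner_add_left cinner_smult_left intro: cinner_commute cinner_pos)
qed

sublocale completion: complex_inner_space hilbert_completion
  by (rule complex_inner_space_completion)

lemma completion_minus:
  assumes "f \<in> completion" "g \<in> completion"
  shows "f \<ominus>\<^bsub>hilbert_completion\<^esub> g = (\<lambda>w. f w - g w)"
proof -
  have "\<ominus>\<^bsub>hilbert_completion\<^esub> g = (\<lambda>w. - g w)"
    by (rule completion.minus_equality)
      (use assms completion_smult[of g "-1"] in auto)
  then show ?thesis by (simp add: a_minus_def)
qed

lemma completion_diff:
  assumes "f \<in> completion" "g \<in> completion"
  shows "(\<lambda>w. f w - g w) \<in> completion"
  using completion_add[OF assms(1) completion_smult[OF assms(2), of "-1"]] by simp

lemma hdist_completion:
  assumes "f \<in> completion" "g \<in> completion"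
  shows "hdist hilbert_completion f g = sqrt (Re (cinner (\<lambda>w. f w - g w) (\<lambda>w. f w - g w)))"
  using assms by (simp add: hdist_def completion_minus)

text \<open>Evaluation is bounded, so a Cauchy sequence converges pointwise. Letting one index of
  the Cauchy estimate tend to infinity turns the pointwise limit into a limit in the dual norm,
  which is the Hilbert norm.\<close>

theorem complex_hilbert_space_completion: "complex_hilbert_space hilbert_completion"
proof (intro complex_hilbert_space.intro complex_hilbert_space_axioms.intro)
  show "complex_inner_space hilbert_completion" by (rule complex_inner_space_completion)
  show "completion.metric.mcomplete"
    unfolding completion.metric.mcomplete_def
  proof (intro allI impI)
    fix \<sigma> assume \<sigma>: "completion.metric.MCauchy \<sigma>"
    have \<sigma>H: "\<sigma> n \<in> completion" for n
      using \<sigma> by (auto simp: completion.metric.MCauchy_def simp del: hilbert_completion_simps(1))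
        (simp add: subset_iff)
    have d: "cmod (\<sigma> m w - \<sigma> n w) \<le> hdist hilbert_completion (\<sigma> m) (\<sigma> n) * seminorm w" for m n w
      using completion_apply_le[OF completion_diff[OF \<sigma>H[of m] \<sigma>H[of n]], of w]
      by (simp add: hdist_completion \<sigma>H)
    have cauchy: "\<exists>M. \<forall>m\<ge>M. \<forall>n\<ge>M. hdist hilbert_completion (\<sigma> m) (\<sigma> n) < e" if "e > 0" for e
      using \<sigma>[unfolded completion.metric.MCauchy_def] that by meson
    have le: "cmod (\<sigma> m w - \<sigma> n w) \<le> e * seminorm w"
      if "hdist hilbert_completion (\<sigma> m) (\<sigma> n) < e" for m n w e
      using d[of m w n] that by (meson less_eq_real_def mult_right_mono order_trans seminorm_ge0)
    have "convergent (\<lambda>n. \<sigma> n w)" for w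
    proof (rule Cauchy_convergent, rule CauchyI)
      fix r :: real assume r: "r > 0"
      obtain e where e: "e > 0" "e * seminorm w < r"
        using ex_pos_mult_less[OF r seminorm_ge0[of w]] by (auto simp: mult.commute)
      then show "\<exists>M. \<forall>m\<ge>M. \<forall>n\<ge>M. cmod (\<sigma> m w - \<sigma> n w) < r"
        using cauchy[OF e(1)] le by (meson order_le_less_trans)
    qed
    then obtain f where f: "\<And>w. (\<lambda>n. \<sigma> n w) \<longlonglongrightarrow> f w"
      unfolding convergent_def by metis
    have conv: "\<exists>M. \<forall>n\<ge>M. \<forall>w. cmod (f w - \<sigma> n w) \<le> e * seminorm w" if e: "e > 0" for e
    proof -
      obtain M where M: "\<And>m n. m \<ge> M \<Longrightarrow> n \<ge> M \<Longrightarrow> hdist hilbert_completion (\<sigma> m) (\<sigma> n) < e"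
        using cauchy[OF e] by blast
      have "cmod (f w - \<sigma> n w) \<le> e * seminorm w" if n: "n \<ge> M" for n w
      proof (rule LIMSEQ_le_const2)
        show "(\<lambda>m. cmod (\<sigma> m w - \<sigma> n w)) \<longlonglongrightarrow> cmod (f w - \<sigma> n w)"
          by (intro tendsto_norm tendsto_diff f tendsto_const)
        show "\<exists>N. \<forall>m\<ge>N. cmod (\<sigma> m w - \<sigma> n w) \<le> e * seminorm w"
          using M n le by blast
      qed
      then show ?thesis by blast
    qed
    have fH: "f \<in> completion"
    proof (rule completionI_approx)
      fix e :: real assume "e > 0"
      then have e: "e / 2 > 0" by simp
      obtain n where n: "\<And>w. cmod (f w - \<sigma> n w) \<le> e / 2 * seminorm w" using conv[OF e] by blast
      obtain u where "converges_to u (\<sigma> n)" using \<sigma>H completion_ex by blast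
      then obtain x where x: "\<And>w. cmod (\<sigma> n w - s x w) \<le> e / 2 * seminorm w"
        using e unfolding converges_to_def eventually_sequentially by blast
      have "cmod (f w - s x w) \<le> e * seminorm w" for w
      proof -
        have "cmod (f w - s x w) \<le> cmod (f w - \<sigma> n w) + cmod (\<sigma> n w - s x w)"
          using norm_triangle_ineq[of "f w - \<sigma> n w" "\<sigma> n w - s x w"] by simp
        also have "\<dots> \<le> e / 2 * seminorm w + e / 2 * seminorm w" by (intro add_mono n x)
        finally show ?thesis by simp
      qed
      then show "\<exists>u. \<forall>w. cmod (f w - s u w) \<le> e * seminorm w" by blast
    qed
    have "limitin completion.metric.mtopology \<sigma> f sequentially"
      unfolding completion.metric.limit_metric_sequentially
    proof (intro conjI allI impI)
      show "f \<in> carrier hilbert_completion" using fH by simp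
      fix e :: real assume "e > 0"
      then have e: "e / 2 > 0" by simp
      obtain M where M: "\<And>n w. n \<ge> M \<Longrightarrow> cmod (f w - \<sigma> n w) \<le> e / 2 * seminorm w"
        using conv[OF e] by blast
      have "hdist hilbert_completion (\<sigma> n) f < e" if "n \<ge> M" for n
      proof -
        have "hdist hilbert_completion (\<sigma> n) f \<le> e / 2"
          unfolding hdist_completion[OF \<sigma>H fH]
          by (rule completion_norm_le[OF completion_diff[OF \<sigma>H fH]])
            (use M[OF that] e in \<open>auto simp: norm_minus_commute\<close>)
        then show ?thesis using e by simp
      qed
      then show "\<exists>N. \<forall>n\<ge>N. \<sigma> n \<in> carrier hilbert_completion \<and> hdist hilbert_completion (\<sigma> n) f < e"
        using \<sigma>H by auto
    qed
    then show "\<exists>f. limitin completion.metric.mtopology \<sigma> f sequentially" by blast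
  qed
qed

end

section \<open>Positive-definite functions and extreme states\<close>

text \<open>A list of pairs is a formal linear combination of points, and this is the sesquilinear
  form with kernel \<open>k\<close>. Points may repeat, so that addition is concatenation.\<close>

definition kernel_form ::
    "('a \<Rightarrow> 'a \<Rightarrow> complex) \<Rightarrow> (complex \<times> 'a) list \<Rightarrow> (complex \<times> 'a) list \<Rightarrow> complex" where
  "kernel_form k xs ys = (\<Sum>p\<leftarrow>xs. \<Sum>q\<leftarrow>ys. fst p * cnj (fst q) * k (snd p) (snd q))"

lemma cnj_sum_list: "cnj (sum_list zs) = (\<Sum>z\<leftarrow>zs. cnj z)"
  by (induction zs) auto

lemma sum_list_swap:
  "(\<Sum>p\<leftarrow>xs. \<Sum>q\<leftarrow>ys. f p q) = (\<Sum>q\<leftarrow>ys. \<Sum>p\<leftarrow>xs. f p q :: 'b :: comm_monoid_add)"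
  by (induction xs) (simp_all add: sum_list_addf)

lemma kernel_form_append_left: "kernel_form k (xs @ ys) zs = kernel_form k xs zs + kernel_form k ys zs"
  by (simp add: kernel_form_def)

lemma kernel_form_append_right: "kernel_form k zs (xs @ ys) = kernel_form k zs xs + kernel_form k zs ys"
  by (simp add: kernel_form_def sum_list_addf)

lemma kernel_form_scale_left: "kernel_form k (map (apfst ((*) c)) xs) zs = c * kernel_form k xs zs"
  by (simp add: kernel_form_def sum_list_const_mult o_def mult.assoc)

lemma kernel_form_commute:
  assumes "\<And>a b. k b a = cnj (k a b)"
  shows "kernel_form k ys xs = cnj (kernel_form k xs ys)"
proof -
  have *: "k b a = cnj (k a b)" for a b by (rule assms)
  have "kernel_form k ys xs = (\<Sum>p\<leftarrow>xs. \<Sum>q\<leftarrow>ys. fst q * cnj (fst p) * k (snd q) (snd p))"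
    unfolding kernel_form_def by (rule sum_list_swap)
  also have "\<dots> = cnj (kernel_form k xs ys)"
    unfolding kernel_form_def cnj_sum_list map_map o_def
    by (intro arg_cong[of _ _ sum_list] map_cong refl) (subst *, simp)
  finally show ?thesis .
qed

lemma kernel_form_cong:
  assumes "\<And>a b. a \<in> snd ` set xs \<Longrightarrow> b \<in> snd ` set ys \<Longrightarrow> k a b = k' a b"
  shows "kernel_form k xs ys = kernel_form k' xs ys"
  unfolding kernel_form_def by (intro arg_cong[of _ _ sum_list] map_cong refl) (use assms in auto)

lemma kernel_form_add:
  "kernel_form (\<lambda>a b. k a b + k' a b) xs ys = kernel_form k xs ys + kernel_form k' xs ys"
  by (simp add: kernel_form_def distrib_left sum_list_addf)

lemma kernel_form_smult: "kernel_form (\<lambda>a b. c * k a b) xs ys = c * kernel_form k xs ys"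
  by (simp add: kernel_form_def sum_list_const_mult[symmetric] algebra_simps)

lemma kernel_form_sum:
  "kernel_form (\<lambda>a b. \<Sum>t\<in>T. k t a b) xs ys = (\<Sum>t\<in>T. kernel_form (k t) xs ys)"
proof (cases "finite T")
  case True
  then show ?thesis
    by induction (simp_all add: kernel_form_add, simp add: kernel_form_def)
qed (simp add: kernel_form_def)

lemma kernel_form_rank_one:
  "kernel_form (\<lambda>a b. f a * cnj (f b)) xs ys =
    (\<Sum>p\<leftarrow>xs. fst p * f (snd p)) * cnj (\<Sum>q\<leftarrow>ys. fst q * f (snd q))"
  unfolding kernel_form_def cnj_sum_list map_map o_def sum_list_mult_const[symmetric]
    sum_list_const_mult[symmetric] by (subst sum_list_swap) (simp add: mult_ac)

lemma kernel_form_map_snd: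
  "kernel_form k (map (apsnd f) xs) (map (apsnd h) ys) = kernel_form (\<lambda>a b. k (f a) (h b)) xs ys"
  by (simp add: kernel_form_def o_def)

lemma continuous_on_sum_list:
  fixes f :: "'b :: topological_space \<Rightarrow> 'c \<Rightarrow> 'd :: topological_monoid_add"
  assumes "\<And>p. continuous_on S (\<lambda>x. f x p)"
  shows "continuous_on S (\<lambda>x. \<Sum>p\<leftarrow>xs. f x p)"
  by (induction xs) (auto intro!: continuous_intros assms)

text \<open>Strict convexity of the squared modulus with its exact defect: for
  \<open>0 < t < 1\<close> the last term vanishes only if \<open>z = z'\<close>.\<close>

lemma cmod_convex_combination:
  "(cmod (of_real t * z + of_real (1 - t) * z'))\<^sup>2 =
    t * (cmod z)\<^sup>2 + (1 - t) * (cmod z')\<^sup>2 - t * (1 - t) * (cmod (z - z'))\<^sup>2"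
  unfolding cmod_power2 by (simp add: power2_eq_square algebra_simps)

lemma continuous_on_kernel_form:
  assumes "\<And>a b. continuous_on S (\<lambda>x. k x a b)"
  shows "continuous_on S (\<lambda>x. kernel_form (k x) xs ys)"
  unfolding kernel_form_def
  by (intro continuous_on_sum_list continuous_intros assms)

section \<open>States of a group: compactness and extreme points\<close>

context group
begin

text \<open>The Gram kernel of an orbit: if \<open>\<phi> g\<close> is the inner product of
  \<open>\<pi> g \<xi>\<close> with \<open>\<xi>\<close>, the value at \<open>a\<close>,
  \<open>b\<close> is the inner product of \<open>\<pi> a \<xi>\<close> with
  \<open>\<pi> b \<xi>\<close>. Points outside the carrier become null vectors.\<close>

definition translation_kernel :: "('a \<Rightarrow> complex) \<Rightarrow> 'a \<Rightarrow> 'a \<Rightarrow> complex" where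
  "translation_kernel \<phi> a b =
     (if a \<in> carrier G \<and> b \<in> carrier G then \<phi> (inv b \<otimes> a) else 0)"

text \<open>Normalised positive-definite functions. Only the real part of the form is required to be
  nonnegative, so Hermitian symmetry is a separate condition. Vanishing outside the carrier makes a
  state determined by its values on the group.\<close>

definition states :: "('a \<Rightarrow> complex) set" where
  "states = {\<phi>. (\<forall>g. g \<notin> carrier G \<longrightarrow> \<phi> g = 0) \<and> \<phi> \<one> = 1 \<and>
     (\<forall>g\<in>carrier G. \<phi> (inv g) = cnj (\<phi> g)) \<and>
     (\<forall>xs. 0 \<le> Re (kernel_form (translation_kernel \<phi>) xs xs))}"

definition extreme_state :: "('a \<Rightarrow> complex) \<Rightarrow> bool" where
  "extreme_state \<phi> \<longleftrightarrow> \<phi> \<in> states \<and>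
     (\<forall>\<psi>\<in>states. \<forall>\<psi>'\<in>states. \<forall>t. 0 < t \<and> t < 1 \<and>
       (\<forall>g. \<phi> g = of_real t * \<psi> g + of_real (1 - t) * \<psi>' g) \<longrightarrow> \<psi> = \<phi> \<and> \<psi>' = \<phi>)"

text \<open>Multiplication by \<open>g\<close>, made a permutation of the whole type by fixing the points outside the
  carrier.\<close>

definition left_translation :: "'a \<Rightarrow> 'a \<Rightarrow> 'a" where
  "left_translation g a = (if a \<in> carrier G then g \<otimes> a else a)"

lemma left_translation_in_carrier [simp]:
  "g \<in> carrier G \<Longrightarrow> left_translation g a \<in> carrier G \<longleftrightarrow> a \<in> carrier G"
  by (auto simp: left_translation_def)

lemma left_translation_mult:
  "\<lbrakk>g \<in> carrier G; h \<in> carrier G\<rbrakk> \<Longrightarrow>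
    left_translation g (left_translation h a) = left_translation (g \<otimes> h) a"
  by (auto simp: left_translation_def m_assoc)

lemma left_translation_one [simp]: "left_translation \<one> a = a"
  by (simp add: left_translation_def)

lemma translation_kernel_invariant:
  assumes "g \<in> carrier G"
  shows "translation_kernel \<phi> (left_translation g a) (left_translation g b) = translation_kernel \<phi> a b"
proof -
  have "inv (g \<otimes> b) \<otimes> (g \<otimes> a) = inv b \<otimes> a" if "a \<in> carrier G" "b \<in> carrier G"
    using that assms by (simp add: inv_mult_group m_assoc[symmetric]) (simp add: m_assoc)
  then show ?thesis using assms by (auto simp: translation_kernel_def left_translation_def)
qed

lemma translation_kernel_commute:
  assumes "\<And>g. g \<in> carrier G \<Longrightarrow> \<phi> (inv g) = cnj (\<phi> g)"
  shows "translation_kernel \<phi> b a = cnj (translation_kernel \<phi> a b)"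
proof -
  have "\<phi> (inv a \<otimes> b) = cnj (\<phi> (inv b \<otimes> a))" if "a \<in> carrier G" "b \<in> carrier G"
    using assms[of "inv b \<otimes> a"] that by (simp add: inv_mult_group)
  then show ?thesis by (simp add: translation_kernel_def)
qed

lemma state_outside: "\<lbrakk>\<phi> \<in> states; g \<notin> carrier G\<rbrakk> \<Longrightarrow> \<phi> g = 0"
  by (simp add: states_def)

lemma state_one: "\<phi> \<in> states \<Longrightarrow> \<phi> \<one> = 1"
  by (simp add: states_def)

lemma state_inv: "\<lbrakk>\<phi> \<in> states; g \<in> carrier G\<rbrakk> \<Longrightarrow> \<phi> (inv g) = cnj (\<phi> g)"
  by (simp add: states_def)

lemma state_form_ge0: "\<phi> \<in> states \<Longrightarrow> 0 \<le> Re (kernel_form (translation_kernel \<phi>) xs xs)"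
  by (simp add: states_def)

lemma state_le_1:
  assumes \<phi>: "\<phi> \<in> states"
  shows "cmod (\<phi> g) \<le> 1"
proof (cases "g \<in> carrier G \<and> \<phi> g \<noteq> 0")
  case True
  \<comment> \<open>The phase that rotates \<open>\<phi> g\<close> onto the negative real axis;
    positivity at the unit plus \<open>c\<close> times \<open>g\<close> then reads
    \<open>2 - 2 * cmod (\<phi> g) \<ge> 0\<close>.\<close>
  define c where "c = - (cnj (\<phi> g) / of_real (cmod (\<phi> g)))"
  have c: "c * cnj c = 1"
    using True by (simp add: c_def complex_norm_square[symmetric] mult.commute[of "cnj _"] power2_eq_square)
  have cg: "c * \<phi> g = - of_real (cmod (\<phi> g))"
    using True by (simp add: c_def mult.commute[of "cnj _"] complex_norm_square[symmetric] power2_eq_square)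
  have "kernel_form (translation_kernel \<phi>) [(1, \<one>), (c, g)] [(1, \<one>), (c, g)] =
      2 + c * \<phi> g + cnj (c * \<phi> g)"
    using True \<phi> c
    by (simp add: kernel_form_def translation_kernel_def state_one state_inv algebra_simps)
  then show ?thesis using state_form_ge0[OF \<phi>, of "[(1, \<one>), (c, g)]"] by (simp add: cg)
next
  case False
  then show ?thesis using state_outside[OF \<phi>] by auto
qed

lemma closed_states: "closed states"
proof -
  have coord: "continuous_on UNIV (\<lambda>\<phi> :: 'a \<Rightarrow> complex. \<phi> g)" for g
    by (rule continuous_on_product_coordinates)
  have kernel: "continuous_on UNIV (\<lambda>\<phi>. kernel_form (translation_kernel \<phi>) xs xs)" for xs
  proof (rule continuous_on_kernel_form)
    show "continuous_on UNIV (\<lambda>\<phi>. translation_kernel \<phi> a b)" for a b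
      unfolding translation_kernel_def
      by (cases "a \<in> carrier G \<and> b \<in> carrier G") (simp_all only: simp_thms if_True if_False coord continuous_on_const)
  qed
  have "states = (\<Inter>g\<in>-carrier G. {\<phi>. \<phi> g = 0}) \<inter> {\<phi>. \<phi> \<one> = 1} \<inter>
      (\<Inter>g\<in>carrier G. {\<phi>. \<phi> (inv g) = cnj (\<phi> g)}) \<inter>
      (\<Inter>xs. {\<phi>. 0 \<le> Re (kernel_form (translation_kernel \<phi>) xs xs)})"
    by (auto simp: states_def)
  moreover have "closed \<dots>"
    by (intro closed_Int closed_INT ballI closed_Collect_eq closed_Collect_le continuous_intros
        coord kernel)
  ultimately show ?thesis by simp
qed

lemma compact_states: "compact states"
proof -
  have "compactin (product_topology (\<lambda>_. euclidean) UNIV) (Pi\<^sub>E UNIV (\<lambda>_::'a. cball (0::complex) 1))"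
    by (simp add: compactin_PiE)
  then have "compact (Pi\<^sub>E UNIV (\<lambda>_::'a. cball (0::complex) 1))"
    by (simp add: euclidean_product_topology)
  moreover have "states \<subseteq> Pi\<^sub>E UNIV (\<lambda>_. cball 0 1)"
    by (auto simp: state_le_1)
  ultimately show ?thesis
    using compact_Int_closed[OF _ closed_states] by (metis inf_absorb2)
qed

text \<open>A strictly convex function cannot attain its maximum in the interior of a segment.
  \<open>F\<close> is such a function, a weighted sum of squared moduli over the group, and the face
  property ensures that the ends of a segment through the maximiser compete in
  \<open>Y\<close>.\<close>

lemma extreme_state_exists:
  assumes count: "countable (carrier G)"
    and Y: "Y \<subseteq> states" "closed Y" "Y \<noteq> {}"
    and face: "\<And>\<psi> \<psi>' t. \<lbrakk>\<psi> \<in> states; \<psi>' \<in> states; 0 < t; t < 1;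
      (\<lambda>g. of_real t * \<psi> g + of_real (1 - t) * \<psi>' g) \<in> Y\<rbrakk> \<Longrightarrow> \<psi> \<in> Y \<and> \<psi>' \<in> Y"
  shows "\<exists>\<phi>\<in>Y. extreme_state \<phi>"
proof -
  \<comment> \<open>For a finite carrier this enumeration repeats elements; what matters is that
    each one occurs.\<close>
  define e where "e = from_nat_into (carrier G)"
  have e: "range e = carrier G"
    unfolding e_def by (rule range_from_nat_into) (use count in auto)
  define F where "F = (\<lambda>\<phi>. \<Sum>n. (1/2)^n * (cmod (\<phi> (e n)))\<^sup>2)"
  have bound: "norm ((1/2)^n * (cmod (\<phi> (e n)))\<^sup>2) \<le> (1/2)^n" if "\<phi> \<in> states" for \<phi> n
    using state_le_1[OF that, of "e n"] by (simp add: power_le_one mult_left_le)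
  have summable: "summable (\<lambda>n. (1/2)^n * (cmod (\<phi> (e n)))\<^sup>2)" if "\<phi> \<in> states" for \<phi>
    using bound[OF that] by (intro summable_comparison_test'[OF summable_geometric[of "1/2"]]) auto
  have "uniform_limit states (\<lambda>n \<phi>. \<Sum>i<n. (1/2)^i * (cmod (\<phi> (e i)))\<^sup>2) F sequentially"
    unfolding F_def by (rule Weierstrass_m_test[OF bound]) (auto intro: summable_geometric)
  then have "continuous_on states F"
    by (rule uniform_limit_theorem[rotated])
      (auto intro!: always_eventually continuous_intros
        continuous_on_subset[OF continuous_on_product_coordinates])
  then have cont: "continuous_on Y F" using Y(1) by (rule continuous_on_subset)
  have "compact Y" using compact_Int_closed[OF compact_states Y(2)] Y(1) by (simp add: inf_absorb2)
  from continuous_attains_sup[OF this Y(3) cont]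
  obtain \<phi> where \<phi>: "\<phi> \<in> Y" and max: "\<And>\<psi>. \<psi> \<in> Y \<Longrightarrow> F \<psi> \<le> F \<phi>" by blast
  have "\<psi> = \<phi> \<and> \<psi>' = \<phi>"
    if \<psi>: "\<psi> \<in> states" "\<psi>' \<in> states" and t: "0 < t" "t < 1"
      and eq: "\<forall>g. \<phi> g = of_real t * \<psi> g + of_real (1 - t) * \<psi>' g" for \<psi> \<psi>' t
  proof -
    define d where "d = (\<lambda>n. (1/2)^n * (cmod (\<psi> (e n) - \<psi>' (e n)))\<^sup>2)"
    have "(\<lambda>g. of_real t * \<psi> g + of_real (1 - t) * \<psi>' g) = \<phi>"
      by (rule ext) (rule eq[rule_format, symmetric])
    then have inY: "\<psi> \<in> Y" "\<psi>' \<in> Y"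
      using face[OF \<psi> t] \<phi> by simp_all
    have term_eq: "t * (1 - t) * d n = t * ((1/2)^n * (cmod (\<psi> (e n)))\<^sup>2) +
        (1 - t) * ((1/2)^n * (cmod (\<psi>' (e n)))\<^sup>2) - (1/2)^n * (cmod (\<phi> (e n)))\<^sup>2" for n
      unfolding eq[rule_format, of "e n"] cmod_convex_combination d_def by (simp add: algebra_simps)
    \<comment> \<open>The defects of strict convexity of the summands of \<open>F\<close> add up to
      \<open>L\<close>, and maximality makes \<open>L\<close> nonpositive; so every defect is
      zero.\<close>
    define L where "L = t * F \<psi> + (1 - t) * F \<psi>' - F \<phi>"
    have sums: "(\<lambda>n. t * (1 - t) * d n) sums L"
      unfolding term_eq F_def L_def
      by (intro sums_diff sums_add sums_mult summable_sums summable \<psi>) (use \<phi> Y in auto)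
    have "t * F \<psi> + (1 - t) * F \<psi>' \<le> t * F \<phi> + (1 - t) * F \<phi>"
      using max[OF inY(1)] max[OF inY(2)] t by (intro add_mono mult_left_mono) auto
    then have L: "L \<le> 0" by (simp add: L_def algebra_simps)
    have nonneg: "t * (1 - t) * d n \<ge> 0" for n
      using t by (simp add: d_def)
    have "t * (1 - t) * d n \<le> L" for n
      using sum_le_suminf[of "\<lambda>n. t * (1 - t) * d n" "{n}"] sums nonneg
      by (simp add: sums_iff)
    then have "t * (1 - t) * d n = 0" for n
      using nonneg[of n] L order_antisym order_trans by blast
    then have "\<psi> (e n) = \<psi>' (e n)" for n using t by (auto simp: d_def)
    then have on_carrier: "\<psi> g = \<psi>' g" if "g \<in> carrier G" for g
      using that e by (metis rangeE)
    have eq': "\<psi> g = \<psi>' g" for g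
      by (cases "g \<in> carrier G") (simp_all add: on_carrier state_outside \<psi>)
    then have "\<phi> g = \<psi>' g" for g
      unfolding eq[rule_format, of g] eq' by (simp flip: distrib_right)
    with eq' have "\<phi> = \<psi>'" "\<psi> = \<psi>'" by blast+
    then show ?thesis by simp
  qed
  then have "extreme_state \<phi>"
    using \<phi> Y(1) unfolding extreme_state_def by blast
  then show ?thesis using \<phi> by blast
qed

section \<open>States that extend a unitary character\<close>

definition extend_by_zero :: "'a set \<Rightarrow> ('a \<Rightarrow> complex) \<Rightarrow> 'a \<Rightarrow> complex" where
  "extend_by_zero H \<theta> = (\<lambda>g. if g \<in> H then \<theta> g else 0)"

definition unitary_character :: "'a set \<Rightarrow> ('a \<Rightarrow> complex) \<Rightarrow> bool" where
  "unitary_character H \<theta> \<longleftrightarrow> subgroup H G \<and> (\<forall>a\<in>H. cmod (\<theta> a) = 1) \<and>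
     (\<forall>a\<in>H. \<forall>b\<in>H. \<theta> (a \<otimes> b) = \<theta> a * \<theta> b)"

lemma unitary_character_one:
  assumes "unitary_character H \<theta>"
  shows "\<theta> \<one> = 1"
proof -
  have "\<one> \<in> H" using assms by (simp add: unitary_character_def subgroup.one_closed)
  then have "\<theta> \<one> * \<theta> \<one> = \<theta> \<one>" "\<theta> \<one> \<noteq> 0"
    using assms unfolding unitary_character_def by (metis l_one one_closed, metis norm_zero zero_neq_one)
  then show ?thesis by simp
qed

lemma unitary_character_inv:
  assumes "unitary_character H \<theta>" "a \<in> H"
  shows "\<theta> (inv a) = cnj (\<theta> a)"
proof -
  have H: "subgroup H G" and 1: "cmod (\<theta> a) = 1" using assms by (auto simp: unitary_character_def)
  have "\<theta> (inv a) * \<theta> a = \<theta> (inv a \<otimes> a)"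
    using assms H unfolding unitary_character_def by (simp add: subgroup.m_inv_closed)
  also have "\<dots> = 1"
    using unitary_character_one[OF assms(1)] assms(2) subgroup.mem_carrier[OF H] by simp
  finally have *: "\<theta> (inv a) * \<theta> a = 1" .
  have "\<theta> (inv a) = \<theta> (inv a) * (\<theta> a * cnj (\<theta> a))"
    using 1 by (simp add: complex_norm_square[symmetric])
  also have "\<dots> = cnj (\<theta> a)" using * by (simp add: mult.assoc[symmetric])
  finally show ?thesis .
qed

text \<open>This is the coefficient of the representation induced from \<open>\<theta>\<close>. Its
  kernel is a sum of rank-one kernels, one for each left coset of \<open>H\<close>, so the form is a
  sum of squares.\<close>

lemma extend_by_zero_in_states:
  assumes \<theta>: "unitary_character H \<theta>"
  shows "extend_by_zero H \<theta> \<in> states"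
proof -
  have H: "subgroup H G" using \<theta> by (simp add: unitary_character_def)
  note Hc = subgroup.mem_carrier[OF H]
  \<comment> \<open>A representative of the left coset of \<open>a\<close>. The predicate under
    \<open>SOME\<close> depends only on the coset, hence so does the choice.\<close>
  define r where "r = (\<lambda>a. SOME t. t \<in> carrier G \<and> inv t \<otimes> a \<in> H)"
  have r: "r a \<in> carrier G \<and> inv (r a) \<otimes> a \<in> H" if "a \<in> carrier G" for a
    unfolding r_def by (rule someI[of _ a]) (use that H in \<open>simp add: subgroup.one_closed\<close>)
  have r_eq: "r a = r b \<longleftrightarrow> inv b \<otimes> a \<in> H" if ab: "a \<in> carrier G" "b \<in> carrier G" for a b
  proof
    assume "inv b \<otimes> a \<in> H"
    moreover have "inv t \<otimes> a = (inv t \<otimes> b) \<otimes> (inv b \<otimes> a)"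
      "inv t \<otimes> b = (inv t \<otimes> a) \<otimes> inv (inv b \<otimes> a)" if "t \<in> carrier G" for t
      using that ab by (simp_all add: inv_mult_group m_assoc) (simp_all add: m_assoc[symmetric])
    ultimately have "t \<in> carrier G \<and> inv t \<otimes> a \<in> H \<longleftrightarrow> t \<in> carrier G \<and> inv t \<otimes> b \<in> H" for t
      using H by (metis subgroup.m_closed subgroup.m_inv_closed)
    then show "r a = r b" by (simp add: r_def)
  next
    assume eq: "r a = r b"
    have "inv b \<otimes> a = inv (inv (r b) \<otimes> b) \<otimes> (inv (r b) \<otimes> a)"
      using ab r by (simp add: inv_mult_group m_assoc) (simp add: m_assoc[symmetric])
    then show "inv b \<otimes> a \<in> H"
      using r[OF ab(1)] r[OF ab(2)] H eq by (metis subgroup.m_closed subgroup.m_inv_closed)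
  qed
  \<comment> \<open>\<open>f t\<close> is \<open>\<theta>\<close> transported to the coset of
    \<open>t\<close>. Only \<open>t = r a\<close> contributes below, so any finite \<open>T\<close>
    that contains it gives the kernel.\<close>
  define f where "f = (\<lambda>t a. if a \<in> carrier G \<and> r a = t then \<theta> (inv t \<otimes> a) else 0)"
  let ?k = "translation_kernel (extend_by_zero H \<theta>)"
  have k: "?k a b = (\<Sum>t\<in>T. f t a * cnj (f t b))" if T: "finite T" "r a \<in> T" for a b T
  proof (cases "a \<in> carrier G \<and> b \<in> carrier G \<and> inv b \<otimes> a \<in> H")
    case True
    then have rr: "r a = r b" and ab: "a \<in> carrier G" "b \<in> carrier G" using r_eq by auto
    define t where "t = r a"
    have t: "t \<in> carrier G" "inv t \<otimes> a \<in> H" "inv t \<otimes> b \<in> H"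
      using r[OF ab(1)] r[OF ab(2)] rr by (auto simp: t_def)
    have "(\<Sum>t\<in>T. f t a * cnj (f t b)) = (\<Sum>t\<in>{t}. f t a * cnj (f t b))"
      using T by (intro sum.mono_neutral_right) (auto simp: f_def t_def)
    also have "\<dots> = cnj (\<theta> (inv t \<otimes> b)) * \<theta> (inv t \<otimes> a)"
      using ab rr by (simp add: f_def t_def)
    also have "\<dots> = \<theta> (inv (inv t \<otimes> b) \<otimes> (inv t \<otimes> a))"
      using \<theta> t H unitary_character_inv[OF \<theta>]
      by (simp add: unitary_character_def subgroup.m_inv_closed)
    also have "inv (inv t \<otimes> b) \<otimes> (inv t \<otimes> a) = inv b \<otimes> a"
      using ab t by (simp add: inv_mult_group m_assoc) (simp add: m_assoc[symmetric])
    finally show ?thesis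
      using True by (simp add: translation_kernel_def extend_by_zero_def)
  next
    case False
    then have "a \<notin> carrier G \<or> b \<notin> carrier G \<or> r a \<noteq> r b" using r_eq[of a b] by blast
    then have "f t a * cnj (f t b) = 0" for t by (auto simp: f_def)
    then have "(\<Sum>t\<in>T. f t a * cnj (f t b)) = 0" by (rule sum.neutral[OF ballI])
    then show ?thesis using False by (auto simp: translation_kernel_def extend_by_zero_def)
  qed
  have "0 \<le> Re (kernel_form ?k xs xs)" for xs
  proof -
    let ?T = "r ` snd ` set xs"
    have "kernel_form ?k xs xs = kernel_form (\<lambda>a b. \<Sum>t\<in>?T. f t a * cnj (f t b)) xs xs"
      by (intro kernel_form_cong k) auto
    also have "\<dots> = (\<Sum>t\<in>?T. of_real ((cmod (\<Sum>p\<leftarrow>xs. fst p * f t (snd p)))\<^sup>2))"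
      unfolding kernel_form_sum kernel_form_rank_one by (simp only: complex_norm_square)
    finally have "Re (kernel_form ?k xs xs) = (\<Sum>t\<in>?T. (cmod (\<Sum>p\<leftarrow>xs. fst p * f t (snd p)))\<^sup>2)"
      by (simp flip: of_real_power)
    then show ?thesis by (simp add: sum_nonneg)
  qed
  moreover have "inv g \<in> H \<longleftrightarrow> g \<in> H" if "g \<in> carrier G" for g
    using H that by (metis inv_inv subgroup.m_inv_closed)
  ultimately show ?thesis
    using Hc unitary_character_one[OF \<theta>] unitary_character_inv[OF \<theta>] subgroup.one_closed[OF H]
    by (auto simp: states_def extend_by_zero_def)
qed

text \<open>States take values in the unit disc, and the unimodular numbers
  \<open>\<theta> h\<close> are extreme points of it. Prescribing them on \<open>H\<close> therefore
  cuts out a face, and \<open>extend_by_zero\<close> shows that it is nonempty.\<close>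

lemma extreme_state_extends_character:
  assumes count: "countable (carrier G)" and \<theta>: "unitary_character H \<theta>"
  obtains \<phi> where "extreme_state \<phi>" "\<And>h. h \<in> H \<Longrightarrow> \<phi> h = \<theta> h"
proof -
  have 1: "cmod (\<theta> h) = 1" if "h \<in> H" for h using \<theta> that by (simp add: unitary_character_def)
  let ?Y = "{\<phi> \<in> states. \<forall>h\<in>H. \<phi> h = \<theta> h}"
  have convex: "z = w \<and> z' = w"
    if z: "cmod z \<le> 1" "cmod z' \<le> 1" "cmod w = 1" and t: "0 < t" "t < 1"
      and eq: "of_real t * z + of_real (1 - t) * z' = w" for z z' w :: complex and t :: real
  proof -
    have "(cmod w)\<^sup>2 = t * (cmod z)\<^sup>2 + (1 - t) * (cmod z')\<^sup>2 - t * (1 - t) * (cmod (z - z'))\<^sup>2"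
      unfolding eq[symmetric] by (rule cmod_convex_combination)
    moreover have "t * (cmod z)\<^sup>2 + (1 - t) * (cmod z')\<^sup>2 \<le> t * 1 + (1 - t) * 1"
      using z t by (intro add_mono mult_left_mono) (auto simp: power_le_one)
    ultimately have "t * (1 - t) * (cmod (z - z'))\<^sup>2 \<le> 0" using z by simp
    then have "(cmod (z - z'))\<^sup>2 \<le> 0" using t by (simp add: mult_le_0_iff)
    then have "z = z'" by simp
    then show ?thesis using eq by (auto simp: algebra_simps)
  qed
  have "\<exists>\<phi>\<in>?Y. extreme_state \<phi>"
  proof (rule extreme_state_exists[OF count])
    show "closed ?Y"
    proof -
      have "?Y = states \<inter> (\<Inter>h\<in>H. {\<phi>. \<phi> h = \<theta> h})" by auto
      moreover have "closed \<dots>"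
        by (intro closed_Int closed_INT ballI closed_Collect_eq continuous_intros
            continuous_on_product_coordinates closed_states)
      ultimately show ?thesis by simp
    qed
    have "extend_by_zero H \<theta> \<in> ?Y"
      using extend_by_zero_in_states[OF \<theta>] by (auto simp: extend_by_zero_def)
    then show "?Y \<noteq> {}" by blast
    show "\<psi> \<in> ?Y \<and> \<psi>' \<in> ?Y"
      if "\<psi> \<in> states" "\<psi>' \<in> states" "0 < t" "t < 1"
        "(\<lambda>g. of_real t * \<psi> g + of_real (1 - t) * \<psi>' g) \<in> ?Y" for \<psi> \<psi>' t
      using that convex[OF state_le_1 state_le_1 1] by blast
  qed auto
  then show thesis using that by blast
qed

end

section \<open>Characters of abelian groups\<close>

lemma kernel_form_scale_right: "kernel_form k zs (map (apfst ((*) c)) xs) = cnj c * kernel_form k zs xs"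
  unfolding kernel_form_def sum_list_const_mult[symmetric]
  by (simp add: o_def mult_ac)

lemma (in group) extreme_stateD:
  assumes "extreme_state \<phi>" "\<psi> \<in> states" "\<psi>' \<in> states" "0 < t" "t < 1"
    and "\<And>g. \<phi> g = of_real t * \<psi> g + of_real (1 - t) * \<psi>' g"
  shows "\<psi> = \<phi>"
  by (rule assms(1)[unfolded extreme_state_def, THEN conjunct2, THEN bspec[OF _ assms(2)],
        THEN bspec[OF _ assms(3)], THEN spec[of _ t], THEN mp, THEN conjunct1])
    (intro conjI allI assms)

text \<open>Evaluates the identity \<open>Q_eq\<close> in the next proof at \<open>c = 1\<close> and
  \<open>c = \<i>\<close>, with \<open>P\<close>, \<open>A\<close>, \<open>B\<close>,
  \<open>z\<close> for the values of \<open>\<phi>\<close> at \<open>h\<close>,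
  \<open>g \<otimes> h\<close>, \<open>inv g \<otimes> h\<close>, \<open>g\<close>. The first case
  determines \<open>A + B\<close>, the second \<open>A - B\<close>.\<close>

lemma complex_eq_from_Re_Im:
  fixes A B P z :: complex
  assumes 1: "P + (A + B) / 4 = of_real (1 + Re z / 2) * P"
    and 2: "P + (\<i> * A - \<i> * B) / 4 = of_real (1 - Im z / 2) * P"
  shows "A = z * P"
proof -
  have "(A + B) / 4 = of_real (Re z / 2) * P"
    using 1 unfolding of_real_add of_real_1 distrib_right mult_1 by (rule add_left_imp_eq)
  then have "4 * ((A + B) / 4) = 4 * (of_real (Re z / 2) * P)" by (rule arg_cong)
  then have a: "A + B = 2 * of_real (Re z) * P" by simp
  have b: "\<i> * (A - B) = - (2 * of_real (Im z) * P)" using 2 by (simp add: left_diff_distrib right_diff_distrib)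
  have "A - B = - \<i> * (\<i> * (A - B))" by simp
  then have c: "A - B = 2 * (\<i> * of_real (Im z)) * P" unfolding b by simp
  have "2 * A = (A + B) + (A - B)" by simp
  also have "\<dots> = 2 * ((of_real (Re z) + \<i> * of_real (Im z)) * P)" unfolding a c by (simp add: distrib_right distrib_left)
  finally show ?thesis by (simp add: complex_eq[symmetric])
qed

context comm_group
begin

text \<open>Since the group is abelian, a small perturbation of \<open>\<phi>\<close> by its
  translates along \<open>g\<close> remains positive-definite. As \<open>\<phi>\<close> is the
  average of \<open>Q c\<close> and \<open>Q (- c)\<close>, extremality makes \<open>Q c\<close> a
  multiple of \<open>\<phi>\<close> for each unimodular \<open>c\<close>, which contains the product
  formula.\<close>

lemma extreme_state_mult:
  assumes \<phi>: "extreme_state \<phi>" and g: "g \<in> carrier G" and h: "h \<in> carrier G"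
  shows "\<phi> (g \<otimes> h) = \<phi> g * \<phi> h"
proof -
  have \<phi>s: "\<phi> \<in> states" using \<phi> by (simp add: extreme_state_def)
  let ?K = "translation_kernel \<phi>"
  \<comment> \<open>For unimodular \<open>c\<close> this is the coefficient of the operator
    \<open>1 + U / 4\<close>, where \<open>U\<close> is \<open>c g\<close> plus its adjoint and has
    norm at most 2. The factor 1/4 keeps \<open>p c\<close>, the value of \<open>Q c\<close> at the
    unit, strictly between 0 and 2.\<close>
  define Q where "Q = (\<lambda>c h. if h \<in> carrier G
    then \<phi> h + (c * \<phi> (g \<otimes> h) + cnj c * \<phi> (inv g \<otimes> h)) / 4 else 0)"
  define p where "p = (\<lambda>c. 1 + Re (c * \<phi> g) / 2)"
  have p_bounds: "p c > 0" "p c < 2" if c: "cmod c = 1" for c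
  proof -
    have "\<bar>Re (c * \<phi> g)\<bar> \<le> cmod (c * \<phi> g)" by (rule abs_Re_le_cmod)
    also have "\<dots> \<le> 1" using c state_le_1[OF \<phi>s] by (simp add: norm_mult)
    finally show "p c > 0" "p c < 2" unfolding p_def by linarith+
  qed
  have Q_one: "Q c \<one> = of_real (p c)" for c
    using g \<phi>s complex_add_cnj[of "c * \<phi> g"]
    by (simp add: Q_def p_def state_one state_inv)
  have Q_inv: "Q c (inv k) = cnj (Q c k)" if k: "k \<in> carrier G" for c k
  proof -
    have "g \<otimes> inv k = inv (inv g \<otimes> k)" "inv g \<otimes> inv k = inv (g \<otimes> k)"
      using g k by (simp_all add: inv_mult_group m_comm)
    then show ?thesis using g k \<phi>s by (simp add: Q_def state_inv)
  qed
  have Q_form: "0 \<le> Re (kernel_form (translation_kernel (Q c)) xs xs)" if c: "cmod c = 1" for c xs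
  proof -
    let ?tr = "left_translation g"
    define ys where "ys = map (apfst ((*) c)) (map (apsnd ?tr) xs)"
    have cc: "c * cnj c = 1" using c by (simp add: complex_norm_square[symmetric])
    have "kernel_form ?K (map (apsnd ?tr) xs) (map (apsnd id) xs) = kernel_form (\<lambda>a b. ?K (?tr a) b) xs xs"
      "kernel_form ?K (map (apsnd id) xs) (map (apsnd ?tr) xs) = kernel_form (\<lambda>a b. ?K a (?tr b)) xs xs"
      unfolding kernel_form_map_snd by simp_all
    then have yx: "kernel_form ?K ys xs = c * kernel_form (\<lambda>a b. ?K (?tr a) b) xs xs"
      and xy: "kernel_form ?K xs ys = cnj c * kernel_form (\<lambda>a b. ?K a (?tr b)) xs xs"
      unfolding ys_def kernel_form_scale_left kernel_form_scale_right by simp_all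
    have yy: "kernel_form ?K ys ys = kernel_form ?K xs xs"
      unfolding ys_def kernel_form_scale_left kernel_form_scale_right kernel_form_map_snd
        translation_kernel_invariant[OF g] using cc by (simp add: mult.commute[of "cnj c" c] flip: mult.assoc)
    \<comment> \<open>Commutativity moves \<open>g\<close> past \<open>inv b\<close>, so both
      translates of \<open>\<phi>\<close> come from translating one argument of its kernel.\<close>
    have tq: "translation_kernel (Q c) a b =
        ?K a b + (c / 4 * ?K (?tr a) b + cnj c / 4 * ?K a (?tr b))" for a b
    proof -
      have "g \<otimes> (inv b \<otimes> a) = inv b \<otimes> (g \<otimes> a)" "inv g \<otimes> (inv b \<otimes> a) = inv (g \<otimes> b) \<otimes> a"
        if "a \<in> carrier G" "b \<in> carrier G"
        using that g by (simp_all add: inv_mult_group m_lcomm m_assoc)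
      then show ?thesis
        using g by (simp add: translation_kernel_def Q_def left_translation_def add_divide_distrib)
    qed
    have "4 * kernel_form (translation_kernel (Q c)) xs xs =
        4 * kernel_form ?K xs xs + (kernel_form ?K ys xs + kernel_form ?K xs ys)"
      unfolding tq[abs_def] kernel_form_add kernel_form_smult xy yx by (simp add: algebra_simps)
    \<comment> \<open>The mixed terms are completed to the square of \<open>xs @ ys\<close>; by
      invariance \<open>ys\<close> has the same square as \<open>xs\<close>.\<close>
    also have "\<dots> = 2 * kernel_form ?K xs xs + kernel_form ?K (xs @ ys) (xs @ ys)"
      by (simp add: kernel_form_append_left kernel_form_append_right yy)
    finally have "4 * Re (kernel_form (translation_kernel (Q c)) xs xs) =
        2 * Re (kernel_form ?K xs xs) + Re (kernel_form ?K (xs @ ys) (xs @ ys))"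
      by (simp add: complex_eq_iff)
    then show ?thesis
      using state_form_ge0[OF \<phi>s, of xs] state_form_ge0[OF \<phi>s, of "xs @ ys"] by linarith
  qed
  define S where "S = (\<lambda>c h. of_real (1 / p c) * Q c h)"
  have S_state: "S c \<in> states" if c: "cmod c = 1" for c
  proof -
    have "translation_kernel (S c) = (\<lambda>a b. of_real (1 / p c) * translation_kernel (Q c) a b)"
      by (auto simp: translation_kernel_def S_def fun_eq_iff)
    then have "kernel_form (translation_kernel (S c)) xs xs =
        of_real (1 / p c) * kernel_form (translation_kernel (Q c)) xs xs" for xs
      by (simp only: kernel_form_smult)
    then have "0 \<le> Re (kernel_form (translation_kernel (S c)) xs xs)" for xs
      using Q_form[OF c, of xs] p_bounds[OF c] by (simp add: Re_complex_of_real)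
    moreover have "S c \<one> = 1" using p_bounds[OF c] by (simp add: S_def Q_one)
    moreover have "S c (inv k) = cnj (S c k)" if "k \<in> carrier G" for k
      using that by (simp add: S_def Q_inv)
    moreover have "S c k = 0" if "k \<notin> carrier G" for k
      using that by (simp add: S_def Q_def)
    ultimately show ?thesis by (simp add: states_def)
  qed
  have Q_eq: "Q c h = of_real (p c) * \<phi> h" if c: "cmod c = 1" for c
  proof -
    have mc: "cmod (- c) = 1" using c by simp
    have p': "p (- c) = 2 - p c" by (simp add: p_def)
    have Q_sum: "Q c k + Q (- c) k = 2 * \<phi> k" for k
    proof (cases "k \<in> carrier G")
      case True
      have "z + (x + y) / 4 + (z + (- x + - y) / 4) = 2 * z" for x y z :: complex
        by (simp add: field_simps)
      from this[of "\<phi> k" "c * \<phi> (g \<otimes> k)" "cnj c * \<phi> (inv g \<otimes> k)"] True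
      show ?thesis by (simp only: Q_def if_True complex_cnj_minus mult_minus_left)
    qed (simp add: Q_def state_outside[OF \<phi>s])
    \<comment> \<open>The weights are half the values of \<open>Q c\<close> and
      \<open>Q (- c)\<close> at the unit, so they cancel the normalisation in
      \<open>S\<close>.\<close>
    have "\<phi> k = of_real (p c / 2) * S c k + of_real (1 - p c / 2) * S (- c) k" for k
    proof -
      have half: "of_real (y / 2) * (of_real (1 / y) * z) = z / 2" if "y > 0" for y :: real and z :: complex
        using that by simp
      have "1 - p c / 2 = p (- c) / 2" by (simp add: p' field_simps)
      then have "of_real (p c / 2) * S c k + of_real (1 - p c / 2) * S (- c) k = Q c k / 2 + Q (- c) k / 2"
        unfolding S_def by (simp only: half p_bounds c mc)
      then show ?thesis using Q_sum[of k] by (simp add: field_simps)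
    qed
    moreover have "0 < p c / 2" "p c / 2 < 1" using p_bounds[OF c] by auto
    ultimately have "S c = \<phi>" by (intro extreme_stateD[OF \<phi> S_state[OF c] S_state[OF mc]])
    then have "S c h = \<phi> h" by simp
    then show ?thesis using p_bounds[OF c] by (simp add: S_def field_simps)
  qed
  show ?thesis
  proof (rule complex_eq_from_Re_Im)
    show "\<phi> h + (\<phi> (g \<otimes> h) + \<phi> (inv g \<otimes> h)) / 4 = of_real (1 + Re (\<phi> g) / 2) * \<phi> h"
      using Q_eq[of 1] h by (simp add: Q_def p_def)
    show "\<phi> h + (\<i> * \<phi> (g \<otimes> h) - \<i> * \<phi> (inv g \<otimes> h)) / 4 = of_real (1 - Im (\<phi> g) / 2) * \<phi> h"
      using Q_eq[of \<i>] h by (simp add: Q_def p_def)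
  qed
qed

text \<open>The minimisers of the real part at \<open>h\<close> form a closed face, and the state
  concentrated at the unit shows that the minimum is at most 0. An extreme minimiser is
  multiplicative, hence unimodular because \<open>\<phi> (inv a) = cnj (\<phi> a)\<close>, and its
  value at \<open>h\<close> is not 1.\<close>

theorem characters_separate_points:
  assumes "countable (carrier G)" and h: "h \<in> carrier G" "h \<noteq> \<one>"
  obtains \<theta> where "unitary_character (carrier G) \<theta>" "\<theta> h \<noteq> 1"
proof -
  let ?\<delta> = "extend_by_zero {\<one>} (\<lambda>_. 1)"
  have \<delta>: "?\<delta> \<in> states"
    by (rule extend_by_zero_in_states) (simp add: unitary_character_def triv_subgroup)
  let ?Y = "{\<phi> \<in> states. \<forall>\<psi>\<in>states. Re (\<phi> h) \<le> Re (\<psi> h)}"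
  have cont: "continuous_on A (\<lambda>\<phi> :: 'a \<Rightarrow> complex. Re (\<phi> h))" for A
    by (intro continuous_intros continuous_on_subset[OF continuous_on_product_coordinates]) auto
  have "\<exists>\<phi>\<in>?Y. extreme_state \<phi>"
  proof (rule extreme_state_exists[OF assms(1)])
    have "?Y = states \<inter> (\<Inter>\<psi>\<in>states. {\<phi>. Re (\<phi> h) \<le> Re (\<psi> h)})" by auto
    moreover have "closed \<dots>"
      by (intro closed_Int closed_INT ballI closed_Collect_le closed_states cont continuous_on_const)
    ultimately show "closed ?Y" by simp
    have "\<exists>\<phi>\<in>states. \<forall>\<psi>\<in>states. Re (\<phi> h) \<le> Re (\<psi> h)"
      by (rule continuous_attains_inf[OF compact_states _ cont]) (use \<delta> in blast)
    then show "?Y \<noteq> {}" by blast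
    show "\<psi> \<in> ?Y \<and> \<psi>' \<in> ?Y"
      if \<psi>: "\<psi> \<in> states" "\<psi>' \<in> states" and t: "0 < t" "t < 1"
        and Y: "(\<lambda>g. of_real t * \<psi> g + of_real (1 - t) * \<psi>' g) \<in> ?Y" for \<psi> \<psi>' t
    proof -
      \<comment> \<open>\<open>m\<close> is the minimum, written as a weighted average of two values
        that are at least \<open>m\<close>; so both equal it.\<close>
      define m where "m = t * Re (\<psi> h) + (1 - t) * Re (\<psi>' h)"
      have m: "m \<le> Re (\<eta> h)" if "\<eta> \<in> states" for \<eta>
        using Y that by (simp add: m_def)
      have "(1 - t) * (Re (\<psi>' h) - Re (\<psi> h)) \<le> 0" "t * (Re (\<psi> h) - Re (\<psi>' h)) \<le> 0"
        using m[OF \<psi>(1)] m[OF \<psi>(2)] by (simp_all add: m_def algebra_simps)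
      then have "Re (\<psi> h) = Re (\<psi>' h)"
        using t by (simp add: mult_le_0_iff)
      then have "Re (\<psi> h) = m" "Re (\<psi>' h) = m" by (simp_all add: m_def algebra_simps)
      then show ?thesis using m \<psi> by auto
    qed
  qed auto
  then obtain \<phi> where \<phi>: "\<phi> \<in> states" "extreme_state \<phi>" and min: "\<And>\<psi>. \<psi> \<in> states \<Longrightarrow> Re (\<phi> h) \<le> Re (\<psi> h)"
    by blast
  have "Re (\<phi> h) \<le> 0" using min[OF \<delta>] h by (simp add: extend_by_zero_def)
  then have "\<phi> h \<noteq> 1" by auto
  moreover have "cmod (\<phi> a) = 1" if a: "a \<in> carrier G" for a
  proof -
    have "1 = \<phi> (inv a \<otimes> a)" using a \<phi> by (simp add: state_one)
    also have "\<dots> = cnj (\<phi> a) * \<phi> a"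
      using a \<phi> by (subst extreme_state_mult) (simp_all add: state_inv)
    also have "\<dots> = of_real ((cmod (\<phi> a))\<^sup>2)" by (subst complex_norm_square) (rule mult.commute)
    finally have "(cmod (\<phi> a))\<^sup>2 = 1" by (simp only: of_real_eq_1_iff[symmetric, where 'a = complex])
    then show ?thesis by (simp add: abs_square_eq_1)
  qed
  ultimately show thesis
    using \<phi> by (intro that[of \<phi>]) (auto simp: unitary_character_def subgroup_self extreme_state_mult)
qed

end

section \<open>Extreme states and irreducibility\<close>

text \<open>A sequence in \<open>W\<close> that minimises the distance to \<open>x\<close> is Cauchy
  by the parallelogram law, and at the minimiser no step along \<open>W\<close> can lower the
  distance.\<close>

lemma (in complex_hilbert_space) projection_exists:
  assumes W: "closed_subspace W V" and x: "x \<in> carrier V"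
  obtains y where "y \<in> W" "\<And>z. z \<in> W \<Longrightarrow> hinner V (x \<ominus> y) z = 0"
proof -
  have sub: "submodule W complex_field V" and cl: "closedin metric.mtopology W"
    using W by (auto simp: closed_subspace_def)
  note E = submoduleE[OF sub]
  have Wc: "z \<in> carrier V" if "z \<in> W" for z using E(1) that by blast
  have zW: "\<zero> \<in> W"
    using subgroup.one_closed[OF submodule.axioms(1)[OF sub]] by simp
  have smc [simp]: "c \<odot> z \<in> carrier V" if "z \<in> carrier V" for c z
    using that smult_closed by simp
  define q where "q = (\<lambda>y. Re (hinner V (x \<ominus> y) (x \<ominus> y)))"
  have q_ge0: "q y \<ge> 0" if "y \<in> carrier V" for y
    using that x by (simp add: q_def hinner_self_ge0)
  define d where "d = (INF y\<in>W. q y)"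
  have bdd: "bdd_below (q ` W)" by (rule bdd_belowI[of _ 0]) (use q_ge0 Wc in auto)
  have d_le: "d \<le> q y" if "y \<in> W" for y
    unfolding d_def using that bdd by (simp add: cINF_lower)
  have d_ge0: "d \<ge> 0" unfolding d_def by (rule cINF_greatest) (use zW q_ge0 Wc in auto)
  have "\<exists>y\<in>W. q y < d + inverse (real (Suc n))" for n
    using cINF_less_iff[OF _ bdd, of "d + inverse (real (Suc n))"] zW unfolding d_def by auto
  then obtain \<sigma> where \<sigma>: "\<And>n. \<sigma> n \<in> W" "\<And>n. q (\<sigma> n) < d + inverse (real (Suc n))" by metis
  have parallelogram: "Re (hinner V (a \<ominus> b) (a \<ominus> b)) =
      2 * q a + 2 * q b - 4 * q ((1/2) \<odot> (a \<oplus> b))"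
    if a: "a \<in> carrier V" and b: "b \<in> carrier V" for a b
    using a b x hinner_commute[OF x a] hinner_commute[OF x b] hinner_commute[OF a b]
    by (simp add: q_def hinner_minus_left hinner_minus_right hinner_add_left hinner_add_right
        hinner_smult_left hinner_smult_right algebra_simps)
  have "metric.MCauchy \<sigma>"
    unfolding metric.MCauchy_def
  proof (intro conjI allI impI)
    show "range \<sigma> \<subseteq> carrier V" using \<sigma>(1) Wc by blast
    fix \<epsilon> :: real assume \<epsilon>: "\<epsilon> > 0"
    \<comment> \<open>Two excesses over \<open>d\<close> enter the parallelogram law, each with
      factor 2; hence the 4.\<close>
    then have "\<forall>\<^sub>F n in sequentially. inverse (real (Suc n)) < \<epsilon>\<^sup>2 / 4"
      by (intro order_tendstoD(2)[OF LIMSEQ_inverse_real_of_nat]) simp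
    then obtain N where N: "\<And>n. n \<ge> N \<Longrightarrow> inverse (real (Suc n)) < \<epsilon>\<^sup>2 / 4"
      unfolding eventually_sequentially by blast
    have "hdist V (\<sigma> m) (\<sigma> n) < \<epsilon>" if mn: "N \<le> m" "N \<le> n" for m n
    proof -
      have "(1/2) \<odot> (\<sigma> m \<oplus> \<sigma> n) \<in> W" using E(4) E(5) \<sigma>(1) by simp
      from d_le[OF this]
      have "Re (hinner V (\<sigma> m \<ominus> \<sigma> n) (\<sigma> m \<ominus> \<sigma> n)) < \<epsilon>\<^sup>2"
        using parallelogram[of "\<sigma> m" "\<sigma> n"] \<sigma>(1) \<sigma>(2)[of m] \<sigma>(2)[of n] N[OF mn(1)] N[OF mn(2)]
        by (simp add: Wc)
      then have "sqrt (Re (hinner V (\<sigma> m \<ominus> \<sigma> n) (\<sigma> m \<ominus> \<sigma> n))) < \<epsilon>"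
        using \<epsilon> by (simp add: real_less_lsqrt)
      then show ?thesis using \<sigma>(1) Wc by (simp add: hdist_def)
    qed
    then show "\<exists>N. \<forall>n n'. N \<le> n \<longrightarrow> N \<le> n' \<longrightarrow> hdist V (\<sigma> n) (\<sigma> n') < \<epsilon>" by blast
  qed
  then obtain y where lim: "limitin metric.mtopology \<sigma> y sequentially"
    using complete unfolding metric.mcomplete_def by blast
  have yW: "y \<in> W"
    using cl lim \<sigma>(1) unfolding metric.metric_closedin_iff_sequentially_closed by blast
  have y: "y \<in> carrier V" using yW Wc by blast
  have "(\<lambda>n. hdist V (\<sigma> n) y) \<longlonglongrightarrow> 0"
    using lim unfolding metric.limitin_metric_dist_null by blast
  moreover have "(\<lambda>n. sqrt (d + inverse (real (Suc n)))) \<longlonglongrightarrow> sqrt (d + 0)"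
    by (intro tendsto_intros LIMSEQ_inverse_real_of_nat)
  ultimately have "(\<lambda>n. sqrt (d + inverse (real (Suc n))) + hdist V (\<sigma> n) y) \<longlonglongrightarrow> sqrt (d + 0) + 0"
    by (rule tendsto_add[rotated])
  moreover have "hdist V x y \<le> sqrt (d + inverse (real (Suc n))) + hdist V (\<sigma> n) y" for n
  proof -
    have "hdist V x y \<le> hdist V x (\<sigma> n) + hdist V (\<sigma> n) y"
      using x y \<sigma>(1) Wc by (intro metric.triangle) auto
    moreover have "hdist V x (\<sigma> n) \<le> sqrt (d + inverse (real (Suc n)))"
      using x \<sigma>(1) Wc less_imp_le[OF \<sigma>(2)[of n]] by (simp add: hdist_def q_def)
    ultimately show ?thesis by simp
  qed
  ultimately have "hdist V x y \<le> sqrt d" by (intro LIMSEQ_le_const) auto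
  then have qy: "q y \<le> d"
    using x y by (simp add: hdist_def q_def)
  have "hinner V (x \<ominus> y) z = 0" if zW: "z \<in> W" for z
  proof (cases "z = \<zero>")
    case False
    have z: "z \<in> carrier V" using Wc zW by blast
    define b where "b = hinner V (x \<ominus> y) z"
    define n where "n = Re (hinner V z z)"
    have n: "n > 0" using False z hinner_pos by (simp add: n_def)
    have zz: "hinner V z z = of_real n"
      using hinner_self_Im[OF z] by (simp add: n_def complex_eq_iff)
    \<comment> \<open>The optimal step along \<open>z\<close>. It lowers \<open>q\<close> by
      \<open>(cmod b)\<^sup>2 / n\<close>, which minimality of \<open>y\<close> forbids unless
      \<open>b = 0\<close>.\<close>
    define c where "c = b / of_real n"
    have xy: "x \<ominus> y \<in> carrier V" using x y by simp
    have "x \<ominus> (y \<oplus> c \<odot> z) = (x \<ominus> y) \<ominus> c \<odot> z"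
      using x y z by (simp add: a_minus_def minus_add a_assoc)
    then have "q (y \<oplus> c \<odot> z) = Re (hinner V ((x \<ominus> y) \<ominus> c \<odot> z) ((x \<ominus> y) \<ominus> c \<odot> z))"
      by (simp add: q_def)
    also have "hinner V ((x \<ominus> y) \<ominus> c \<odot> z) ((x \<ominus> y) \<ominus> c \<odot> z) =
        hinner V (x \<ominus> y) (x \<ominus> y) - cnj c * b - c * cnj b + c * cnj c * of_real n"
      using xy z hinner_commute[OF xy z]
      unfolding hinner_minus_left[OF xy smc[OF z] minus_closed[OF xy smc[OF z]]]
        hinner_minus_right[OF xy smc[OF z] xy] hinner_minus_right[OF xy smc[OF z] smc[OF z]]
      by (simp add: hinner_smult_left hinner_smult_right zz b_def[symmetric] algebra_simps)
    also have "\<dots> = hinner V (x \<ominus> y) (x \<ominus> y) - (b * cnj b) / of_real n"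
      using n by (simp add: c_def field_simps)
    also have "b * cnj b = of_real ((cmod b)\<^sup>2)" by (rule complex_norm_square[symmetric])
    finally have "q (y \<oplus> c \<odot> z) = q y - (cmod b)\<^sup>2 / n"
      by (simp add: q_def Re_divide_of_real)
    moreover have "y \<oplus> c \<odot> z \<in> W" using E(4) E(5) yW zW by simp
    ultimately have "(cmod b)\<^sup>2 / n \<le> 0" using d_le[of "y \<oplus> c \<odot> z"] qy by simp
    then have "b = 0" using n by (simp add: divide_le_0_iff)
    then show ?thesis by (simp add: b_def)
  qed (use x y in simp)
  with yW show thesis by (rule that)
qed

section \<open>Diagonal matrix coefficients of a representation\<close>

context unitary_representation
begin

definition diagonal_coefficient :: "'h \<Rightarrow> 'a \<Rightarrow> complex" where
  "diagonal_coefficient v =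
     (\<lambda>g. if g \<in> carrier G then hinner V (\<pi> g v) v / hinner V v v else 0)"

lemma rep_one: "x \<in> carrier V \<Longrightarrow> \<pi> \<one>\<^bsub>G\<^esub> x = x"
proof -
  assume x: "x \<in> carrier V"
  have "\<pi> \<one>\<^bsub>G\<^esub> (\<pi> \<one>\<^bsub>G\<^esub> x) = \<pi> \<one>\<^bsub>G\<^esub> x"
    using rep_mult[OF G.one_closed G.one_closed x] by simp
  then show "\<pi> \<one>\<^bsub>G\<^esub> x = x"
    using rep_bij[OF G.one_closed] x by (auto simp: bij_betw_def dest: inj_onD)
qed

lemma rep_adjoint:
  assumes g: "g \<in> carrier G" and x: "x \<in> carrier V" and y: "y \<in> carrier V"
  shows "hinner V (\<pi> g x) y = hinner V x (\<pi> (inv\<^bsub>G\<^esub> g) y)"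
proof -
  have "y = \<pi> g (\<pi> (inv\<^bsub>G\<^esub> g) y)"
    using rep_mult[of g "inv\<^bsub>G\<^esub> g" y] g y by (simp add: rep_one)
  then show ?thesis using rep_hinner[of g x "\<pi> (inv\<^bsub>G\<^esub> g) y"] g x y by simp
qed

text \<open>The translation kernel of the coefficient is a positive multiple of the Gram kernel of
  the orbit of \<open>v\<close>, so the form is a squared norm.\<close>

lemma diagonal_coefficient_in_states:
  assumes v: "v \<in> carrier V" "v \<noteq> \<zero>\<^bsub>V\<^esub>"
  shows "diagonal_coefficient v \<in> G.states"
proof -
  define n where "n = Re (hinner V v v)"
  have n: "n > 0" using v V.hinner_pos by (simp add: n_def)
  have vv: "hinner V v v = of_real n"
    using V.hinner_self_Im[OF v(1)] by (simp add: n_def complex_eq_iff)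
  define w where "w = (\<lambda>a. if a \<in> carrier G then \<pi> a v else \<zero>\<^bsub>V\<^esub>)"
  have w [simp]: "w a \<in> carrier V" for a using v by (simp add: w_def)
  \<comment> \<open>Realises a formal combination of group elements as a vector, by letting it act
    on \<open>v\<close>.\<close>
  define vec where "vec = (\<lambda>xs. foldr (\<lambda>p y. fst p \<odot>\<^bsub>V\<^esub> w (snd p) \<oplus>\<^bsub>V\<^esub> y) xs \<zero>\<^bsub>V\<^esub>)"
  have smc [simp]: "c \<odot>\<^bsub>V\<^esub> x \<in> carrier V" if "x \<in> carrier V" for c x
    using that V.smult_closed by simp
  have vec_closed [simp]: "vec xs \<in> carrier V" for xs
    by (induction xs) (simp_all add: vec_def)
  have vec_left: "hinner V (vec xs) y = (\<Sum>p\<leftarrow>xs. fst p * hinner V (w (snd p)) y)"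
    if "y \<in> carrier V" for xs y
  proof (induction xs)
    case (Cons p xs)
    have "vec (p # xs) = fst p \<odot>\<^bsub>V\<^esub> w (snd p) \<oplus>\<^bsub>V\<^esub> vec xs" by (simp add: vec_def)
    then show ?case using Cons that by (simp add: V.hinner_add_left V.hinner_smult_left)
  qed (use that in \<open>simp add: vec_def\<close>)
  have vec_right: "hinner V y (vec xs) = (\<Sum>p\<leftarrow>xs. cnj (fst p) * hinner V y (w (snd p)))"
    if "y \<in> carrier V" for xs y
  proof (induction xs)
    case (Cons p xs)
    have "vec (p # xs) = fst p \<odot>\<^bsub>V\<^esub> w (snd p) \<oplus>\<^bsub>V\<^esub> vec xs" by (simp add: vec_def)
    then show ?case using Cons that by (simp add: V.hinner_add_right V.hinner_smult_right)
  qed (use that in \<open>simp add: vec_def\<close>)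
  have K: "G.translation_kernel (diagonal_coefficient v) a b = of_real (1 / n) * hinner V (w a) (w b)"
    for a b
  proof (cases "a \<in> carrier G \<and> b \<in> carrier G")
    case True
    then have "hinner V (\<pi> (inv\<^bsub>G\<^esub> b \<otimes>\<^bsub>G\<^esub> a) v) v = hinner V (\<pi> a v) (\<pi> b v)"
      using v rep_adjoint[of "inv\<^bsub>G\<^esub> b" "\<pi> a v" v] by (simp add: rep_mult)
    then show ?thesis
      using True by (simp add: G.translation_kernel_def diagonal_coefficient_def w_def vv)
  qed (use v in \<open>auto simp: G.translation_kernel_def w_def\<close>)
  have "kernel_form (G.translation_kernel (diagonal_coefficient v)) xs xs =
      of_real (1 / n) * hinner V (vec xs) (vec xs)" for xs
  proof -
    have "kernel_form (\<lambda>a b. hinner V (w a) (w b)) xs xs = hinner V (vec xs) (vec xs)"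
      unfolding vec_left[OF vec_closed] vec_right[OF w] kernel_form_def
      by (simp add: sum_list_const_mult[symmetric] mult_ac)
    then show ?thesis unfolding K[abs_def] kernel_form_smult by simp
  qed
  then have "0 \<le> Re (kernel_form (G.translation_kernel (diagonal_coefficient v)) xs xs)" for xs
    using n V.hinner_self_ge0[of "vec xs"] by simp
  moreover have "diagonal_coefficient v (inv\<^bsub>G\<^esub> g) = cnj (diagonal_coefficient v g)"
    if g: "g \<in> carrier G" for g
    using g v V.hinner_commute[of "\<pi> g v" v] rep_adjoint[of g v v]
      V.hinner_commute[of "\<pi> (inv\<^bsub>G\<^esub> g) v" v]
    by (simp add: diagonal_coefficient_def vv)
  moreover have "diagonal_coefficient v \<one>\<^bsub>G\<^esub> = 1"
    using v n by (simp add: diagonal_coefficient_def rep_one vv)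
  ultimately show ?thesis
    by (simp add: G.states_def) (simp add: diagonal_coefficient_def)
qed

text \<open>A closed invariant \<open>W\<close> splits \<open>\<xi>\<close> orthogonally, and with
  it the coefficient of \<open>\<xi>\<close> into a convex combination. Extremality equates the
  coefficients of \<open>\<xi>\<close> and of its component \<open>\<eta>\<close> in
  \<open>W\<close>; then \<open>\<eta> - t \<xi>\<close> is orthogonal to the orbit of
  \<open>\<xi>\<close> and vanishes, so \<open>\<xi>\<close> lies in \<open>W\<close>. The
  hypothesis \<open>cyclic\<close> expresses density of the span of the orbit by
  orthogonality.\<close>

theorem irreducible_if_extreme:
  assumes \<xi>: "\<xi> \<in> carrier V" "hinner V \<xi> \<xi> = 1"
    and cyclic: "\<And>f. \<lbrakk>f \<in> carrier V; \<And>g. g \<in> carrier G \<Longrightarrow> hinner V f (\<pi> g \<xi>) = 0\<rbrakk> \<Longrightarrow> f = \<zero>\<^bsub>V\<^esub>"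
    and extreme: "G.extreme_state (diagonal_coefficient \<xi>)"
  shows "irreducible_unitary_representation G V \<pi>"
proof unfold_locales
  show "carrier V \<noteq> {\<zero>\<^bsub>V\<^esub>}"
    using \<xi> by (metis V.hinner_zero_left singletonD zero_neq_one)
next
  fix W assume W: "closed_subspace W V" and inv: "\<And>g. g \<in> carrier G \<Longrightarrow> \<pi> g ` W \<subseteq> W"
  have sub: "submodule W complex_field V" using W by (simp add: closed_subspace_def)
  note E = V.submoduleE[OF sub]
  have Wc: "z \<in> carrier V" if "z \<in> W" for z using E(1) that by blast
  have smc [simp]: "c \<odot>\<^bsub>V\<^esub> x \<in> carrier V" if "x \<in> carrier V" for c x
    using that V.smult_closed by simp
  have zW: "\<zero>\<^bsub>V\<^esub> \<in> W"
    using subgroup.one_closed[OF submodule.axioms(1)[OF sub]] by simp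
  have full: "W = carrier V" if \<xi>W: "\<xi> \<in> W"
  proof -
    have "f \<in> W" if f: "f \<in> carrier V" for f
    proof -
      obtain y where y: "y \<in> W" "\<And>z. z \<in> W \<Longrightarrow> hinner V (f \<ominus>\<^bsub>V\<^esub> y) z = 0"
        using V.projection_exists[OF W f] by blast
      have "f \<ominus>\<^bsub>V\<^esub> y = \<zero>\<^bsub>V\<^esub>"
      proof (rule cyclic)
        fix g assume "g \<in> carrier G"
        then have "\<pi> g \<xi> \<in> W" using inv \<xi>W by blast
        then show "hinner V (f \<ominus>\<^bsub>V\<^esub> y) (\<pi> g \<xi>) = 0" by (rule y)
      qed (use f y Wc in simp)
      then show ?thesis using V.minus_zero_imp_eq[of f y] f y Wc by simp
    qed
    then show ?thesis using Wc by blast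
  qed
  obtain \<eta> where \<eta>: "\<eta> \<in> W" and orth: "\<And>z. z \<in> W \<Longrightarrow> hinner V (\<xi> \<ominus>\<^bsub>V\<^esub> \<eta>) z = 0"
    using V.projection_exists[OF W \<xi>(1)] by blast
  define \<zeta> where "\<zeta> = \<xi> \<ominus>\<^bsub>V\<^esub> \<eta>"
  have \<eta>c [simp]: "\<eta> \<in> carrier V" and \<zeta>c [simp]: "\<zeta> \<in> carrier V" using \<eta> Wc \<xi> by (auto simp: \<zeta>_def)
  note [simp] = \<xi>(1)
  have \<xi>_eq: "\<xi> = \<eta> \<oplus>\<^bsub>V\<^esub> \<zeta>"
    by (simp add: \<zeta>_def a_minus_def V.a_comm[of \<eta>] V.a_assoc V.l_neg)
  have orth1: "hinner V z \<zeta> = 0" if "z \<in> W" for z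
    using V.hinner_commute[of \<zeta> z] orth[OF that] Wc[OF that] by (simp add: \<zeta>_def[symmetric])
  have orth2: "hinner V (\<pi> g \<zeta>) z = 0" if "z \<in> W" "g \<in> carrier G" for g z
  proof -
    have "\<pi> (inv\<^bsub>G\<^esub> g) z \<in> W" using inv[of "inv\<^bsub>G\<^esub> g"] that by auto
    then show ?thesis
      using that Wc rep_adjoint[of g \<zeta> z] orth by (simp add: \<zeta>_def[symmetric])
  qed
  show "W = {\<zero>\<^bsub>V\<^esub>} \<or> W = carrier V"
  proof (cases "\<eta> = \<zero>\<^bsub>V\<^esub> \<or> \<zeta> = \<zero>\<^bsub>V\<^esub>")
    case True
    then show ?thesis
    proof
      assume "\<zeta> = \<zero>\<^bsub>V\<^esub>"
      then have "\<xi> \<in> W" using \<xi>_eq \<eta> by simp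
      then show ?thesis using full by simp
    next
      assume "\<eta> = \<zero>\<^bsub>V\<^esub>"
      then have \<xi>\<zeta>: "\<xi> = \<zeta>" using \<xi>_eq by simp
      have "f = \<zero>\<^bsub>V\<^esub>" if f: "f \<in> W" for f
      proof (rule cyclic)
        fix g assume g: "g \<in> carrier G"
        show "hinner V f (\<pi> g \<xi>) = 0"
          using orth2[OF f g] V.hinner_commute[of "\<pi> g \<zeta>" f] g Wc[OF f] by (simp add: \<xi>\<zeta>)
      qed (use f Wc in auto)
      then show ?thesis using zW by blast
    qed
  next
    case False
    \<comment> \<open>The squared norm of the component in \<open>W\<close>: the normalised
      coefficients of the two components combine with weights \<open>t\<close> and
      \<open>1 - t\<close>.\<close>
    define t where "t = Re (hinner V \<eta> \<eta>)"
    have tt: "hinner V \<eta> \<eta> = of_real t"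
      using V.hinner_self_Im[OF \<eta>c] by (simp add: t_def complex_eq_iff)
    have t: "t > 0" using False V.hinner_pos by (simp add: t_def)
    have cross: "hinner V \<zeta> \<eta> = 0" "hinner V \<eta> \<zeta> = 0"
      using orth[OF \<eta>] orth1[OF \<eta>] by (simp_all add: \<zeta>_def)
    have "hinner V \<xi> \<xi> = hinner V \<eta> \<eta> + hinner V \<zeta> \<zeta>"
      unfolding \<xi>_eq by (simp add: V.hinner_add_left V.hinner_add_right cross)
    then have ss: "hinner V \<zeta> \<zeta> = of_real (1 - t)" using \<xi> tt by (simp add: algebra_simps)
    have "0 < Re (hinner V \<zeta> \<zeta>)" using False V.hinner_pos by simp
    then have t1: "t < 1" by (simp add: ss)
    have split: "hinner V (\<pi> g \<xi>) \<xi> = hinner V (\<pi> g \<eta>) \<eta> + hinner V (\<pi> g \<zeta>) \<zeta>"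
      if g: "g \<in> carrier G" for g
    proof -
      have "\<pi> g \<eta> \<in> W" using inv[OF g] \<eta> by blast
      then show ?thesis
        unfolding \<xi>_eq using g orth1[of "\<pi> g \<eta>"] orth2[OF \<eta> g]
        by (simp add: rep_add V.hinner_add_left V.hinner_add_right)
    qed
    have "diagonal_coefficient \<xi> g =
        of_real t * diagonal_coefficient \<eta> g + of_real (1 - t) * diagonal_coefficient \<zeta> g" for g
      using t t1 split[of g] \<xi>(2) tt ss
      by (simp add: diagonal_coefficient_def del: of_real_diff)
    moreover have "diagonal_coefficient \<eta> \<in> G.states" "diagonal_coefficient \<zeta> \<in> G.states"
      using False by (simp_all add: diagonal_coefficient_in_states)
    ultimately have eq: "diagonal_coefficient \<eta> = diagonal_coefficient \<xi>"
      using t t1 by (intro G.extreme_stateD[OF extreme])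
    have coeff: "hinner V (\<pi> g \<eta>) \<eta> = of_real t * hinner V (\<pi> g \<xi>) \<xi>" if "g \<in> carrier G" for g
    proof -
      have "diagonal_coefficient \<eta> g = diagonal_coefficient \<xi> g" by (simp only: eq)
      then show ?thesis using that t \<xi>(2) tt by (simp add: diagonal_coefficient_def field_simps)
    qed
    have "\<eta> \<ominus>\<^bsub>V\<^esub> of_real t \<odot>\<^bsub>V\<^esub> \<xi> = \<zero>\<^bsub>V\<^esub>"
    proof (rule cyclic)
      fix g assume g: "g \<in> carrier G"
      then have ig: "inv\<^bsub>G\<^esub> g \<in> carrier G" by simp
      have adj: "hinner V x (\<pi> g \<xi>) = hinner V (\<pi> (inv\<^bsub>G\<^esub> g) x) \<xi>" if "x \<in> carrier V" for x
        using rep_adjoint[OF ig that, of \<xi>] g by simp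
      \<comment> \<open>On \<open>W\<close>, pairing with \<open>\<xi>\<close> and with
        \<open>\<eta>\<close> agree, since their difference \<open>\<zeta>\<close> is orthogonal to
        \<open>W\<close>.\<close>
      have "\<pi> (inv\<^bsub>G\<^esub> g) \<eta> \<in> W" using inv[OF ig] \<eta> by blast
      then have "hinner V (\<pi> (inv\<^bsub>G\<^esub> g) \<eta>) \<xi> = hinner V (\<pi> (inv\<^bsub>G\<^esub> g) \<eta>) \<eta>"
        using orth1[of "\<pi> (inv\<^bsub>G\<^esub> g) \<eta>"] ig unfolding \<xi>_eq by (simp add: V.hinner_add_right)
      then have "hinner V \<eta> (\<pi> g \<xi>) = of_real t * hinner V \<xi> (\<pi> g \<xi>)"
        unfolding adj[OF \<eta>c] adj[OF \<xi>(1)] coeff[OF ig] .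
      then show "hinner V (\<eta> \<ominus>\<^bsub>V\<^esub> of_real t \<odot>\<^bsub>V\<^esub> \<xi>) (\<pi> g \<xi>) = 0"
        using g by (simp add: V.hinner_minus_left V.hinner_smult_left)
    qed simp
    then have "\<eta> = of_real t \<odot>\<^bsub>V\<^esub> \<xi>" by (rule V.minus_zero_imp_eq) simp_all
    then have "of_real (1 / t) \<odot>\<^bsub>V\<^esub> \<eta> = \<xi>"
      using t V.smult_assoc1[of "of_real (1 / t)" "of_real t" \<xi>] V.smult_one[of \<xi>] by simp
    moreover have "of_real (1 / t) \<odot>\<^bsub>V\<^esub> \<eta> \<in> W" using E(4)[of "of_real (1 / t)" \<eta>] \<eta> by simp
    ultimately show ?thesis using full by simp
  qed
qed

end

section \<open>The GNS representation\<close>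

locale group_state = group G for G :: "('a, 'b) monoid_scheme" (structure) +
  fixes \<phi> :: "'a \<Rightarrow> complex"
  assumes state: "\<phi> \<in> states"

sublocale group_state \<subseteq> semi_inner_space "kernel_form (translation_kernel \<phi>)" "(@)"
  "\<lambda>c. map (apfst ((*) c))"
proof
  show "kernel_form (translation_kernel \<phi>) v u = cnj (kernel_form (translation_kernel \<phi>) u v)" for u v
    by (rule kernel_form_commute[OF translation_kernel_commute]) (rule state_inv[OF state])
qed (rule kernel_form_append_left kernel_form_scale_left state_form_ge0[OF state])+

context group_state
begin

abbreviation form where "form \<equiv> kernel_form (translation_kernel \<phi>)"

definition translate :: "'a \<Rightarrow> (complex \<times> 'a) list \<Rightarrow> (complex \<times> 'a) list" where
  "translate g = map (apsnd (left_translation g))"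

text \<open>A vector \<open>u\<close> is represented by the functional \<open>form u\<close>, and
  moving \<open>u\<close> by \<open>g\<close> moves the argument by \<open>inv g\<close>. The
  restriction to \<open>completion\<close> makes the operator extensional, as \<open>Bij\<close>
  demands.\<close>

definition gns_rep :: "'a \<Rightarrow> ((complex \<times> 'a) list \<Rightarrow> complex) \<Rightarrow> (complex \<times> 'a) list \<Rightarrow> complex" where
  "gns_rep g = (\<lambda>f\<in>completion. \<lambda>w. f (translate (inv g) w))"

lemma translate_mult:
  "\<lbrakk>g \<in> carrier G; h \<in> carrier G\<rbrakk> \<Longrightarrow> translate g (translate h w) = translate (g \<otimes> h) w"
  by (simp add: translate_def left_translation_mult apsnd_compose o_def)

lemma translate_one [simp]: "translate \<one> w = w"
  by (simp add: translate_def apsnd_def map_prod_def)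

lemma form_translate: "g \<in> carrier G \<Longrightarrow> form (translate g u) (translate g v) = form u v"
  by (simp add: translate_def kernel_form_map_snd translation_kernel_invariant)

lemma form_translate_left:
  assumes "g \<in> carrier G"
  shows "form (translate g u) w = form u (translate (inv g) w)"
  using form_translate[OF assms, of u "translate (inv g) w"] assms by (simp add: translate_mult)

lemma seminorm_translate [simp]: "g \<in> carrier G \<Longrightarrow> seminorm (translate g u) = seminorm u"
  by (simp add: seminorm_def form_translate)

lemma converges_to_translate:
  assumes "g \<in> carrier G" "converges_to u f"
  shows "converges_to (\<lambda>n. translate g (u n)) (\<lambda>w. f (translate (inv g) w))"
  unfolding converges_to_def
proof (intro allI impI)
  fix \<epsilon> :: real assume "\<epsilon> > 0"
  then have "\<forall>\<^sub>F n in sequentially. \<forall>w. cmod (f w - form (u n) w) \<le> \<epsilon> * seminorm w"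
    using assms(2) unfolding converges_to_def by blast
  then show "\<forall>\<^sub>F n in sequentially. \<forall>w.
      cmod (f (translate (inv g) w) - form (translate g (u n)) w) \<le> \<epsilon> * seminorm w"
  proof eventually_elim
    case (elim n)
    show ?case
    proof
      fix w
      show "cmod (f (translate (inv g) w) - form (translate g (u n)) w) \<le> \<epsilon> * seminorm w"
        using elim[rule_format, of "translate (inv g) w"] assms(1) by (simp add: form_translate_left)
    qed
  qed
qed

lemma completion_translate:
  "\<lbrakk>g \<in> carrier G; f \<in> completion\<rbrakk> \<Longrightarrow> (\<lambda>w. f (translate (inv g) w)) \<in> completion"
  unfolding completion_def using converges_to_translate by blast

lemma cinner_translate:
  assumes "g \<in> carrier G" "f \<in> completion" "h \<in> completion"
  shows "cinner (\<lambda>w. f (translate (inv g) w)) (\<lambda>w. h (translate (inv g) w)) = cinner f h"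
proof -
  obtain u v where uv: "converges_to u f" "converges_to v h" using assms completion_ex by blast
  have "(\<lambda>n. form (translate g (u n)) (translate g (v n))) \<longlonglongrightarrow>
      cinner (\<lambda>w. f (translate (inv g) w)) (\<lambda>w. h (translate (inv g) w))"
    by (intro cinner_limit2 converges_to_translate uv assms)
  then show ?thesis
    unfolding form_translate[OF assms(1)] using cinner_limit2[OF uv] LIMSEQ_unique by blast
qed

lemma gns_rep_closed: "\<lbrakk>g \<in> carrier G; f \<in> completion\<rbrakk> \<Longrightarrow> gns_rep g f \<in> completion"
  by (simp add: gns_rep_def completion_translate)

lemma gns_rep_mult:
  "\<lbrakk>g \<in> carrier G; h \<in> carrier G; f \<in> completion\<rbrakk> \<Longrightarrow>
    gns_rep (g \<otimes> h) f = gns_rep g (gns_rep h f)"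
  by (simp add: gns_rep_def completion_translate translate_mult inv_mult_group)

lemma gns_rep_one: "f \<in> completion \<Longrightarrow> gns_rep \<one> f = f"
  by (simp add: gns_rep_def)

lemma gns_rep_unitary:
  assumes g: "g \<in> carrier G"
  shows "gns_rep g \<in> unitary_operators hilbert_completion"
proof -
  have "bij_betw (gns_rep g) completion completion"
    by (rule bij_betw_byWitness[where f' = "gns_rep (inv g)"])
      (use g in \<open>auto simp: gns_rep_closed gns_rep_one simp flip: gns_rep_mult\<close>)
  then show ?thesis
    using g completion_add completion_smult
    by (auto simp: unitary_operators_def Bij_def gns_rep_def cinner_translate)
qed

sublocale gns: unitary_representation G hilbert_completion gns_rep
proof -
  interpret V: complex_hilbert_space hilbert_completion
    by (rule complex_hilbert_space_completion)
  have "gns_rep (g \<otimes> h) = compose completion (gns_rep g) (gns_rep h)"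
    if "g \<in> carrier G" "h \<in> carrier G" for g h
    using that by (auto simp: fun_eq_iff compose_def gns_rep_mult) (simp_all add: gns_rep_def)
  then have "gns_rep \<in> hom G (unitary_group hilbert_completion)"
    by (auto simp: hom_def gns_rep_unitary unitary_group_mult)
  then show "unitary_representation G hilbert_completion gns_rep"
    by unfold_locales
qed

definition cyclic_vector :: "(complex \<times> 'a) list \<Rightarrow> complex" where
  "cyclic_vector = form [(1, \<one>)]"

lemma cyclic_vector_closed [simp]: "cyclic_vector \<in> completion"
  by (simp add: cyclic_vector_def)

lemma gns_rep_cyclic_vector:
  assumes "g \<in> carrier G"
  shows "gns_rep g cyclic_vector = form [(1, g)]"
proof -
  have "translate g [(1, \<one>)] = [(1, g)]" using assms by (simp add: translate_def left_translation_def)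
  then have "form [(1, \<one>)] (translate (inv g) w) = form [(1, g)] w" for w
    using form_translate_left[OF assms, of "[(1, \<one>)]" w] by simp
  then show ?thesis by (simp add: gns_rep_def cyclic_vector_def)
qed

lemma diagonal_coefficient_cyclic_vector: "gns.diagonal_coefficient cyclic_vector = \<phi>"
proof
  fix g
  have "cinner (gns_rep g cyclic_vector) cyclic_vector = \<phi> g" if "g \<in> carrier G" for g
    using that
    by (subst gns_rep_cyclic_vector[OF that], subst cyclic_vector_def, subst cinner_s_right)
      (simp_all add: kernel_form_def translation_kernel_def)
  from this[of g] this[of \<one>] show "gns.diagonal_coefficient cyclic_vector g = \<phi> g"
    using state_outside[OF state] state_one[OF state]
    by (simp add: gns.diagonal_coefficient_def gns_rep_one)
qed

text \<open>Pairing with the translate of the cyclic vector by \<open>g\<close> is evaluation at the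
  point \<open>g\<close>, and points outside the carrier are null. A functional that vanishes at all
  points vanishes at every formal combination.\<close>

lemma cyclic:
  assumes f: "f \<in> completion" and orth: "\<And>g. g \<in> carrier G \<Longrightarrow> cinner f (gns_rep g cyclic_vector) = 0"
  shows "f = (\<lambda>_. 0)"
proof
  fix w
  have f1: "f [(1, a)] = 0" for a
  proof (cases "a \<in> carrier G")
    case True
    then show ?thesis using orth[OF True] f by (simp add: gns_rep_cyclic_vector cinner_s_right)
  next
    case False
    then have "seminorm [(1, a)] = 0"
      by (simp add: seminorm_def kernel_form_def translation_kernel_def)
    then show ?thesis using completion_apply_le[OF f, of "[(1, a)]"] by simp
  qed
  show "f w = 0"
  proof (induction w)
    case Nil
    show ?case using completion_sc[OF f, of 0 "[]"] by simp
  next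
    case (Cons p w)
    have "p # w = map (apfst ((*) (fst p))) [(1, snd p)] @ w" by simp
    then have "f (p # w) = cnj (fst p) * f [(1, snd p)] + f w"
      using completion_ad[OF f] completion_sc[OF f] by metis
    then show ?case using Cons f1 by simp
  qed
qed

theorem gns_irreducible:
  assumes "extreme_state \<phi>"
  shows "irreducible_unitary_representation G hilbert_completion gns_rep"
proof (rule gns.irreducible_if_extreme[of cyclic_vector])
  show "hinner hilbert_completion cyclic_vector cyclic_vector = 1"
    using state_one[OF state] unfolding hilbert_completion_simps cyclic_vector_def
    by (subst cinner_s_right) (simp_all add: kernel_form_def translation_kernel_def)
qed (use assms cyclic in \<open>simp_all add: diagonal_coefficient_cyclic_vector\<close>)

end

section \<open>From characters to irreducibly faithful sets\<close>

lemma (in unitary_representation) rep_eq_one_iff: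
  assumes "g \<in> carrier G"
  shows "\<pi> g = \<one>\<^bsub>unitary_group V\<^esub> \<longleftrightarrow> (\<forall>v\<in>carrier V. \<pi> g v = v)"
  using rep_extensional[OF assms] by (auto simp: fun_eq_iff extensional_def)

lemma (in unitary_representation) kernel_normal:
  "{g \<in> carrier G. \<forall>v\<in>carrier V. \<pi> g v = v} \<lhd> G"
  unfolding G.normal_inv_iff
proof (intro conjI ballI)
  have inv_fix: "\<pi> (inv\<^bsub>G\<^esub> a) v = v" if "a \<in> carrier G" "v \<in> carrier V" "\<pi> a v = v" for a v
    using rep_mult[of "inv\<^bsub>G\<^esub> a" a v] that by (simp add: rep_one)
  show "subgroup {g \<in> carrier G. \<forall>v\<in>carrier V. \<pi> g v = v} G"
    by (rule G.subgroupI) (use rep_one in \<open>auto simp: rep_mult inv_fix intro!: exI[of _ "\<one>\<^bsub>G\<^esub>"]\<close>)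
  show "x \<otimes>\<^bsub>G\<^esub> h \<otimes>\<^bsub>G\<^esub> inv\<^bsub>G\<^esub> x \<in> {g \<in> carrier G. \<forall>v\<in>carrier V. \<pi> g v = v}"
    if x: "x \<in> carrier G" and h: "h \<in> {g \<in> carrier G. \<forall>v\<in>carrier V. \<pi> g v = v}" for x h
  proof -
    have "\<pi> (x \<otimes>\<^bsub>G\<^esub> h \<otimes>\<^bsub>G\<^esub> inv\<^bsub>G\<^esub> x) v = v" if v: "v \<in> carrier V" for v
      using rep_mult[of x "inv\<^bsub>G\<^esub> x" v] x h v by (simp add: rep_mult rep_one)
    then show ?thesis using x h by simp
  qed
qed

text \<open>The condition on \<open>N\<close> is applied to the kernel of the GNS representation of
  an extreme state that extends \<open>\<theta>\<close>: on this kernel the state is constantly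
  1.\<close>

theorem (in group) irreducibly_faithful_if_character:
  assumes "countable (carrier G)" and \<theta>: "unitary_character H \<theta>" and F: "F \<subseteq> carrier G"
    and nontrivial: "\<And>x N. \<lbrakk>x \<in> F; x \<noteq> \<one>; N \<lhd> G; x \<in> N\<rbrakk> \<Longrightarrow> \<exists>y\<in>N \<inter> H. \<theta> y \<noteq> 1"
  shows "irreducibly_faithful G F"
proof -
  obtain \<phi> where \<phi>: "extreme_state \<phi>" and ext: "\<And>h. h \<in> H \<Longrightarrow> \<phi> h = \<theta> h"
    using extreme_state_extends_character[OF assms(1) \<theta>] by blast
  interpret group_state G \<phi>
    by unfold_locales (use \<phi> in \<open>simp add: extreme_state_def\<close>)
  interpret irr: irreducible_unitary_representation G hilbert_completion gns_rep
    by (rule gns_irreducible[OF \<phi>])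
  show ?thesis
  proof (rule irr.irreducibly_faithful_any_type[OF F])
    fix x assume x: "x \<in> F" "x \<noteq> \<one>"
    show "gns_rep x \<noteq> \<one>\<^bsub>unitary_group hilbert_completion\<^esub>"
    proof
      assume "gns_rep x = \<one>\<^bsub>unitary_group hilbert_completion\<^esub>"
      then have "x \<in> {g \<in> carrier G. \<forall>v\<in>carrier hilbert_completion. gns_rep g v = v}"
        using gns.rep_eq_one_iff[of x] x F by blast
      from nontrivial[OF x gns.kernel_normal this]
      obtain y where y: "y \<in> H" "\<theta> y \<noteq> 1" "y \<in> carrier G" "gns_rep y cyclic_vector = cyclic_vector"
        by auto
      \<comment> \<open>The coefficient is a quotient by this number, so it must be nonzero before a
        fixed vector yields the value 1.\<close>
      have "cinner cyclic_vector cyclic_vector \<noteq> 0"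
        using \<phi> fun_cong[OF diagonal_coefficient_cyclic_vector, of \<one>] state_one[OF state]
        by (auto simp: gns.diagonal_coefficient_def)
      then have "\<phi> y = 1"
        using fun_cong[OF diagonal_coefficient_cyclic_vector, of y] y
        by (simp add: gns.diagonal_coefficient_def)
      then show False using ext y by simp
    qed
  qed
qed

section \<open>Characters and normal subgroups\<close>

context group
begin

lemma unitary_character_product:
  "\<lbrakk>unitary_character H \<theta>; unitary_character H \<eta>\<rbrakk> \<Longrightarrow> unitary_character H (\<lambda>g. \<theta> g * \<eta> g)"
  by (auto simp: unitary_character_def norm_mult)

lemma unitary_character_cnj:
  "unitary_character H \<theta> \<Longrightarrow> unitary_character H (\<lambda>g. cnj (\<theta> g))"
  by (simp add: unitary_character_def)

text \<open>A set of pairwise commuting elements lies in an abelian subgroup, the centre of its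
  centralizer.\<close>

lemma characters_of_commuting_set_separate:
  assumes count: "countable (carrier G)" and S: "S \<subseteq> carrier G"
    and commute: "\<And>s t. \<lbrakk>s \<in> S; t \<in> S\<rbrakk> \<Longrightarrow> s \<otimes> t = t \<otimes> s"
  obtains H where "subgroup H G" "S \<subseteq> H"
    "\<And>w. \<lbrakk>w \<in> H; w \<noteq> \<one>\<rbrakk> \<Longrightarrow> \<exists>\<theta>. unitary_character H \<theta> \<and> \<theta> w \<noteq> 1"
proof -
  have inv_commute: "inv a \<otimes> b = b \<otimes> inv a"
    if "a \<in> carrier G" "b \<in> carrier G" "a \<otimes> b = b \<otimes> a" for a b
  proof -
    have "inv a \<otimes> b = inv a \<otimes> (b \<otimes> a) \<otimes> inv a" using that(1,2) by (simp add: m_assoc)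
    also have "\<dots> = inv a \<otimes> (a \<otimes> b) \<otimes> inv a" by (simp only: that(3))
    also have "\<dots> = b \<otimes> inv a" using that(1,2) by (simp add: m_assoc[symmetric])
    finally show ?thesis .
  qed
  have mult_commute: "(a \<otimes> b) \<otimes> c = c \<otimes> (a \<otimes> b)"
    if "a \<in> carrier G" "b \<in> carrier G" "c \<in> carrier G" "a \<otimes> c = c \<otimes> a" "b \<otimes> c = c \<otimes> b" for a b c
  proof -
    have "(a \<otimes> b) \<otimes> c = a \<otimes> (b \<otimes> c)" using that(1-3) by (simp add: m_assoc)
    also have "\<dots> = (a \<otimes> c) \<otimes> b" using that(1-3) by (simp only: that(5)) (simp add: m_assoc)
    also have "\<dots> = (c \<otimes> a) \<otimes> b" by (simp only: that(4))
    also have "\<dots> = c \<otimes> (a \<otimes> b)" using that(1-3) by (simp add: m_assoc)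
    finally show ?thesis .
  qed
  define C where "C = {g \<in> carrier G. \<forall>s\<in>S. g \<otimes> s = s \<otimes> g}"
  define H where "H = {h \<in> C. \<forall>g\<in>C. h \<otimes> g = g \<otimes> h}"
  have Cc: "g \<in> carrier G" if "g \<in> C" for g using that by (simp add: C_def)
  have Hc: "g \<in> carrier G" if "g \<in> H" for g using that Cc by (simp add: H_def)
  have C_mult: "a \<otimes> b \<in> C" if "a \<in> C" "b \<in> C" for a b
    unfolding C_def by (intro CollectI conjI ballI mult_commute) (use that S in \<open>auto simp: C_def\<close>)
  have C_inv: "inv a \<in> C" if "a \<in> C" for a
    unfolding C_def by (intro CollectI conjI ballI inv_commute) (use that S in \<open>auto simp: C_def\<close>)
  have H: "subgroup H G"
  proof (rule subgroupI)
    have "\<one> \<in> C" using S by (simp add: C_def subset_iff)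
    then have "\<one> \<in> H" using Cc by (simp add: H_def)
    then show "H \<noteq> {}" by blast
    show "inv a \<in> H" if "a \<in> H" for a
      unfolding H_def by (intro CollectI conjI ballI inv_commute C_inv) (use that Cc in \<open>auto simp: H_def\<close>)
    show "a \<otimes> b \<in> H" if "a \<in> H" "b \<in> H" for a b
      unfolding H_def by (intro CollectI conjI ballI mult_commute C_mult) (use that Cc in \<open>auto simp: H_def\<close>)
  qed (use Hc in blast)
  have "S \<subseteq> H"
  proof
    fix s assume s: "s \<in> S"
    then have "s \<in> C" unfolding C_def using S by (intro CollectI conjI ballI commute) auto
    moreover have "s \<otimes> g = g \<otimes> s" if "g \<in> C" for g using that s by (simp add: C_def)
    ultimately show "s \<in> H" unfolding H_def by blast
  qed
  have H_commute: "a \<otimes> b = b \<otimes> a" if "a \<in> H" "b \<in> H" for a b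
    using that unfolding H_def by blast
  interpret H: group "G\<lparr>carrier := H\<rparr>" by (rule subgroup_imp_group[OF H])
  interpret H: comm_group "G\<lparr>carrier := H\<rparr>"
    by (rule H.group_comm_groupI) (simp, rule H_commute, simp_all)
  have "\<exists>\<theta>. unitary_character H \<theta> \<and> \<theta> w \<noteq> 1" if w: "w \<in> H" "w \<noteq> \<one>" for w
  proof -
    have "countable H" using count Hc by (meson countable_subset subsetI)
    then obtain \<theta> where "H.unitary_character H \<theta>" "\<theta> w \<noteq> 1"
      using H.characters_separate_points[of w] w by auto
    then show ?thesis using H by (auto simp: H.unitary_character_def unitary_character_def)
  qed
  with H \<open>S \<subseteq> H\<close> show thesis by (rule that)
qed

section \<open>Characters nontrivial at two or three elements\<close>

context
  fixes H
  assumes H: "subgroup H G"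
    and separate: "\<And>w. \<lbrakk>w \<in> H; w \<noteq> \<one>\<rbrakk> \<Longrightarrow> \<exists>\<theta>. unitary_character H \<theta> \<and> \<theta> w \<noteq> 1"
begin

text \<open>A group is never the union of two proper subgroups: if each of two characters fails at
  the element of the other, their product fails at neither.\<close>

lemma character_nontrivial_at_two:
  assumes "x \<in> H" "y \<in> H" "x \<noteq> \<one>" "y \<noteq> \<one>"
  obtains \<theta> where "unitary_character H \<theta>" "\<theta> x \<noteq> 1" "\<theta> y \<noteq> 1"
proof -
  obtain \<theta> \<eta> where \<theta>: "unitary_character H \<theta>" "\<theta> x \<noteq> 1" and \<eta>: "unitary_character H \<eta>" "\<eta> y \<noteq> 1"
    using separate assms by blast
  show thesis
  proof (cases "\<theta> y = 1 \<and> \<eta> x = 1")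
    case True
    then show thesis using that[OF unitary_character_product[OF \<theta>(1) \<eta>(1)]] \<theta> \<eta> by simp
  qed (use that \<theta> \<eta> in blast)
qed

text \<open>The annihilators of \<open>x\<close>, \<open>y\<close>, \<open>z\<close> cover the
  character group, though no two of them do; \<open>\<alpha>\<close>, \<open>\<beta>\<close>,
  \<open>\<gamma>\<close> each lie in exactly one. As for any cover by three proper subgroups, the
  annihilators have index 2, so characters are \<open>1\<close> or \<open>- 1\<close> at
  \<open>x\<close>, and separation of points gives the square.\<close>

lemma square_if_no_character_nontrivial_at_three:
  assumes xyz: "x \<in> H" "y \<in> H" "z \<in> H" "x \<noteq> \<one>" "y \<noteq> \<one>" "z \<noteq> \<one>"
    and bad: "\<And>\<theta>. unitary_character H \<theta> \<Longrightarrow> \<theta> x = 1 \<or> \<theta> y = 1 \<or> \<theta> z = 1"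
  shows "x \<otimes> x = \<one>"
    and "\<And>\<theta>. unitary_character H \<theta> \<Longrightarrow> \<theta> x \<noteq> 1 \<Longrightarrow> \<theta> x = - 1 \<and> (\<theta> y = 1 \<longleftrightarrow> \<theta> z \<noteq> 1)"
proof -
  obtain \<alpha> where \<alpha>: "unitary_character H \<alpha>" "\<alpha> y \<noteq> 1" "\<alpha> z \<noteq> 1"
    by (rule character_nontrivial_at_two[of y z]) (use xyz in auto)
  obtain \<beta> where \<beta>: "unitary_character H \<beta>" "\<beta> x \<noteq> 1" "\<beta> z \<noteq> 1"
    by (rule character_nontrivial_at_two[of x z]) (use xyz in auto)
  obtain \<gamma> where \<gamma>: "unitary_character H \<gamma>" "\<gamma> x \<noteq> 1" "\<gamma> y \<noteq> 1"
    by (rule character_nontrivial_at_two[of x y]) (use xyz in auto)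
  have one: "\<alpha> x = 1" "\<beta> y = 1" "\<gamma> z = 1" using bad \<alpha> \<beta> \<gamma> by blast+
  have unimodular: "cmod (\<theta> a) = 1" if "unitary_character H \<theta>" "a \<in> H" for \<theta> a
    using that by (simp add: unitary_character_def)
  \<comment> \<open>Here \<open>u\<close> is \<open>\<theta> x\<close> and \<open>v\<close> the
    value at \<open>x\<close> of an auxiliary character. As the conjugate of that character is an
    equally good multiplier, \<open>v\<close> is its own inverse.\<close>
  have eq1: "u = - 1" if v: "cmod v = 1" and uv: "u * v = 1" "u * cnj v = 1" and u: "u \<noteq> 1" for u v :: complex
  proof -
    have "cnj v * v = 1" using v by (simp add: complex_norm_square[symmetric] mult.commute[of "cnj v"])
    then have "u = (u * cnj v) * v" by (simp add: mult.assoc)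
    then have "u = v" using uv by simp
    then have "u * u = 1" using uv by simp
    then show ?thesis using u by (simp add: square_eq_1_iff)
  qed
  show main: "\<theta> x = - 1 \<and> (\<theta> y = 1 \<longleftrightarrow> \<theta> z \<noteq> 1)" if \<theta>: "unitary_character H \<theta>" "\<theta> x \<noteq> 1" for \<theta>
  proof -
    \<comment> \<open>Otherwise the product with \<open>\<alpha>\<close>, which is trivial at
      \<open>x\<close> only, would be nontrivial at all three elements.\<close>
    have "\<not> (\<theta> y = 1 \<and> \<theta> z = 1)"
      using bad[OF unitary_character_product[OF \<theta>(1) \<alpha>(1)]] \<alpha> \<theta> one by auto
    \<comment> \<open>Among the three elements \<open>\<gamma>\<close> is trivial exactly at
      \<open>z\<close>, so both products are nontrivial at \<open>y\<close> and \<open>z\<close> and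
      must be trivial at \<open>x\<close>.\<close>
    moreover have "\<theta> x = - 1" if "\<theta> y = 1" "\<theta> z \<noteq> 1"
    proof (rule eq1[OF unimodular[OF \<gamma>(1) xyz(1)]])
      show "\<theta> x * \<gamma> x = 1"
        using bad[OF unitary_character_product[OF \<theta>(1) \<gamma>(1)]] \<gamma> that one by auto
      show "\<theta> x * cnj (\<gamma> x) = 1"
        using bad[OF unitary_character_product[OF \<theta>(1) unitary_character_cnj[OF \<gamma>(1)]]] \<gamma> that one by auto
    qed fact
    moreover have "\<theta> x = - 1" if "\<theta> z = 1" "\<theta> y \<noteq> 1"
    proof (rule eq1[OF unimodular[OF \<beta>(1) xyz(1)]])
      show "\<theta> x * \<beta> x = 1"
        using bad[OF unitary_character_product[OF \<theta>(1) \<beta>(1)]] \<beta> that one by auto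
      show "\<theta> x * cnj (\<beta> x) = 1"
        using bad[OF unitary_character_product[OF \<theta>(1) unitary_character_cnj[OF \<beta>(1)]]] \<beta> that one by auto
    qed fact
    ultimately show ?thesis using bad[OF \<theta>(1)] \<theta>(2) by blast
  qed
  show "x \<otimes> x = \<one>"
  proof (rule ccontr)
    assume "x \<otimes> x \<noteq> \<one>"
    then obtain \<theta> where \<theta>: "unitary_character H \<theta>" "\<theta> (x \<otimes> x) \<noteq> 1"
      using separate[of "x \<otimes> x"] xyz H by (auto simp: subgroup.m_closed)
    then have "\<theta> x * \<theta> x \<noteq> 1" using xyz by (simp add: unitary_character_def)
    then show False using main[OF \<theta>(1)] by fastforce
  qed
qed

text \<open>By the preceding lemma and its permutations, the values of a character at the three
  elements are all 1, or one is 1 and two are -1. Their product is 1 in either case, and characters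
  separate points.\<close>

lemma product_if_no_character_nontrivial_at_three:
  assumes xyz: "x \<in> H" "y \<in> H" "z \<in> H" "x \<noteq> \<one>" "y \<noteq> \<one>" "z \<noteq> \<one>"
    and bad: "\<And>\<theta>. unitary_character H \<theta> \<Longrightarrow> \<theta> x = 1 \<or> \<theta> y = 1 \<or> \<theta> z = 1"
  shows "x \<otimes> y \<otimes> z = \<one>"
proof (rule ccontr)
  assume "x \<otimes> y \<otimes> z \<noteq> \<one>"
  then obtain \<theta> where \<theta>: "unitary_character H \<theta>" "\<theta> (x \<otimes> y \<otimes> z) \<noteq> 1"
    using separate[of "x \<otimes> y \<otimes> z"] xyz H by (auto simp: subgroup.m_closed)
  then have ne: "\<theta> x * \<theta> y * \<theta> z \<noteq> 1"
    using xyz H by (simp add: unitary_character_def subgroup.m_closed)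
  have x: "\<theta> x = 1 \<or> \<theta> x = - 1 \<and> (\<theta> y = 1 \<longleftrightarrow> \<theta> z \<noteq> 1)"
    using square_if_no_character_nontrivial_at_three(2)[of x y z, OF xyz bad \<theta>(1)] by blast
  have y: "\<theta> y = 1 \<or> \<theta> y = - 1 \<and> (\<theta> x = 1 \<longleftrightarrow> \<theta> z \<noteq> 1)"
    using square_if_no_character_nontrivial_at_three(2)[of y x z \<theta>] xyz bad \<theta>(1) by blast
  have z: "\<theta> z = 1 \<or> \<theta> z = - 1 \<and> (\<theta> x = 1 \<longleftrightarrow> \<theta> y \<noteq> 1)"
    using square_if_no_character_nontrivial_at_three(2)[of z x y \<theta>] xyz bad \<theta>(1) by blast
  show False using x y z ne by fastforce
qed

end

section \<open>Normal closures and commuting elements\<close>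

definition normal_closure :: "'a \<Rightarrow> 'a set" where
  "normal_closure x = \<Inter>{N. N \<lhd> G \<and> x \<in> N}"

lemma normal_closure_normal:
  assumes "x \<in> carrier G"
  shows "normal_closure x \<lhd> G"
proof -
  have "carrier G \<lhd> G" by (simp add: normal_inv_iff subgroup_self)
  then have "subgroup (normal_closure x) G"
    unfolding normal_closure_def
    by (intro subgroups_Inter) (use assms in \<open>auto simp: normal_inv_iff\<close>)
  then show ?thesis by (auto simp: normal_inv_iff normal_closure_def)
qed

lemma normal_closure_subset: "\<lbrakk>N \<lhd> G; x \<in> N\<rbrakk> \<Longrightarrow> normal_closure x \<subseteq> N"
  by (auto simp: normal_closure_def)

lemma normal_closure_self: "x \<in> normal_closure x"
  by (auto simp: normal_closure_def)

text \<open>If the subgroups meet nontrivially, a common element serves as both \<open>x\<close> and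
  \<open>y\<close>; otherwise they centralise each other.\<close>

lemma commuting_elements_of_normal_subgroups:
  assumes A: "A \<lhd> G" "A \<noteq> {\<one>}" and B: "B \<lhd> G" "B \<noteq> {\<one>}"
  obtains x y where "x \<in> A" "y \<in> B" "x \<noteq> \<one>" "y \<noteq> \<one>" "x \<otimes> y = y \<otimes> x"
proof (cases "A \<inter> B \<subseteq> {\<one>}")
  case True
  have "\<one> \<in> A" "\<one> \<in> B" using A B by (auto simp: normal_inv_iff subgroup.one_closed)
  then obtain x y where "x \<in> A" "y \<in> B" "x \<noteq> \<one>" "y \<noteq> \<one>" using A B by blast
  then show thesis using that normal_imp_commuting[OF A(1) B(1) True] by blast
qed (use that in blast)

lemma klein_four_subgroup:
  assumes x: "x \<in> carrier G" "x \<otimes> x = \<one>" "x \<noteq> \<one>" and y: "y \<in> carrier G" "y \<otimes> y = \<one>" "y \<noteq> \<one>"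
    and xy: "x \<noteq> y" "x \<otimes> y = y \<otimes> x"
  shows "subgroup {\<one>, x, y, x \<otimes> y} G"
    and "G\<lparr>carrier := {\<one>, x, y, x \<otimes> y}\<rparr> \<cong> integer_mod_group 2 \<times>\<times> integer_mod_group 2"
proof -
  have xxy: "x \<otimes> (x \<otimes> y) = y" "x \<otimes> y \<otimes> y = x"
    using x y by (simp add: m_assoc[symmetric], simp add: m_assoc)
  have xyx: "x \<otimes> y \<otimes> x = y" using x y xxy(1) by (simp add: m_assoc xy(2)[symmetric])
  have yxy: "y \<otimes> (x \<otimes> y) = x" using x y by (simp add: xy(2) m_assoc[symmetric])
  have xyxy: "x \<otimes> y \<otimes> (x \<otimes> y) = \<one>" using yxy x y by (simp add: m_assoc)
  note eqs = xxy xyx yxy xyxy xy(2)[symmetric]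
  have invs: "inv x = x" "inv y = y" "inv (x \<otimes> y) = x \<otimes> y"
    by (rule inv_equality; use x y xyxy in simp)+
  show sub: "subgroup {\<one>, x, y, x \<otimes> y} G"
    by (rule subgroupI) (use x y in \<open>auto simp: eqs invs\<close>)
  define f where "f = (\<lambda>(a :: int, b :: int). (if a = 0 then \<one> else x) \<otimes> (if b = 0 then \<one> else y))"
  have two: "{0..<2 :: int} = {0, 1}" by auto
  have dist: "x \<otimes> y \<noteq> \<one>" "x \<otimes> y \<noteq> x" "x \<otimes> y \<noteq> y"
    using x y xy(1) inv_equality[of x y] invs(2) by auto
  have dom: "carrier (integer_mod_group 2 \<times>\<times> integer_mod_group 2) = {(0, 0), (0, 1), (1, 0), (1, 1)}"
    by (auto simp: carrier_integer_mod_group two)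
  have f: "f (0, 0) = \<one>" "f (0, 1) = y" "f (1, 0) = x" "f (1, 1) = x \<otimes> y"
    using x y by (simp_all add: f_def)
  have "f \<in> iso (integer_mod_group 2 \<times>\<times> integer_mod_group 2) (G\<lparr>carrier := {\<one>, x, y, x \<otimes> y}\<rparr>)"
  proof (rule isoI)
    show "f \<in> hom (integer_mod_group 2 \<times>\<times> integer_mod_group 2) (G\<lparr>carrier := {\<one>, x, y, x \<otimes> y}\<rparr>)"
      unfolding hom_def dom using x y by (simp add: f eqs)
    show "bij_betw f (carrier (integer_mod_group 2 \<times>\<times> integer_mod_group 2))
        (carrier (G\<lparr>carrier := {\<one>, x, y, x \<otimes> y}\<rparr>))"
      unfolding bij_betw_def inj_on_def dom using x(3) y(3) xy(1) dist
      by (simp add: f) (simp only: insert_commute[of y x])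
  qed
  then have "integer_mod_group 2 \<times>\<times> integer_mod_group 2 \<cong> G\<lparr>carrier := {\<one>, x, y, x \<otimes> y}\<rparr>"
    by (auto simp: is_iso_def)
  then show "G\<lparr>carrier := {\<one>, x, y, x \<otimes> y}\<rparr> \<cong> integer_mod_group 2 \<times>\<times> integer_mod_group 2"
    by (rule group.iso_sym[rotated]) (simp add: DirProd_group)
qed

end

section \<open>Property P(3)\<close>

text \<open>The vectors fixed by \<open>z\<close> form a closed subspace, invariant because
  \<open>z\<close> is central and proper because \<open>z\<close> acts nontrivially, so it is zero.
  As \<open>z\<close> is an involution, \<open>\<pi> z v\<close> plus \<open>v\<close> is
  fixed.\<close>

lemma (in irreducible_unitary_representation) central_involution:
  assumes z: "z \<in> group_centre G" "z \<otimes>\<^bsub>G\<^esub> z = \<one>\<^bsub>G\<^esub>"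
    and nontrivial: "\<pi> z \<noteq> \<one>\<^bsub>unitary_group V\<^esub>" and v: "v \<in> carrier V"
  shows "\<pi> z v = \<ominus>\<^bsub>V\<^esub> v"
proof -
  have zG: "z \<in> carrier G" and central: "\<And>g. g \<in> carrier G \<Longrightarrow> z \<otimes>\<^bsub>G\<^esub> g = g \<otimes>\<^bsub>G\<^esub> z"
    using z(1) unfolding group_centre_def by blast+
  have zz: "\<pi> z (\<pi> z u) = u" if "u \<in> carrier V" for u
    using rep_mult[OF zG zG that] z(2) rep_one[OF that] by simp
  define W where "W = {u \<in> carrier V. \<pi> z u = u}"
  have minus: "\<pi> z (\<ominus>\<^bsub>V\<^esub> u) = \<ominus>\<^bsub>V\<^esub> \<pi> z u" if u: "u \<in> carrier V" for u
  proof -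
    have "\<pi> z (\<ominus>\<^bsub>V\<^esub> u) \<oplus>\<^bsub>V\<^esub> \<pi> z u = \<pi> z \<zero>\<^bsub>V\<^esub>"
      using rep_add[OF zG, of "\<ominus>\<^bsub>V\<^esub> u" u] u by (simp add: V.l_neg)
    also have "\<dots> = \<zero>\<^bsub>V\<^esub>"
      using rep_add[OF zG V.zero_closed V.zero_closed] zG V.add.l_cancel_one' by simp
    finally show ?thesis using u zG by (simp add: V.minus_equality)
  qed
  have "submodule W complex_field V"
    by (rule V.submoduleI)
      (use rep_add[OF zG V.zero_closed V.zero_closed] zG V.smult_closed in
        \<open>auto simp: W_def minus rep_add rep_smult\<close>)
  moreover have "closedin V.metric.mtopology W"
    unfolding V.metric.closedin_metric
  proof (intro conjI allI impI)
    show "W \<subseteq> carrier V" by (auto simp: W_def)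
    fix x assume x: "x \<in> carrier V - W"
    have d: "hdist V (\<pi> z a) (\<pi> z b) = hdist V a b" if "a \<in> carrier V" "b \<in> carrier V" for a b
      using that zG by (simp add: hdist_def V.hinner_minus_left V.hinner_minus_right rep_hinner)
    \<comment> \<open>Half the displacement of \<open>x\<close>: a fixed \<open>y\<close> within
      distance \<open>r\<close> of \<open>x\<close> would be within \<open>r\<close> of
      \<open>\<pi> z x\<close> too, against the triangle inequality.\<close>
    define r where "r = hdist V (\<pi> z x) x / 2"
    have "\<pi> z x \<noteq> x" using x by (auto simp: W_def)
    then have r: "r > 0"
      using x zG V.metric.mdist_pos_less[of "\<pi> z x" x] by (simp add: r_def)
    have "y \<notin> W" if y: "y \<in> carrier V" "hdist V x y < r" for y
    proof
      assume "y \<in> W"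
      then have "hdist V (\<pi> z x) x \<le> hdist V (\<pi> z x) (\<pi> z y) + hdist V y x"
        using V.metric.triangle[of "\<pi> z x" y x] x zG by (simp add: W_def)
      then show False using d[of x y] x y V.metric.commute[of x y] by (simp add: r_def)
    qed
    then show "\<exists>r>0. disjnt W (V.metric.mball x r)"
      using r by (intro exI[of _ r]) (auto simp: disjnt_iff V.metric.in_mball)
  qed
  ultimately have closed: "closed_subspace W V" by (simp add: closed_subspace_def)
  have "\<pi> g ` W \<subseteq> W" if g: "g \<in> carrier G" for g
  proof
    fix y assume "y \<in> \<pi> g ` W"
    then obtain u where u: "u \<in> carrier V" "\<pi> z u = u" "y = \<pi> g u" by (auto simp: W_def)
    have "\<pi> z (\<pi> g u) = \<pi> (z \<otimes>\<^bsub>G\<^esub> g) u" using zG g u by (simp add: rep_mult)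
    also have "\<dots> = \<pi> g u" unfolding central[OF g] using zG g u by (simp add: rep_mult)
    finally show "y \<in> W" using g u by (simp add: W_def)
  qed
  then have "W = {\<zero>\<^bsub>V\<^esub>} \<or> W = carrier V" using irreducible[OF closed] by blast
  moreover have "W \<noteq> carrier V"
    using nontrivial rep_eq_one_iff[OF zG] by (auto simp: W_def)
  moreover have "\<pi> z v \<oplus>\<^bsub>V\<^esub> v \<in> W"
    using v zG by (simp add: W_def rep_add zz V.a_comm)
  ultimately have "\<pi> z v \<oplus>\<^bsub>V\<^esub> v = \<zero>\<^bsub>V\<^esub>" by blast
  then show ?thesis using v zG by (simp add: V.minus_equality)
qed

lemma (in group) not_property_P_3_if_central_klein_four:
  assumes H: "subgroup H G" "H \<subseteq> group_centre G"
    and iso: "G\<lparr>carrier := H\<rparr> \<cong> integer_mod_group 2 \<times>\<times> integer_mod_group 2"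
  shows "\<not> property_P G 3"
proof
  assume P: "property_P G 3"
  let ?K = "integer_mod_group 2 \<times>\<times> integer_mod_group 2"
  have "?K \<cong> G\<lparr>carrier := H\<rparr>"
    using group.iso_sym[OF subgroup_imp_group[OF H(1)] iso] .
  then obtain f where f: "f \<in> hom ?K (G\<lparr>carrier := H\<rparr>)" "bij_betw f (carrier ?K) H"
    by (auto simp: is_iso_def iso_def)
  have K: "carrier ?K = {0, 1} \<times> {0, 1}"
    by (auto simp: carrier_integer_mod_group)
  have mult: "f (a \<otimes>\<^bsub>?K\<^esub> b) = f a \<otimes> f b" if "a \<in> carrier ?K" "b \<in> carrier ?K" for a b
  proof -
    have "f d = f a \<otimes> f b" if "f d = f a \<otimes>\<^bsub>G\<lparr>carrier := H\<rparr>\<^esub> f b" for d using that by simp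
    then show ?thesis using hom_mult[OF f(1) that] .
  qed
  have one: "f (0, 0) = \<one>"
    using hom_one[OF f(1)] DirProd_group[OF group_integer_mod_group group_integer_mod_group]
      subgroup_imp_group[OF H(1)] by simp
  define x where "x = f (1, 0)"
  define y where "y = f (0, 1)"
  have inj: "f a = f b \<longleftrightarrow> a = b" if "a \<in> carrier ?K" "b \<in> carrier ?K" for a b
    using f(2) that by (auto simp: bij_betw_def dest: inj_onD)
  have ne: "x \<noteq> \<one>" "y \<noteq> \<one>" "f (1, 1) \<noteq> \<one>"
    unfolding x_def y_def one[symmetric] by (subst inj; simp add: K)+
  have xy: "f (1, 1) = x \<otimes> y" "x \<otimes> x = \<one>" "y \<otimes> y = \<one>"
    using mult[of "(1, 0)" "(0, 1)"] mult[of "(1, 0)" "(1, 0)"] mult[of "(0, 1)" "(0, 1)"]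
    unfolding x_def y_def K by (simp_all add: one)
  have inH: "x \<in> H" "y \<in> H"
    using f(2) unfolding x_def y_def bij_betw_def K by auto
  then have centre: "x \<in> group_centre G" "y \<in> group_centre G" using H by auto
  then have c: "x \<in> carrier G" "y \<in> carrier G" unfolding group_centre_def by blast+
  have "card {x, y, x \<otimes> y} \<le> 3" by (simp add: card_insert_if)
  then have "irreducibly_faithful G {x, y, x \<otimes> y}" using P c by (simp add: property_P_def)
  then obtain V :: "('a \<Rightarrow> complex) hilbert" and \<pi>
    where irr: "irreducible_unitary_representation G V \<pi>"
      and faithful: "\<And>g. \<lbrakk>g \<in> {x, y, x \<otimes> y}; g \<noteq> \<one>\<rbrakk> \<Longrightarrow> \<pi> g \<noteq> \<one>\<^bsub>unitary_group V\<^esub>"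
    unfolding irreducibly_faithful_def by blast
  interpret irreducible_unitary_representation G V \<pi> by (rule irr)
  have "\<pi> (x \<otimes> y) v = v" if v: "v \<in> carrier V" for v
  proof -
    have "\<pi> x (\<pi> y v) = \<ominus>\<^bsub>V\<^esub> (\<pi> y v)"
      using central_involution[OF centre(1) xy(2) faithful] ne v c by simp
    also have "\<dots> = v"
      using central_involution[OF centre(2) xy(3) faithful v] ne v by simp
    finally show ?thesis using rep_mult[OF c v] by simp
  qed
  then show False using faithful[of "x \<otimes> y"] ne xy rep_eq_one_iff[of "x \<otimes> y"] c by simp
qed

section \<open>Triples that are not irreducibly faithful\<close>

lemma (in group) irreducibly_faithful_mono:
  assumes "irreducibly_faithful G F" "F' \<subseteq> F"
  shows "irreducibly_faithful G F'"
  using assms unfolding irreducibly_faithful_def by blast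

lemma (in group) irreducibly_faithful_triple:
  assumes count: "countable (carrier G)"
    and no_klein_four: "\<not> (\<exists>H. subgroup H G \<and> H \<subseteq> group_centre G \<and>
      G\<lparr>carrier := H\<rparr> \<cong> integer_mod_group 2 \<times>\<times> integer_mod_group 2)"
    and carrier: "a \<in> carrier G" "b \<in> carrier G" "c \<in> carrier G"
    and ne: "a \<noteq> \<one>" "b \<noteq> \<one>" "c \<noteq> \<one>"
  shows "irreducibly_faithful G {a, b, c}"
proof (rule ccontr)
  assume unfaithful: "\<not> irreducibly_faithful G {a, b, c}"
  define A where "A = normal_closure a"
  define B where "B = normal_closure b"
  define C where "C = normal_closure c"
  have normal: "A \<lhd> G" "B \<lhd> G" "C \<lhd> G"
    using carrier by (simp_all add: A_def B_def C_def normal_closure_normal)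
  have sub: "A \<subseteq> carrier G" "B \<subseteq> carrier G" "C \<subseteq> carrier G"
    using normal by (auto simp: normal_inv_iff dest: subgroup.subset)
  have nontrivial: "A \<noteq> {\<one>}" "B \<noteq> {\<one>}" "C \<noteq> {\<one>}"
    using ne normal_closure_self by (auto simp: A_def B_def C_def)
  \<comment> \<open>Unfaithfulness enters here only. A normal subgroup that contains one of
    \<open>a\<close>, \<open>b\<close>, \<open>c\<close> contains its normal closure.\<close>
  have no_character: "\<theta> x = 1 \<or> \<theta> y = 1 \<or> \<theta> z = 1"
    if "unitary_character H \<theta>" "x \<in> A \<inter> H" "y \<in> B \<inter> H" "z \<in> C \<inter> H" for H \<theta> x y z
  proof (rule ccontr)
    assume good: "\<not> (\<theta> x = 1 \<or> \<theta> y = 1 \<or> \<theta> z = 1)"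
    have "irreducibly_faithful G {a, b, c}"
    proof (rule irreducibly_faithful_if_character[OF count that(1)])
      fix g N assume N: "g \<in> {a, b, c}" "N \<lhd> G" "g \<in> N"
      then have "A \<subseteq> N \<or> B \<subseteq> N \<or> C \<subseteq> N"
        using normal_closure_subset by (auto simp: A_def B_def C_def)
      then show "\<exists>y\<in>N \<inter> H. \<theta> y \<noteq> 1" using that good by blast
    qed (use carrier in simp)
    then show False using unfaithful by simp
  qed
  \<comment> \<open>Two commuting elements that together meet all three normal closures are
    excluded, since some character is nontrivial at both.\<close>
  have two: False
    if xy: "x \<in> carrier G" "y \<in> carrier G" "x \<noteq> \<one>" "y \<noteq> \<one>" "x \<otimes> y = y \<otimes> x"
      and mem: "A \<inter> {x, y} \<noteq> {}" "B \<inter> {x, y} \<noteq> {}" "C \<inter> {x, y} \<noteq> {}" for x y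
  proof -
    obtain H where H: "subgroup H G" "{x, y} \<subseteq> H"
      "\<And>w. \<lbrakk>w \<in> H; w \<noteq> \<one>\<rbrakk> \<Longrightarrow> \<exists>\<theta>. unitary_character H \<theta> \<and> \<theta> w \<noteq> 1"
      by (rule characters_of_commuting_set_separate[OF count, of "{x, y}"]) (use xy in auto)
    obtain \<theta> where \<theta>: "unitary_character H \<theta>" "\<theta> x \<noteq> 1" "\<theta> y \<noteq> 1"
      by (rule character_nontrivial_at_two[OF H(1,3), of x y]) (use H(2) xy in auto)
    obtain x' y' z' where "x' \<in> A \<inter> {x, y}" "y' \<in> B \<inter> {x, y}" "z' \<in> C \<inter> {x, y}"
      using mem by blast
    then show False using no_character[OF \<theta>(1), of x' y' z'] \<theta>(2,3) H(2) by auto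
  qed
  \<comment> \<open>A nontrivial element of the intersection serves for two of the closures and can
    be chosen to commute with a nontrivial element of the third. Stating \<open>perm\<close> as an
    equality of sets covers all three choices.\<close>
  have pair: False
    if A': "A' \<lhd> G" "B' \<lhd> G" "\<not> A' \<inter> B' \<subseteq> {\<one>}" and C': "C' \<lhd> G" "C' \<noteq> {\<one>}"
      and perm: "{A', B', C'} = {A, B, C}" for A' B' C'
  proof -
    have "A' \<inter> B' \<noteq> {\<one>}" using A'(3) by blast
    then obtain x y where xy: "x \<in> A' \<inter> B'" "y \<in> C'" "x \<noteq> \<one>" "y \<noteq> \<one>" "x \<otimes> y = y \<otimes> x"
      using commuting_elements_of_normal_subgroups[OF normal_subgroup_intersect[OF A'(1,2)] _ C'] by blast
    have "x \<in> carrier G" "y \<in> carrier G"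
      using xy A' C' by (auto simp: normal_inv_iff dest: subgroup.mem_carrier)
    moreover have "\<forall>M\<in>{A, B, C}. M \<inter> {x, y} \<noteq> {}" using xy unfolding perm[symmetric] by blast
    ultimately show False using two[OF _ _ xy(3-5)] by blast
  qed
  have disjoint: "A \<inter> B \<subseteq> {\<one>}" "A \<inter> C \<subseteq> {\<one>}" "B \<inter> C \<subseteq> {\<one>}"
  proof -
    show "A \<inter> B \<subseteq> {\<one>}" using pair[of A B C] normal nontrivial by blast
    show "A \<inter> C \<subseteq> {\<one>}" using pair[of A C B] normal nontrivial by blast
    show "B \<inter> C \<subseteq> {\<one>}" using pair[of B C A] normal nontrivial by blast
  qed
  have commute: "x \<otimes> y = y \<otimes> x" "x \<otimes> z = z \<otimes> x" "y \<otimes> z = z \<otimes> y"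
    if "x \<in> A" "y \<in> B" "z \<in> C" for x y z
    using normal_imp_commuting[OF normal(1,2) disjoint(1)] normal_imp_commuting[OF normal(1,3) disjoint(2)]
      normal_imp_commuting[OF normal(2,3) disjoint(3)] that by blast+
  have relations: "x \<otimes> y \<otimes> z = \<one>" "x \<otimes> x = \<one>" "y \<otimes> y = \<one>"
    if xyz: "x \<in> A" "y \<in> B" "z \<in> C" and xyz1: "x \<noteq> \<one>" "y \<noteq> \<one>" "z \<noteq> \<one>" for x y z
  proof -
    obtain H where H: "subgroup H G" "{x, y, z} \<subseteq> H"
      "\<And>w. \<lbrakk>w \<in> H; w \<noteq> \<one>\<rbrakk> \<Longrightarrow> \<exists>\<theta>. unitary_character H \<theta> \<and> \<theta> w \<noteq> 1"
      by (rule characters_of_commuting_set_separate[OF count, of "{x, y, z}"])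
        (use xyz sub commute[OF xyz] in auto)
    have bad: "\<theta> x = 1 \<or> \<theta> y = 1 \<or> \<theta> z = 1" if "unitary_character H \<theta>" for \<theta>
      using no_character[OF that, of x y z] xyz H(2) by blast
    have bad': "\<theta> y = 1 \<or> \<theta> x = 1 \<or> \<theta> z = 1" if "unitary_character H \<theta>" for \<theta>
      using bad[OF that] by blast
    have m: "x \<in> H" "y \<in> H" "z \<in> H" using H(2) by auto
    show "x \<otimes> y \<otimes> z = \<one>"
      by (rule product_if_no_character_nontrivial_at_three[OF H(1,3) m xyz1 bad])
    show "x \<otimes> x = \<one>"
      by (rule square_if_no_character_nontrivial_at_three(1)[OF H(1,3) m xyz1 bad])
    show "y \<otimes> y = \<one>"
      by (rule square_if_no_character_nontrivial_at_three(1)[OF H(1,3) m(2,1,3) xyz1(2,1,3) bad'])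
  qed
  have self: "a \<in> A" "b \<in> B" "c \<in> C"
    using normal_closure_self by (simp_all add: A_def B_def C_def)
  \<comment> \<open>Both \<open>x\<close> and \<open>a\<close> are inverse to
    \<open>b \<otimes> c\<close>, so \<open>A\<close> has order 2.\<close>
  have A_eq: "x = a" if "x \<in> A" "x \<noteq> \<one>" for x
  proof -
    have x: "x \<in> carrier G" using that sub by blast
    have "x \<otimes> (b \<otimes> c) = a \<otimes> (b \<otimes> c)"
      using relations(1)[OF that(1) self(2,3) that(2) ne(2,3)] relations(1)[OF self ne] x carrier
      by (simp add: m_assoc)
    then show ?thesis using x carrier by simp
  qed
  have B_eq: "y = b" if "y \<in> B" "y \<noteq> \<one>" for y
  proof -
    have y: "y \<in> carrier G" using that sub by blast
    have "a \<otimes> y \<otimes> c = a \<otimes> b \<otimes> c"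
      using relations(1)[OF self(1) that(1) self(3) ne(1) that(2) ne(3)] relations(1)[OF self ne]
      by simp
    then show ?thesis using y carrier by simp
  qed
  \<comment> \<open>Conjugation permutes the nontrivial elements of a normal subgroup, so it fixes
    the only one.\<close>
  have central: "x \<in> group_centre G"
    if N: "N \<lhd> G" "x \<in> N" "x \<noteq> \<one>" "\<And>y. \<lbrakk>y \<in> N; y \<noteq> \<one>\<rbrakk> \<Longrightarrow> y = x" for N x
  proof -
    have x: "x \<in> carrier G" using N(2) subgroup.mem_carrier[OF normal_imp_subgroup[OF N(1)]] by blast
    have "x \<otimes> g = g \<otimes> x" if g: "g \<in> carrier G" for g
    proof -
      have "g \<otimes> x \<otimes> inv g \<in> N" using N(1,2) g by (simp add: normal_inv_iff)
      moreover have "g \<otimes> x \<otimes> inv g \<noteq> \<one>"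
      proof
        assume "g \<otimes> x \<otimes> inv g = \<one>"
        then have "g \<otimes> x \<otimes> inv g \<otimes> g = g" using g by simp
        then have "g \<otimes> x = g" using g x by (simp add: m_assoc)
        then show False using g x N(3) by simp
      qed
      ultimately have "g \<otimes> x \<otimes> inv g = x" by (rule N(4))
      then have "g \<otimes> x \<otimes> inv g \<otimes> g = x \<otimes> g" by simp
      then show ?thesis using g x by (simp add: m_assoc)
    qed
    then show ?thesis using x unfolding group_centre_def by blast
  qed
  have ab_centre: "a \<in> group_centre G" "b \<in> group_centre G"
    using central[OF normal(1) self(1) ne(1) A_eq] central[OF normal(2) self(2) ne(2) B_eq] by auto
  have "a \<noteq> b" using disjoint(1) self ne by blast
  note klein = klein_four_subgroup[OF carrier(1) relations(2)[OF self ne] ne(1) carrier(2)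
      relations(3)[OF self ne] ne(2) this commute(1)[OF self]]
  have "{\<one>, a, b, a \<otimes> b} \<subseteq> group_centre G"
  proof -
    have "a \<otimes> b \<otimes> g = g \<otimes> (a \<otimes> b)" if g: "g \<in> carrier G" for g
    proof -
      have "a \<otimes> b \<otimes> g = a \<otimes> (b \<otimes> g)" using g carrier by (simp add: m_assoc)
      also have "b \<otimes> g = g \<otimes> b" using ab_centre(2) g unfolding group_centre_def by blast
      also have "a \<otimes> (g \<otimes> b) = a \<otimes> g \<otimes> b" using g carrier by (simp add: m_assoc)
      also have "a \<otimes> g = g \<otimes> a" using ab_centre(1) g unfolding group_centre_def by blast
      finally show ?thesis using g carrier by (simp add: m_assoc)
    qed
    then have "a \<otimes> b \<in> group_centre G" using carrier unfolding group_centre_def by simp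
    moreover have "\<one> \<in> group_centre G" by (simp add: group_centre_def)
    ultimately show ?thesis using ab_centre by blast
  qed
  then show False using no_klein_four klein by blast
qed

theorem corollary1p2:
  fixes G :: "('a, 'b) monoid_scheme"
  assumes "group G"
    and "countable (carrier G)"
  shows "property_P G 3 \<longleftrightarrow>
    \<not> (\<exists>H. subgroup H G \<and> H \<subseteq> group_centre G \<and>
          G\<lparr>carrier := H\<rparr> \<cong> integer_mod_group 2 \<times>\<times> integer_mod_group 2)"
proof -
  interpret group G by (rule assms(1))
  show ?thesis
  proof (intro iffI notI)
    assume no_klein_four: "\<not> (\<exists>H. subgroup H G \<and> H \<subseteq> group_centre G \<and>
          G\<lparr>carrier := H\<rparr> \<cong> integer_mod_group 2 \<times>\<times> integer_mod_group 2)"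
    show "property_P G 3"
      unfolding property_P_def
    proof (intro allI impI)
      fix F assume F: "F \<subseteq> carrier G \<and> finite F \<and> card F \<le> 3"
      show "irreducibly_faithful G F"
      proof (cases "F \<subseteq> {\<one>\<^bsub>G\<^esub>}")
        case True
        \<comment> \<open>Nothing has to be separated, but an irreducible representation must exist;
          the trivial subgroup supplies one.\<close>
        have "unitary_character {\<one>\<^bsub>G\<^esub>} (\<lambda>_. 1)"
          by (simp add: unitary_character_def triv_subgroup)
        then show ?thesis
          by (rule irreducibly_faithful_if_character[OF assms(2)]) (use F True in auto)
      next
        case False
        then obtain d where d: "d \<in> F" "d \<noteq> \<one>\<^bsub>G\<^esub>" by blast
        obtain as where as: "set as = F" "length as \<le> 3"
          using F finite_distinct_list by (metis distinct_card)
        obtain a b c where abc: "F \<subseteq> {a, b, c}"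
        proof
          \<comment> \<open>For a shorter list some of these entries are unspecified;
            \<open>r\<close> replaces any that lie outside \<open>F\<close>.\<close>
          show "F \<subseteq> {as ! 0, as ! 1, as ! 2}"
          proof
            fix g assume "g \<in> F"
            then obtain i where i: "i < length as" "g = as ! i"
              unfolding as(1)[symmetric] in_set_conv_nth by blast
            then have "i = 0 \<or> i = 1 \<or> i = 2" using as(2) by linarith
            then show "g \<in> {as ! 0, as ! 1, as ! 2}" using i(2) by blast
          qed
        qed
        \<comment> \<open>The lemma on triples asks for three nontrivial elements, so the unit and
          values outside \<open>F\<close> are replaced by \<open>d\<close>; the unit is put back
          afterwards.\<close>
        define r where "r = (\<lambda>g. if g \<in> F \<and> g \<noteq> \<one>\<^bsub>G\<^esub> then g else d)"
        have r: "r g \<in> carrier G" "r g \<noteq> \<one>\<^bsub>G\<^esub>" for g using d F by (auto simp: r_def)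
        have "irreducibly_faithful G {r a, r b, r c}"
          by (rule irreducibly_faithful_triple[OF assms(2) no_klein_four]) (use r in auto)
        then have "irreducibly_faithful G (insert \<one>\<^bsub>G\<^esub> {r a, r b, r c})"
          unfolding irreducibly_faithful_def by blast
        moreover have "F \<subseteq> insert \<one>\<^bsub>G\<^esub> {r a, r b, r c}"
        proof
          fix g assume g: "g \<in> F"
          then have "g = \<one>\<^bsub>G\<^esub> \<or> g = r g" by (simp add: r_def)
          moreover have "r g \<in> {r a, r b, r c}" using abc g by blast
          ultimately show "g \<in> insert \<one>\<^bsub>G\<^esub> {r a, r b, r c}" by auto
        qed
        ultimately show ?thesis by (rule irreducibly_faithful_mono)
      qed
    qed
  qed (metis not_property_P_3_if_central_klein_four)
qed

end
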